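(* Let $n\geq 2$ be an integer and let $p\in(0,\infty]$. With $V(t)$ and $S_q(t)$ denoting the hyper-volume and hyper-$q$-area functions on $[0,\pi_p/2]$ defined in the context, the following hold. (i) The relative hyper-volume and the relative hyper-$p$-area coincide, that is, $$\frac{V(t)}{V(\pi_p/2)}=\frac{S_p(t)}{S_p(\pi_p/2)}\qquad\text{for all } t\in[0,\pi_p/2],$$ if and only if $p\in\{1,2,\infty\}$. (ii) Moreover, they also coincide with the relative hyper-$2$-area, that is, $$\frac{V(t)}{V(\pi_p/2)}=\frac{S_p(t)}{S_p(\pi_p/2)}=\frac{S_2(t)}{S_2(\pi_p/2)}\qquad\text{for all } t\in[0,\pi_p/2],$$ if and only if $p\in\{1,2,\infty\}$.
   Context: For $p\in(0,\infty)$ and $x\in\mathbb{R}^m$ put $\|x\|_p=(\sum_{i=1}^m|x_i|^p)^{1/p}$, and put $\|x\|_\infty=\max_i|x_i|$ (these are called $p$-norms for all $p\in(0,\infty]$, including $p<1$). Let $\pi_p$ be the (Lebesgue) area of $\{x\in\mathbb{R}^2:\|x\|_p\le 1\}$. Squigonometric functions. Only their values on $[0,\pi_p/2]$ are needed. For $p<\infty$, $\cos_p=C$ and $\sin_p=S$ are the continuous functions on $[0,\pi_p/2]$, positive on $(0,\pi_p/2)$, that solve $C'(t)=-S(t)^{p-1}$, $S'(t)=C(t)^{p-1}$ on $(0,\pi_p/2)$ with $C(0)=1$, $S(0)=0$. They satisfy $\cos_p(t)^p+\sin_p(t)^p=1$, $\cos_p(\pi_p/2)=0$, $\sin_p(\pi_p/2)=1$.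 For $p=\infty$ (where $\pi_\infty=4$), $\cos_\infty(t)=\min(1,2-t)$ and $\sin_\infty(t)=\min(1,t)$ for $t\in[0,2]$. Thus $t\mapsto(\cos_p(t),\sin_p(t))$ parametrizes the part of the unit $p$-circle in the closed first quadrant. Unsigned sphere. $|\mathrm{Sph}^m_p|=\{x\in\mathbb{R}^m: x_i\ge 0\ \forall i,\ \|x\|_p=1\}$ (so $|\mathrm{Sph}^1_p|=\{1\}$). The points of $|\mathrm{Sph}^n_p|$ are parametrized as $(\sin_p(t)\,x,\ \cos_p(t))$ with $t\in[0,\pi_p/2]$ and $x\in|\mathrm{Sph}^{n-1}_p|$. For $t_0\in[0,\pi_p/2]$ define the cap $$K(t_0)=\{(\sin_p(t)\,x,\cos_p(t)) : t\in[0,t_0],\ x\in|\mathrm{Sph}^{n-1}_p|\}\subset\mathbb{R}^n .$$ Hyper-volume. $V(t_0)$ is the $n$-dimensional volume (Lebesgue measure) of the cone $\{s\,y: s\in[0,1],\ y\in K(t_0)\}$ over the cap. Hyper-$q$-area. For $q\in(0,\infty]$, $S_q(t_0)$ is the $q$-area of the cap $K(t_0)$, i.e. its $(n-1)$-dimensional measure when $\mathbb{R}^n$ is endowed with the $q$-norm: the $(n-1)$-dimensional Hausdorff measure with respect to the distance $\|x-y\|_q$. (A normalizing constant is irrelevant, since only ratios occur.) For $n=2$ this is the $q$-length of the arc $K(t_0)$, i.e. $\int_0^{t_0}\|(\cos_p'(t),\sin_p'(t))\|_q\,dt$. Only $q=p$ and $q=2$ (Euclidean area) are used. *)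

theory Defs
  imports "HOL-Analysis.Analysis"
begin

text \<open>The space \<open>\<real>\<^sup>n\<close> with \<open>n \<ge> 2\<close> is rendered as \<open>'a \<times> real\<close>, where \<open>'a\<close> is a Euclidean space
  with \<open>DIM('a) = n - 1\<close>; coordinates are taken with respect to the standard orthonormal basis
  \<open>Basis\<close>. Hence a point \<open>(sin\<^sub>p(t) x, cos\<^sub>p(t))\<close> of the paper is literally a pair. The plane
  is \<open>real \<times> real\<close>. The parameter \<open>p \<in> (0,\<infinity>]\<close> is an extended real.\<close>

definition pnorm :: "ereal \<Rightarrow> 'a::euclidean_space \<Rightarrow> real" where
  "pnorm p x =
     (if p = \<infinity> then Max ((\<lambda>b. \<bar>x \<bullet> b\<bar>) ` Basis)
      else (\<Sum>b\<in>Basis. \<bar>x \<bullet> b\<bar> powr real_of_ereal p) powr (1 / real_of_ereal p))"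

definition squig_pi :: "ereal \<Rightarrow> real" where
  "squig_pi p = measure lebesgue {x :: real \<times> real. pnorm p x \<le> 1}"

definition squig_system :: "real \<Rightarrow> (real \<Rightarrow> real) \<Rightarrow> (real \<Rightarrow> real) \<Rightarrow> bool" where
  "squig_system r C S \<longleftrightarrow>
     (let b = squig_pi (ereal r) / 2 in
        continuous_on {0..b} C \<and> continuous_on {0..b} S \<and>
        C 0 = 1 \<and> S 0 = 0 \<and>
        (\<forall>t\<in>{0<..<b}.
           0 < C t \<and> 0 < S t \<and>
           (C has_real_derivative - (S t powr (r - 1))) (at t) \<and>
           (S has_real_derivative C t powr (r - 1)) (at t)))"

text \<open>For \<open>0 < r < \<infinity>\<close> the system determines \<open>C\<close> and \<open>S\<close> uniquely on \<open>[0, \<pi>\<^sub>r/2]\<close>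
  (\<open>C\<^sup>r + S\<^sup>r\<close> is constantly 1 there and the equation for \<open>S\<close> separates); the choice
  operator only affects the irrelevant values outside this interval.\<close>

definition squig_pair :: "real \<Rightarrow> (real \<Rightarrow> real) \<times> (real \<Rightarrow> real)" where
  "squig_pair r = (SOME (C, S). squig_system r C S)"

definition squig_cos :: "ereal \<Rightarrow> real \<Rightarrow> real" where
  "squig_cos p t = (if p = \<infinity> then min 1 (2 - t) else fst (squig_pair (real_of_ereal p)) t)"

definition squig_sin :: "ereal \<Rightarrow> real \<Rightarrow> real" where
  "squig_sin p t = (if p = \<infinity> then min 1 t else snd (squig_pair (real_of_ereal p)) t)"

definition unsigned_sphere :: "ereal \<Rightarrow> 'a::euclidean_space set" where
  "unsigned_sphere p = {x. (\<forall>b\<in>Basis. 0 \<le> x \<bullet> b) \<and> pnorm p x = 1}"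

definition cap :: "ereal \<Rightarrow> real \<Rightarrow> ('a::euclidean_space \<times> real) set" where
  "cap p t0 = {(squig_sin p t *\<^sub>R x, squig_cos p t) | t x. t \<in> {0..t0} \<and> x \<in> unsigned_sphere p}"

text \<open>The first argument of the next function, and of \<open>hyper_area\<close> below, only records the type \<open>'a\<close>
  (that is, the dimension \<open>n = DIM('a) + 1\<close>).\<close>

definition hyper_volume :: "'a::euclidean_space itself \<Rightarrow> ereal \<Rightarrow> real \<Rightarrow> real" where
  "hyper_volume _ p t0 =
     measure lebesgue {s *\<^sub>R y | s y. s \<in> {0..1} \<and> y \<in> (cap p t0 :: ('a \<times> real) set)}"

text \<open>Hausdorff measure of integer dimension \<open>k\<close> with respect to an arbitrary distance function
  \<open>d\<close>, without normalizing constant. No triangle inequality is required of \<open>d\<close>: for \<open>q < 1\<close>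
  the distance \<open>\<parallel>x - y\<parallel>\<^sub>q\<close> does not satisfy it. The case distinction for \<open>{}\<close> matters
  only if \<open>k = 0\<close>.\<close>

definition diam_wrt :: "('b \<Rightarrow> 'b \<Rightarrow> real) \<Rightarrow> 'b set \<Rightarrow> ennreal" where
  "diam_wrt d U = (SUP x\<in>U. SUP y\<in>U. ennreal (d x y))"

definition hausdorff_premeasure ::
    "('b \<Rightarrow> 'b \<Rightarrow> real) \<Rightarrow> nat \<Rightarrow> real \<Rightarrow> 'b set \<Rightarrow> ennreal" where
  "hausdorff_premeasure d k \<delta> A =
     Inf {(\<Sum>i. if U i = {} then 0 else diam_wrt d (U i) ^ k) | U :: nat \<Rightarrow> 'b set.
            A \<subseteq> (\<Union>i. U i) \<and> (\<forall>i. diam_wrt d (U i) \<le> ennreal \<delta>)}"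

definition hausdorff_measure :: "('b \<Rightarrow> 'b \<Rightarrow> real) \<Rightarrow> nat \<Rightarrow> 'b set \<Rightarrow> ennreal" where
  "hausdorff_measure d k A = (SUP \<delta>\<in>{0<..}. hausdorff_premeasure d k \<delta> A)"

text \<open>The measure below is finite: all quasi-norms \<open>\<parallel>\<cdot>\<parallel>\<^sub>q\<close> are equivalent, and the cap is
  part of the boundary of a coordinatewise monotone set in the cube \<open>[0,1]\<^sup>n\<close>.\<close>

definition hyper_area :: "'a::euclidean_space itself \<Rightarrow> ereal \<Rightarrow> ereal \<Rightarrow> real \<Rightarrow> real" where
  "hyper_area _ q p t0 =
     enn2real (hausdorff_measure (\<lambda>x y. pnorm q (x - y)) DIM('a)
                 (cap p t0 :: ('a \<times> real) set))"

end

theory Submission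
  imports Defs
begin

text \<open>Since \<open>sin\<^sub>p\<close> maps \<open>[0, t]\<close> onto \<open>[0, s]\<close> with \<open>s = sin\<^sub>p t\<close>, the cap is the graph of
  \<open>(1 - \<parallel>z\<parallel>\<^sub>p\<^sup>p)\<^sup>1\<^sup>/\<^sup>p\<close> over the part of the ball of radius \<open>s\<close> in the positive orthant, and \<open>s\<close> may replace
  \<open>t\<close> as parameter. If the two ratios agree, the \<open>p\<close>-area of the cap is a constant multiple of the cone volume,
  and this is refuted by the behaviour as \<open>s\<close> tends to \<open>0\<close>. With \<open>k = n - 1\<close>, the volume is
  \<open>s\<^sup>k (V\<^sub>0 + \<Theta>(s\<^sup>p))\<close> for \<open>p > 1\<close> and \<open>O(s\<^sup>k)\<close> for \<open>p < 1\<close>. For \<open>p < 1\<close> the cap is a steep cusp, and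
  projecting it to a vertical hyperplane bounds its area below by a multiple of \<open>s\<^sup>k\<^sup>-\<^sup>1 s\<^sup>p\<close>. For \<open>p > 1\<close> the
  area lies between \<open>h s\<^sup>k\<close> and \<open>h s\<^sup>k (1 + O(s\<^sup>p\<^sup>(\<^sup>p\<^sup>-\<^sup>1\<^sup>)))\<close>, which is incompatible with the volume
  if \<open>p > 2\<close>; if \<open>p < 2\<close>, a linear map that is \<open>1\<close>-Lipschitz on part of the graph shows that the correction of order
  \<open>s\<^sup>p\<^sup>(\<^sup>p\<^sup>-\<^sup>1\<^sup>)\<close> really occurs, and it dominates \<open>s\<^sup>p\<close>. No explicit formula for the Hausdorff measure is
  needed, only that on \<open>\<real>\<^sup>k\<close> it is a multiple of Lebesgue measure, by translation invariance.

  Conversely, for \<open>p = 1\<close> caps are homothetic, for \<open>p = \<infinity>\<close> they consist of boxes, and for \<open>p = 2\<close> the Hausdorff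
  measure and the cone measure on the sphere are both invariant under reflections, hence give the same mass to all balls
  of the same radius, which makes them proportional.\<close>

subsection \<open>Hausdorff measures\<close>

text \<open>The exponent p(p-1) comes from slopes. At distance s from the pole the profile has slope
  of order s^(p-1), and because the p-norm adds p-th powers, a slope m changes p-lengths only by a
  factor 1 + O(m^p). The cone volume follows the height itself and so varies like s^p. The two
  orders p and p(p-1) coincide only for p = 2. The leading coefficients are unknown on both sides:
  the factor between area and volume is arbitrary and the constant of the Hausdorff measure is not
  computed. Hence s tending to 0 yields only an inequality between leading coefficients, and the
  contradiction has to come from the first correction term; the inequality is always taken in the
  direction that lets the leading coefficients be dropped. For p < 1 the distance violates the
  triangle inequality, so Hausdorff measures are treated for an arbitrary distance function that
  merely controls the metric. All area bounds come from Lipschitz maps: parametrizations give upper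
  bounds, contractions onto regions of the base space give lower bounds.\<close>

definition cover_cost :: "('b \<Rightarrow> 'b \<Rightarrow> real) \<Rightarrow> nat \<Rightarrow> 'b set \<Rightarrow> ennreal" where
  "cover_cost d k U = (if U = {} then 0 else diam_wrt d U ^ k)"

section \<open>Covers, monotonicity and countable subadditivity\<close>

lemma diam_wrt_le_iff: "diam_wrt d U \<le> c \<longleftrightarrow> (\<forall>x\<in>U. \<forall>y\<in>U. ennreal (d x y) \<le> c)"
  by (simp add: diam_wrt_def SUP_le_iff)

lemma le_diam_wrt: "x \<in> U \<Longrightarrow> y \<in> U \<Longrightarrow> ennreal (d x y) \<le> diam_wrt d U"
  using diam_wrt_le_iff[of d U "diam_wrt d U"] by simp

lemma diam_wrt_mono: "U \<subseteq> V \<Longrightarrow> diam_wrt d U \<le> diam_wrt d V"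
  by (subst diam_wrt_le_iff) (auto intro: le_diam_wrt)

lemma cover_cost_mono: "U \<subseteq> V \<Longrightarrow> cover_cost d k U \<le> cover_cost d k V"
  by (auto simp: cover_cost_def intro!: power_mono diam_wrt_mono)

lemma hausdorff_premeasure_le:
  assumes "A \<subseteq> (\<Union>i. U i)" "\<And>i::nat. diam_wrt d (U i) \<le> ennreal \<delta>"
  shows "hausdorff_premeasure d k \<delta> A \<le> (\<Sum>i. cover_cost d k (U i))"
  unfolding hausdorff_premeasure_def cover_cost_def
  by (rule Inf_lower) (use assms in blast)

lemma hausdorff_premeasure_greatest:
  assumes "\<And>U::nat \<Rightarrow> 'b set. A \<subseteq> (\<Union>i. U i) \<Longrightarrow> (\<And>i. diam_wrt d (U i) \<le> ennreal \<delta>) \<Longrightarrow>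
             c \<le> (\<Sum>i. cover_cost d k (U i))"
  shows "c \<le> hausdorff_premeasure d k \<delta> A"
  unfolding hausdorff_premeasure_def
  by (rule Inf_greatest) (use assms in \<open>auto simp: cover_cost_def\<close>)

lemma hausdorff_premeasure_cover:
  assumes "hausdorff_premeasure d k \<delta> A < c"
  obtains U :: "nat \<Rightarrow> 'b set" where "A \<subseteq> (\<Union>i. U i)" "\<And>i. diam_wrt d (U i) \<le> ennreal \<delta>"
    "(\<Sum>i. cover_cost d k (U i)) < c"
  using assms unfolding hausdorff_premeasure_def Inf_less_iff cover_cost_def by blast

lemma hausdorff_premeasure_subset:
  assumes "A \<subseteq> B"
  shows "hausdorff_premeasure d k \<delta> A \<le> hausdorff_premeasure d k \<delta> B"
  by (rule hausdorff_premeasure_greatest, rule hausdorff_premeasure_le) (use assms in auto)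

lemma hausdorff_premeasure_antimono:
  assumes "\<delta> \<le> \<delta>'"
  shows "hausdorff_premeasure d k \<delta>' A \<le> hausdorff_premeasure d k \<delta> A"
  by (rule hausdorff_premeasure_greatest, rule hausdorff_premeasure_le)
    (use assms in \<open>auto intro: order_trans[OF _ ennreal_leI]\<close>)

text \<open>Near-optimal covers of the pieces, the n-th with error e / 2^(n+1), are merged into one
  cover. The scale \<delta> is the same throughout, so the merged cover is admissible.\<close>

lemma hausdorff_premeasure_UN:
  "hausdorff_premeasure d k \<delta> (\<Union>n::nat. A n) \<le> (\<Sum>n. hausdorff_premeasure d k \<delta> (A n))"
proof (rule ennreal_le_epsilon)
  let ?O = "hausdorff_premeasure d k \<delta>"
  fix e :: real assume e: "0 < e" "(\<Sum>n. ?O (A n)) < top"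
  then have *: "?O (A n) < ?O (A n) + e * (1/2)^Suc n" for n
    by (auto simp add: less_top dest!: ennreal_suminf_lessD)
  have "\<exists>B::nat \<Rightarrow> _. A n \<subseteq> (\<Union>i. B i) \<and> (\<forall>i. diam_wrt d (B i) \<le> ennreal \<delta>) \<and>
      (\<Sum>i. cover_cost d k (B i)) \<le> ?O (A n) + e * (1/2)^Suc n" for n
    using hausdorff_premeasure_cover[OF *[of n]] by (metis less_imp_le)
  then obtain B where B: "\<And>n. A n \<subseteq> (\<Union>i. B n i)" "\<And>n i::nat. diam_wrt d (B n i) \<le> ennreal \<delta>"
      "\<And>n. (\<Sum>i. cover_cost d k (B n i)) \<le> ?O (A n) + e * (1/2)^Suc n"
    by metis
  \<comment> \<open>The double sequence of covering sets is listed as a single sequence by the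
    pairing function.\<close>
  define C where "C = case_prod B o prod_decode"
  have A_C: "(\<Union>i. A i) \<subseteq> (\<Union>i. C i)"
    using B(1) by (auto simp add: C_def subset_eq) (metis prod.case prod_encode_inverse)
  have "?O (\<Union>i. A i) \<le> (\<Sum>i. cover_cost d k (C i))"
    by (rule hausdorff_premeasure_le[OF A_C]) (simp add: C_def B split: prod.split)
  also have "\<dots> = (\<Sum>n. \<Sum>i. cover_cost d k (B n i))"
    using suminf_ennreal_2dimen[where f="\<lambda>x. cover_cost d k (case_prod B x)"]
    unfolding C_def comp_def by auto
  also have "\<dots> \<le> (\<Sum>n. ?O (A n) + e * (1/2) ^ Suc n)"
    by (intro suminf_le allI B) auto
  also have "\<dots> = (\<Sum>n. ?O (A n)) + (\<Sum>n. ennreal e * ennreal ((1/2) ^ Suc n))"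
    using \<open>0 < e\<close> by (subst suminf_add[symmetric])
                     (auto simp del: ennreal_suminf_cmult simp add: ennreal_mult[symmetric])
  also have "\<dots> = (\<Sum>n. ?O (A n)) + e"
    unfolding ennreal_suminf_cmult
    by (subst suminf_ennreal_eq[OF zero_le_power power_half_series]) auto
  finally show "?O (\<Union>i. A i) \<le> (\<Sum>n. ?O (A n)) + e" .
qed

lemma hausdorff_measure_subset:
  "A \<subseteq> B \<Longrightarrow> hausdorff_measure d k A \<le> hausdorff_measure d k B"
  unfolding hausdorff_measure_def by (intro SUP_mono) (blast intro: hausdorff_premeasure_subset)

lemma hausdorff_premeasure_le_measure:
  "0 < \<delta> \<Longrightarrow> hausdorff_premeasure d k \<delta> A \<le> hausdorff_measure d k A"
  unfolding hausdorff_measure_def by (rule SUP_upper) auto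

lemma hausdorff_measure_UN:
  "hausdorff_measure d k (\<Union>n::nat. A n) \<le> (\<Sum>n. hausdorff_measure d k (A n))"
proof -
  have "hausdorff_premeasure d k \<delta> (\<Union>n. A n) \<le> (\<Sum>n. hausdorff_measure d k (A n))" if "0 < \<delta>" for \<delta>
    by (rule order_trans[OF hausdorff_premeasure_UN])
       (intro suminf_le hausdorff_premeasure_le_measure that, auto)
  then show ?thesis
    unfolding hausdorff_measure_def[of d k "\<Union>n. A n"] by (auto intro: SUP_least)
qed

lemma hausdorff_measure_empty [simp]: "hausdorff_measure d k {} = 0"
proof -
  have "hausdorff_premeasure d k \<delta> {} \<le> (\<Sum>i::nat. cover_cost d k {})" if "\<delta> > 0" for \<delta>
    by (rule hausdorff_premeasure_le) (auto simp: diam_wrt_def bot_ennreal)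
  then show ?thesis
    unfolding hausdorff_measure_def by (auto simp: cover_cost_def intro!: antisym SUP_least)
qed

lemma hausdorff_measure_Un:
  "hausdorff_measure d k (A \<union> B) \<le> hausdorff_measure d k A + hausdorff_measure d k B"
  using hausdorff_measure_UN[of d k "binaryset A B"]
  by (simp add: suminf_binaryset_eq UN_binaryset_eq)

lemma hausdorff_measure_finite_UN:
  "finite I \<Longrightarrow> hausdorff_measure d k (\<Union>i\<in>I. A i) \<le> (\<Sum>i\<in>I. hausdorff_measure d k (A i))"
proof (induction I rule: finite_induct)
  case (insert x F)
  then show ?case
    using hausdorff_measure_Un[of d k "A x" "\<Union>i\<in>F. A i"] by (simp add: add_left_mono order_trans)
qed simp

text \<open>A cover U of A yields the cover of the image by the sets f(U i \<inter> A). Diameters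
  grow at most by the factor L, so scale \<delta> in the target corresponds to scale \<delta> / L in
  the source.\<close>

lemma hausdorff_measure_Lipschitz_image:
  fixes f :: "'b \<Rightarrow> 'c"
  assumes L: "0 < L" and lip: "\<And>x y. x \<in> A \<Longrightarrow> y \<in> A \<Longrightarrow> d' (f x) (f y) \<le> L * d x y"
  shows "hausdorff_measure d' k (f ` A) \<le> ennreal L ^ k * hausdorff_measure d k A"
proof -
  have diam: "diam_wrt d' (f ` (U \<inter> A)) \<le> ennreal L * diam_wrt d U" for U
    unfolding diam_wrt_le_iff
  proof safe
    fix x y assume xy: "x \<in> U" "x \<in> A" "y \<in> U" "y \<in> A"
    have "ennreal (d' (f x) (f y)) \<le> ennreal (L * d x y)"
      using lip xy by (intro ennreal_leI) auto
    also have "\<dots> = ennreal L * ennreal (d x y)"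
      using L by (intro ennreal_mult') simp
    also have "\<dots> \<le> ennreal L * diam_wrt d U"
      by (intro mult_left_mono le_diam_wrt xy) simp
    finally show "ennreal (d' (f x) (f y)) \<le> ennreal L * diam_wrt d U" .
  qed
  have cost: "cover_cost d' k (f ` (U \<inter> A)) \<le> ennreal L ^ k * cover_cost d k U" for U
    using power_mono[OF diam[of U], of k] by (auto simp: cover_cost_def power_mult_distrib)
  have pre: "hausdorff_premeasure d' k \<delta> (f ` A) \<le> ennreal L ^ k * hausdorff_measure d k A" if "0 < \<delta>" for \<delta>
  proof -
    \<comment> \<open>The factor is moved to the left by division, since the infimum over covers can
      only be bounded from below by a fixed quantity.\<close>
    have "hausdorff_premeasure d' k \<delta> (f ` A) / ennreal L ^ k \<le> hausdorff_premeasure d k (\<delta> / L) A"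
    proof (rule hausdorff_premeasure_greatest)
      fix U :: "nat \<Rightarrow> 'b set"
      assume U: "A \<subseteq> (\<Union>i. U i)" "\<And>i. diam_wrt d (U i) \<le> ennreal (\<delta> / L)"
      have "diam_wrt d' (f ` (U i \<inter> A)) \<le> ennreal \<delta>" for i
      proof -
        have "ennreal L * diam_wrt d (U i) \<le> ennreal L * ennreal (\<delta> / L)"
          by (intro mult_left_mono U) auto
        also have "\<dots> = ennreal \<delta>" using L that by (simp flip: ennreal_mult)
        finally show ?thesis using diam[of "U i"] by (rule order_trans[rotated])
      qed
      then have "hausdorff_premeasure d' k \<delta> (f ` A) \<le> (\<Sum>i. cover_cost d' k (f ` (U i \<inter> A)))"
        using U(1) by (intro hausdorff_premeasure_le) blast+
      also have "\<dots> \<le> (\<Sum>i. ennreal L ^ k * cover_cost d k (U i))"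
        by (intro suminf_le cost) auto
      finally have "hausdorff_premeasure d' k \<delta> (f ` A) \<le> (\<Sum>i. cover_cost d k (U i)) * ennreal L ^ k"
        by (simp add: mult.commute)
      then show "hausdorff_premeasure d' k \<delta> (f ` A) / ennreal L ^ k \<le> (\<Sum>i. cover_cost d k (U i))"
        using L by (intro divide_le_posI_ennreal) (auto simp: ennreal_power mult.commute)
    qed
    also have "\<dots> \<le> hausdorff_measure d k A"
      using that L by (intro hausdorff_premeasure_le_measure) auto
    finally have le: "ennreal L ^ k * (hausdorff_premeasure d' k \<delta> (f ` A) / ennreal L ^ k) \<le>
        ennreal L ^ k * hausdorff_measure d k A"
      by (intro mult_left_mono) auto
    have "ennreal L ^ k \<noteq> 0" "ennreal L ^ k \<noteq> top"
      using L by (auto simp: ennreal_power)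
    then have "ennreal L ^ k * (hausdorff_premeasure d' k \<delta> (f ` A) / ennreal L ^ k) =
        hausdorff_premeasure d' k \<delta> (f ` A)"
      by (metis ennreal_mult_divide_eq ennreal_times_divide mult.commute)
    with le show ?thesis by simp
  qed
  show ?thesis
    unfolding hausdorff_measure_def[of d'] by (intro SUP_least pre) auto
qed

lemma hausdorff_measure_isometric_image:
  assumes "\<And>x y. x \<in> A \<Longrightarrow> y \<in> A \<Longrightarrow> d' (f x) (f y) = d x y" "inj_on f A"
  shows "hausdorff_measure d' k (f ` A) = hausdorff_measure d k A"
proof (rule antisym)
  show "hausdorff_measure d' k (f ` A) \<le> hausdorff_measure d k A"
    using hausdorff_measure_Lipschitz_image[of 1 A d' f d k] assms by simp
  have "hausdorff_measure d k (inv_into A f ` f ` A) \<le> ennreal 1 ^ k * hausdorff_measure d' k (f ` A)"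
  proof (rule hausdorff_measure_Lipschitz_image)
    fix x y assume "x \<in> f ` A" "y \<in> f ` A"
    then show "d (inv_into A f x) (inv_into A f y) \<le> 1 * d' x y"
      using assms by (auto simp: inv_into_f_f)
  qed simp
  then show "hausdorff_measure d k A \<le> hausdorff_measure d' k (f ` A)"
    using assms(2) by (simp add: inv_into_image_cancel)
qed

text \<open>The only link between the distance that enters the Hausdorff measure and the metric of
  the space. It holds for \<open>pnorm q\<close> also when q < 1, and it suffices for Caratheodory's
  criterion because separation is measured by \<open>dist\<close>.\<close>

definition controls_dist :: "('b::metric_space \<Rightarrow> 'b \<Rightarrow> real) \<Rightarrow> bool" where
  "controls_dist d \<longleftrightarrow> (\<forall>e>0. \<exists>\<delta>>0. \<forall>x y. d x y \<le> \<delta> \<longrightarrow> dist x y < e)"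

text \<open>At a sufficiently small scale no covering set meets both A and B, so a cover of the
  union splits into a cover of each without increasing the cost.\<close>

lemma hausdorff_measure_separated:
  fixes d :: "'b::metric_space \<Rightarrow> 'b \<Rightarrow> real"
  assumes d: "controls_dist d" and e: "0 < e" and AB: "\<And>x y. x \<in> A \<Longrightarrow> y \<in> B \<Longrightarrow> e \<le> dist x y"
  shows "hausdorff_measure d k A + hausdorff_measure d k B \<le> hausdorff_measure d k (A \<union> B)"
proof -
  obtain \<delta>0 where \<delta>0: "0 < \<delta>0" "\<And>x y. d x y \<le> \<delta>0 \<Longrightarrow> dist x y < e"
    using d e unfolding controls_dist_def by metis
  have le: "hausdorff_premeasure d k \<delta> A + hausdorff_premeasure d k \<delta> B \<le> hausdorff_measure d k (A \<union> B)"
    if \<delta>: "0 < \<delta>" "\<delta> \<le> \<delta>0" for \<delta>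
  proof -
    have "hausdorff_premeasure d k \<delta> A + hausdorff_premeasure d k \<delta> B \<le> hausdorff_premeasure d k \<delta> (A \<union> B)"
    proof (rule hausdorff_premeasure_greatest)
      fix U :: "nat \<Rightarrow> 'b set"
      assume U: "A \<union> B \<subseteq> (\<Union>i. U i)" "\<And>i. diam_wrt d (U i) \<le> ennreal \<delta>"
      have one: "U i \<inter> A = {} \<or> U i \<inter> B = {}" for i
      proof (rule ccontr)
        assume "\<not> ?thesis"
        then obtain x y where xy: "x \<in> U i" "x \<in> A" "y \<in> U i" "y \<in> B" by blast
        then have "ennreal (d x y) \<le> ennreal \<delta>"
          using U(2)[of i] diam_wrt_le_iff[of d "U i"] by blast
        then have "d x y \<le> \<delta>0" using \<delta> by (simp add: ennreal_le_iff)
        then show False using \<delta>0(2) AB xy by force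
      qed
      have "hausdorff_premeasure d k \<delta> A + hausdorff_premeasure d k \<delta> B \<le>
          (\<Sum>i. cover_cost d k (U i \<inter> A)) + (\<Sum>i. cover_cost d k (U i \<inter> B))"
      proof (rule add_mono)
        have *: "diam_wrt d (U i \<inter> X) \<le> ennreal \<delta>" for i X
          using U(2)[of i] diam_wrt_mono[of "U i \<inter> X" "U i" d] by auto
        show "hausdorff_premeasure d k \<delta> A \<le> (\<Sum>i. cover_cost d k (U i \<inter> A))"
          using U(1) by (intro hausdorff_premeasure_le *) auto
        show "hausdorff_premeasure d k \<delta> B \<le> (\<Sum>i. cover_cost d k (U i \<inter> B))"
          using U(1) by (intro hausdorff_premeasure_le *) auto
      qed
      also have "\<dots> = (\<Sum>i. cover_cost d k (U i \<inter> A) + cover_cost d k (U i \<inter> B))"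
        by (rule suminf_add) auto
      also have "\<dots> \<le> (\<Sum>i. cover_cost d k (U i))"
      proof (intro suminf_le)
        fix i
        show "cover_cost d k (U i \<inter> A) + cover_cost d k (U i \<inter> B) \<le> cover_cost d k (U i)"
          using one[of i] cover_cost_mono[of "U i \<inter> A" "U i" d k] cover_cost_mono[of "U i \<inter> B" "U i" d k]
          by (auto simp: cover_cost_def[of d k "{}"])
      qed auto
      finally show "hausdorff_premeasure d k \<delta> A + hausdorff_premeasure d k \<delta> B \<le> (\<Sum>i. cover_cost d k (U i))" .
    qed
    also have "\<dots> \<le> hausdorff_measure d k (A \<union> B)"
      using \<delta> by (intro hausdorff_premeasure_le_measure) auto
    finally show ?thesis .
  qed
  have "hausdorff_measure d k A + hausdorff_measure d k B =
      (SUP \<delta>\<in>{0<..}. hausdorff_premeasure d k \<delta> A + hausdorff_premeasure d k \<delta> B)"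
    unfolding hausdorff_measure_def
  proof (rule SUP_add_directed_ennreal[symmetric])
    fix i j :: real assume "i \<in> {0<..}" "j \<in> {0<..}"
    then show "\<exists>k'\<in>{0<..}. hausdorff_premeasure d k i A + hausdorff_premeasure d k j B
        \<le> hausdorff_premeasure d k k' A + hausdorff_premeasure d k k' B"
      by (intro bexI[of _ "min i j"] add_mono hausdorff_premeasure_antimono) auto
  qed
  also have "\<dots> \<le> hausdorff_measure d k (A \<union> B)"
  proof (rule SUP_least)
    fix \<delta> :: real assume "\<delta> \<in> {0<..}"
    then have "hausdorff_premeasure d k \<delta> A + hausdorff_premeasure d k \<delta> B \<le>
        hausdorff_premeasure d k (min \<delta> \<delta>0) A + hausdorff_premeasure d k (min \<delta> \<delta>0) B"
      by (intro add_mono hausdorff_premeasure_antimono) auto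
    also have "\<dots> \<le> hausdorff_measure d k (A \<union> B)"
      using \<open>\<delta> \<in> _\<close> \<delta>0 by (intro le) auto
    finally show "hausdorff_premeasure d k \<delta> A + hausdorff_premeasure d k \<delta> B \<le> \<dots>" .
  qed
  finally show ?thesis .
qed

text \<open>The distance to F is 1-Lipschitz, so sets on which it takes values at least a and at
  most b are at least a - b apart.\<close>

lemma hausdorff_measure_separated_infdist:
  assumes d: "controls_dist d" and ab: "b < a"
    and "\<And>x. x \<in> A \<Longrightarrow> a \<le> infdist x F" "\<And>y. y \<in> B \<Longrightarrow> infdist y F \<le> b"
  shows "hausdorff_measure d k A + hausdorff_measure d k B \<le> hausdorff_measure d k (A \<union> B)"
proof (rule hausdorff_measure_separated[OF d, of "a - b"])
  fix x y assume "x \<in> A" "y \<in> B"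
  then show "a - b \<le> dist x y"
    using assms(3)[of x] assms(4)[of y] infdist_triangle[of x F y] by linarith
qed (use ab in simp)

text \<open>Caratheodory's criterion: the shells around \<open>F\<close> with indices of equal parity are separated,
  so their measures have a finite sum and the far part of \<open>T\<close> exhausts \<open>T - F\<close> in measure.\<close>

lemma hausdorff_measure_closed_split:
  fixes d :: "'b::metric_space \<Rightarrow> 'b \<Rightarrow> real"
  assumes d: "controls_dist d" and F: "closed F"
  shows "hausdorff_measure d k (T \<inter> F) + hausdorff_measure d k (T - F) \<le> hausdorff_measure d k T"
\<comment> \<open>\<open>infdist\<close> to the empty set is 0 by convention, which would spoil the
  shells; and the tail argument needs a finite measure of T.\<close>
proof (cases "F = {} \<or> hausdorff_measure d k T = top")
  case True
  then show ?thesis by (elim disjE) auto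
next
  case False
  then have F0: "F \<noteq> {}" and fin: "hausdorff_measure d k T < top" by (auto simp: less_top)
  let ?H = "hausdorff_measure d k"
  \<comment> \<open>\<open>R n\<close> is the part of T whose distance from F lies between 1/(n+2)
    and 1/(n+1), with the outer end excluded.\<close>
  define far where "far n = {x \<in> T. 1 / real (Suc n) \<le> infdist x F}" for n
  define R where "R n = far (Suc n) - far n" for n
  have R: "1 / real (n + 2) \<le> infdist x F" "infdist x F \<le> 1 / real (n + 1)" "x \<in> T" if "x \<in> R n" for x n
    using that by (auto simp: R_def far_def)
  \<comment> \<open>c = 0 and c = 1 select the even and the odd shells. The shells before index 2N +
    c stay at distance at least 1/(2N + c) from F, the shell with that index at most 1/(2N + c +
    1).\<close>
  have shells: "(\<Sum>i<N. ?H (R (2 * i + c))) \<le> ?H (\<Union>i<N. R (2 * i + c))" for N c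
  proof (induction N)
    case (Suc N)
    have "?H (\<Union>i<N. R (2 * i + c)) + ?H (R (2 * N + c)) \<le> ?H ((\<Union>i<N. R (2 * i + c)) \<union> R (2 * N + c))"
    proof (cases N)
      case (Suc N')
      show ?thesis
      proof (rule hausdorff_measure_separated_infdist[OF d])
        show "1 / real (2 * N + c + 1) < 1 / real (2 * N + c)"
          using Suc by (simp add: field_simps)
        fix x assume "x \<in> (\<Union>i<N. R (2 * i + c))"
        then obtain i where i: "i < N" "x \<in> R (2 * i + c)" by auto
        have "1 / real (2 * N + c) \<le> 1 / real (2 * i + c + 2)"
          using i by (intro divide_left_mono) auto
        also have "\<dots> \<le> infdist x F" using R(1)[OF i(2)] by simp
        finally show "1 / real (2 * N + c) \<le> infdist x F" .
      next
        fix y assume "y \<in> R (2 * N + c)"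
        then show "infdist y F \<le> 1 / real (2 * N + c + 1)" using R(2) by blast
      qed
    qed simp
    then show ?case
      using order_trans[OF add_right_mono[OF Suc.IH]] by (simp add: lessThan_Suc Un_commute add.commute)
  qed simp
  have half: "(\<Sum>i. ?H (R (2 * i + c))) \<le> ?H T" for c
  proof (rule suminf_le_const)
    fix N show "(\<Sum>i<N. ?H (R (2 * i + c))) \<le> ?H T"
      using shells[of c N] by (rule order_trans) (auto intro!: hausdorff_measure_subset dest: R(3))
  qed auto
  have sum_fin: "(\<Sum>i. ?H (R i)) < top"
  proof -
    have "(\<Sum>i. ?H (R i)) \<le> ?H T + ?H T"
    proof (rule suminf_le_const)
      fix N
      have "(\<Sum>i<N. ?H (R i)) \<le> (\<Sum>i<2*N. ?H (R i))"
        by (rule sum_mono2) auto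
      also have "\<dots> = (\<Sum>i<N. ?H (R (2 * i + 0))) + (\<Sum>i<N. ?H (R (2 * i + 1)))"
        by (induction N) (auto simp: algebra_simps)
      also have "\<dots> \<le> (\<Sum>i. ?H (R (2 * i + 0))) + (\<Sum>i. ?H (R (2 * i + 1)))"
        by (intro add_mono sum_le_suminf) auto
      also have "\<dots> \<le> ?H T + ?H T" by (intro add_mono half)
      finally show "(\<Sum>i<N. ?H (R i)) \<le> ?H T + ?H T" .
    qed auto
    also have "\<dots> < top" using fin by simp
    finally show ?thesis .
  qed
  have cover: "T - F \<subseteq> far n \<union> (\<Union>i. R (i + n))" for n
  proof
    fix x assume x: "x \<in> T - F"
    then have "0 < infdist x F"
      using F F0 by (metis DiffD2 in_closed_iff_infdist_zero infdist_nonneg less_eq_real_def)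
    then obtain m0 where "1 / real (Suc m0) < infdist x F"
      using nat_approx_posE by (metis of_nat_Suc)
    then have ex: "\<exists>m. x \<in> far m" using x by (auto simp: far_def intro!: exI[of _ m0])
    \<comment> \<open>The first index at which x becomes far from F; unless it is at most n, the
      point lies in the shell with index m - 1, which belongs to the tail.\<close>
    define m where "m = (LEAST m. x \<in> far m)"
    have m: "x \<in> far m" unfolding m_def by (rule LeastI_ex[OF ex])
    have min: "x \<notin> far j" if "j < m" for j
      using not_less_Least[of j "\<lambda>m. x \<in> far m"] that unfolding m_def by auto
    show "x \<in> far n \<union> (\<Union>i. R (i + n))"
    proof (cases "m \<le> n")
      case True
      then have "1 / real (Suc n) \<le> 1 / real (Suc m)" by (intro divide_left_mono) auto
      then show ?thesis using m by (auto simp: far_def)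
    next
      case False
      then have "x \<in> R (m - 1)" using m min[of "m - 1"] by (auto simp: R_def)
      then have "x \<in> R ((m - 1 - n) + n)" using False by simp
      then show ?thesis by blast
    qed
  qed
  have near: "?H (T \<inter> F) + ?H (far n) \<le> ?H T" for n
  proof -
    have "?H (far n) + ?H (T \<inter> F) \<le> ?H (far n \<union> (T \<inter> F))"
      by (rule hausdorff_measure_separated_infdist[OF d, of 0 "1 / real (Suc n)" _ F])
         (auto simp: far_def)
    also have "\<dots> \<le> ?H T" by (rule hausdorff_measure_subset) (auto simp: far_def)
    finally show ?thesis by (simp add: add.commute)
  qed
  show ?thesis
  proof (rule ennreal_le_epsilon)
    fix e :: real assume e: "0 < e"
    define r where "r i = enn2real (?H (R i))" for i
    have r: "?H (R i) = ennreal (r i)" for i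
      using ennreal_suminf_lessD[OF sum_fin, of i] by (simp add: r_def)
    have r0: "0 \<le> r i" for i by (simp add: r_def)
    have sr: "summable r"
      using sum_fin r0 unfolding r by (intro summable_suminf_not_top) (auto simp: less_top)
    obtain n where n: "norm (\<Sum>i. r (i + n)) < e"
      using suminf_exist_split[OF e sr] by blast
    have "(\<Sum>i. ?H (R (i + n))) = ennreal (\<Sum>i. r (i + n))"
      unfolding r using r0 sr by (intro suminf_ennreal2) (auto simp: summable_iff_shift)
    also have "\<dots> \<le> ennreal e" using n by (intro ennreal_leI) auto
    finally have tail: "(\<Sum>i. ?H (R (i + n))) \<le> ennreal e" .
    have "?H (T - F) \<le> ?H (far n \<union> (\<Union>i. R (i + n)))"
      by (rule hausdorff_measure_subset[OF cover])
    also have "\<dots> \<le> ?H (far n) + ?H (\<Union>i. R (i + n))" by (rule hausdorff_measure_Un)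
    also have "\<dots> \<le> ?H (far n) + ennreal e"
      by (intro add_left_mono order_trans[OF hausdorff_measure_UN tail])
    finally have "?H (T \<inter> F) + ?H (T - F) \<le> ?H (T \<inter> F) + (?H (far n) + ennreal e)"
      by (rule add_left_mono)
    also have "\<dots> \<le> ?H T + ennreal e"
      unfolding add.assoc[symmetric] by (intro add_right_mono near)
    finally show "?H (T \<inter> F) + ?H (T - F) \<le> ?H T + ennreal e" .
  qed
qed

section \<open>The Borel measure obtained from the outer measure\<close>

definition hausdorff_borel :: "('b::metric_space \<Rightarrow> 'b \<Rightarrow> real) \<Rightarrow> nat \<Rightarrow> 'b measure" where
  "hausdorff_borel d k = measure_of UNIV (sets borel) (hausdorff_measure d k)"

lemma space_hausdorff_borel [simp]: "space (hausdorff_borel d k) = UNIV"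
  by (simp add: hausdorff_borel_def)

lemma sets_hausdorff_borel [simp, measurable_cong]: "sets (hausdorff_borel d k) = sets borel"
  unfolding hausdorff_borel_def
  using sets.sets_measure_of_eq[of borel] by (simp add: space_borel)

text \<open>Closed sets satisfy Caratheodory's criterion and generate the Borel sets, so the outer
  measure is countably additive there. Without this, \<open>measure_of\<close> could return the zero
  measure.\<close>

lemma emeasure_hausdorff_borel:
  fixes d :: "'b::metric_space \<Rightarrow> 'b \<Rightarrow> real"
  assumes d: "controls_dist d" and A: "A \<in> sets borel"
  shows "emeasure (hausdorff_borel d k) A = hausdorff_measure d k A"
proof -
  let ?H = "hausdorff_measure d k"
  have oms: "outer_measure_space (Pow UNIV) ?H"
    unfolding outer_measure_space_def positive_def increasing_def countably_subadditive_def
    by (auto intro: hausdorff_measure_subset hausdorff_measure_UN)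
  interpret P: sigma_algebra UNIV "Pow (UNIV :: 'b set)" by (rule sigma_algebra_Pow)
  let ?L = "lambda_system UNIV (Pow UNIV) ?H"
  have ms: "measure_space UNIV ?L ?H" by (rule P.caratheodory_lemma[OF oms])
  have "{F. closed F} \<subseteq> ?L"
  proof safe
    fix F :: "'b set" assume F: "closed F"
    have "?H (T \<inter> F) + ?H (T - F) = ?H T" for T
    proof (rule antisym[OF hausdorff_measure_closed_split[OF d F]])
      show "?H T \<le> ?H (T \<inter> F) + ?H (T - F)"
        using hausdorff_measure_Un[of d k "T \<inter> F" "T - F"] by (simp add: Int_Diff_Un)
    qed
    then show "F \<in> ?L" unfolding P.lambda_system_eq by simp
  qed
  then have "sets borel \<subseteq> ?L"
    unfolding borel_eq_closed
    using ms by (simp add: measure_space_def sigma_algebra.sigma_sets_subset)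
  then have "measure_space UNIV (sets borel) ?H"
    using measure_down[OF ms] sets.sigma_algebra_axioms[of borel] by (simp add: space_borel)
  then show ?thesis
    using A unfolding hausdorff_borel_def
    by (subst emeasure_measure_of_sigma) (auto simp: measure_space_def)
qed

subsection \<open>The \<open>p\<close>-norms\<close>

lemma pnorm_ereal: "pnorm (ereal r) x = (\<Sum>b\<in>Basis. \<bar>x \<bullet> b\<bar> powr r) powr (1 / r)"
  by (simp add: pnorm_def)

lemma ereal_pos_cases:
  fixes p :: ereal
  assumes "0 < p"
  obtains (real) r where "p = ereal r" "0 < r" | (inf) "p = \<infinity>"
  using assms by (cases p) auto

lemma pnorm_nonneg: "0 \<le> pnorm p x"
proof (cases "p = \<infinity>")
  case True
  obtain b :: 'a where "b \<in> Basis" by (meson nonempty_Basis ex_in_conv)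
  then have "\<bar>x \<bullet> b\<bar> \<le> pnorm p x" using True by (auto simp: pnorm_def)
  then show ?thesis by linarith
qed (simp add: pnorm_def)

lemma pnorm_powr: "0 < r \<Longrightarrow> pnorm (ereal r) x powr r = (\<Sum>b\<in>Basis. \<bar>x \<bullet> b\<bar> powr r)"
  by (simp add: pnorm_ereal powr_powr sum_nonneg)

lemma abs_inner_le_pnorm:
  assumes "0 < p" "b \<in> Basis"
  shows "\<bar>x \<bullet> b\<bar> \<le> pnorm p x"
  using assms(1)
proof (cases p rule: ereal_pos_cases)
  case (real r)
  have "\<bar>x \<bullet> b\<bar> powr r \<le> (\<Sum>b\<in>Basis. \<bar>x \<bullet> b\<bar> powr r)"
    using assms by (intro member_le_sum) auto
  also have "\<dots> = pnorm p x powr r" using real by (simp add: pnorm_powr)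
  finally show ?thesis
    using real by (meson pnorm_nonneg powr_less_mono2 not_le)
qed (use assms in \<open>auto simp: pnorm_def\<close>)

lemma pnorm_mono:
  assumes "0 < p" "\<And>b. b \<in> Basis \<Longrightarrow> \<bar>x \<bullet> b\<bar> \<le> \<bar>y \<bullet> b\<bar>"
  shows "pnorm p x \<le> pnorm p y"
  using assms(1)
proof (cases p rule: ereal_pos_cases)
  case (real r)
  then show ?thesis
    using assms(2) by (auto simp: pnorm_ereal intro!: powr_mono2 sum_mono sum_nonneg)
next
  case inf
  have "\<bar>x \<bullet> b\<bar> \<le> Max ((\<lambda>b. \<bar>y \<bullet> b\<bar>) ` Basis)" if "b \<in> Basis" for b
    by (rule order_trans[OF assms(2)[OF that] Max_ge]) (use that in auto)
  then show ?thesis using inf by (simp add: pnorm_def)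
qed

lemma pnorm_scaleR:
  assumes "0 < p"
  shows "pnorm p (c *\<^sub>R x) = \<bar>c\<bar> * pnorm p x"
  using assms(1)
proof (cases p rule: ereal_pos_cases)
  case (real r)
  then have "pnorm p (c *\<^sub>R x) = (\<bar>c\<bar> powr r * (\<Sum>b\<in>Basis. \<bar>x \<bullet> b\<bar> powr r)) powr (1 / r)"
    by (simp add: pnorm_ereal abs_mult powr_mult sum_distrib_left)
  then show ?thesis
    using real by (simp add: pnorm_ereal powr_mult powr_powr sum_nonneg)
next
  case inf
  have "(*) \<bar>c\<bar> (Max ((\<lambda>b. \<bar>x \<bullet> b\<bar>) ` Basis)) = Max ((*) \<bar>c\<bar> ` (\<lambda>b. \<bar>x \<bullet> b\<bar>) ` Basis)"
    by (rule mono_Max_commute) (auto intro!: monoI mult_left_mono)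
  then show ?thesis using inf by (simp add: pnorm_def abs_mult image_image)
qed

text \<open>By monotonicity the vector with all coordinates equal to c is the worst case, and the
  norm is homogeneous.\<close>

lemma pnorm_le_const:
  assumes "0 < p"
  obtains K where "0 < K"
    "\<And>(x::'a::euclidean_space) c. (\<And>b. b \<in> Basis \<Longrightarrow> \<bar>x \<bullet> b\<bar> \<le> c) \<Longrightarrow> pnorm p x \<le> K * c"
proof
  \<comment> \<open>The summand 1 only serves to make the constant visibly positive.\<close>
  show "0 < pnorm p (One::'a) + 1" using pnorm_nonneg[of p "One::'a"] by linarith
  fix x :: 'a and c assume c: "\<And>b. b \<in> Basis \<Longrightarrow> \<bar>x \<bullet> b\<bar> \<le> c"
  obtain b :: 'a where "b \<in> Basis" by (meson nonempty_Basis ex_in_conv)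
  then have c0: "0 \<le> c" using c by force
  have "pnorm p x \<le> pnorm p (c *\<^sub>R (One::'a))"
    using c c0 by (intro pnorm_mono assms) auto
  also have "\<dots> \<le> (pnorm p (One::'a) + 1) * c"
    using c0 by (simp add: pnorm_scaleR assms algebra_simps)
  finally show "pnorm p x \<le> (pnorm p (One::'a) + 1) * c" .
qed

lemma pnorm_zero [simp]: "0 < p \<Longrightarrow> pnorm p 0 = 0"
  using pnorm_scaleR[of p 0 0] by simp

lemma pnorm_eq_0_iff: "0 < p \<Longrightarrow> pnorm p x = 0 \<longleftrightarrow> x = 0"
proof
  assume p: "0 < p" and 0: "pnorm p x = 0"
  then have "x \<bullet> b = 0" if "b \<in> Basis" for b
    using abs_inner_le_pnorm[OF p that, of x] by simp
  then show "x = 0" using euclidean_all_zero_iff[of x] by simp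
qed simp

lemma norm_le_pnorm:
  assumes "0 < p"
  shows "norm (x::'a::euclidean_space) \<le> DIM('a) * pnorm p x"
proof -
  have "norm x \<le> (\<Sum>b\<in>Basis. \<bar>x \<bullet> b\<bar>)" by (rule norm_le_l1)
  also have "\<dots> \<le> (\<Sum>b\<in>(Basis::'a set). pnorm p x)"
    by (intro sum_mono abs_inner_le_pnorm assms)
  finally show ?thesis by simp
qed

abbreviation pdist :: "ereal \<Rightarrow> 'a::euclidean_space \<Rightarrow> 'a \<Rightarrow> real" where
  "pdist p \<equiv> \<lambda>x y. pnorm p (x - y)"

lemma controls_dist_pnorm:
  assumes "0 < p"
  shows "controls_dist (pdist p :: 'a::euclidean_space \<Rightarrow> _)"
  unfolding controls_dist_def
proof (intro allI impI)
  fix e :: real assume e: "0 < e"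
  show "\<exists>\<delta>>0. \<forall>x y::'a. pnorm p (x - y) \<le> \<delta> \<longrightarrow> dist x y < e"
  proof (intro exI[of _ "e / (2 * DIM('a))"] conjI allI impI)
    fix x y :: 'a assume "pnorm p (x - y) \<le> e / (2 * DIM('a))"
    then have "DIM('a) * pnorm p (x - y) \<le> DIM('a) * (e / (2 * DIM('a)))"
      by (intro mult_left_mono) auto
    also have "\<dots> = e / 2" by simp
    finally have "norm (x - y) \<le> e / 2" using norm_le_pnorm[OF assms, of "x - y"] by linarith
    then show "dist x y < e" using e by (simp add: dist_norm)
  qed (use e in simp)
qed

lemma continuous_on_pnorm [continuous_intros]:
  assumes "0 < p"
  shows "continuous_on A (pnorm p :: 'a::euclidean_space \<Rightarrow> real)"
  using assms
proof (cases p rule: ereal_pos_cases)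
  case (real r)
  then have "pnorm p = (\<lambda>x::'a. (\<Sum>b\<in>Basis. \<bar>x \<bullet> b\<bar> powr r) powr (1 / r))"
    by (auto simp: pnorm_ereal)
  moreover have "continuous_on A (\<lambda>x::'a. (\<Sum>b\<in>Basis. \<bar>x \<bullet> b\<bar> powr r) powr (1 / r))"
    using real by (intro continuous_on_powr' continuous_intros ballI) (auto simp: sum_nonneg)
  ultimately show ?thesis by simp
next
  case inf
  have *: "continuous_on A (\<lambda>x. Max ((\<lambda>b. \<bar>x \<bullet> b\<bar>) ` B))" if "finite B" "B \<noteq> {}" for B :: "'a set"
    using that
  proof (induction B rule: finite_ne_induct)
    case (insert b F)
    then have "(\<lambda>x. Max ((\<lambda>b. \<bar>x \<bullet> b\<bar>) ` insert b F)) = (\<lambda>x. max \<bar>x \<bullet> b\<bar> (Max ((\<lambda>b. \<bar>x \<bullet> b\<bar>) ` F)))"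
      by auto
    then show ?case using insert by (auto intro!: continuous_intros)
  qed (auto intro!: continuous_intros)
  then show ?thesis using inf *[of Basis] by (simp add: pnorm_def[abs_def])
qed

lemma borel_measurable_pnorm [measurable]:
  "0 < p \<Longrightarrow> pnorm p \<in> borel_measurable borel"
  by (intro borel_measurable_continuous_onI continuous_on_pnorm)

lemma sum_Basis_Pair:
  "(\<Sum>b\<in>Basis. f b) = (\<Sum>b\<in>Basis. f (b, 0)) + f (0, 1::real)"
proof -
  have "(\<Sum>b\<in>Basis. f b) = sum f ((\<lambda>u. (u, 0)) ` Basis) + sum f ((\<lambda>u. (0, u)) ` Basis)"
    unfolding Basis_prod_def by (intro sum.union_disjoint) auto
  then show ?thesis by (simp add: sum.reindex inj_on_def)
qed

lemma pnorm_Pair_powr: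
  assumes "0 < r"
  shows "pnorm (ereal r) (z, y::real) powr r = pnorm (ereal r) z powr r + \<bar>y\<bar> powr r"
  using assms by (simp add: pnorm_powr sum_Basis_Pair)

lemma pnorm_Pair_inf:
  "pnorm \<infinity> (z, y::real) = max (pnorm \<infinity> z) \<bar>y\<bar>"
proof -
  have "(\<lambda>b. \<bar>(z, y) \<bullet> b\<bar>) ` Basis = (\<lambda>b. \<bar>z \<bullet> b\<bar>) ` Basis \<union> {\<bar>y\<bar>}"
    by (auto simp: Basis_prod_def image_Un image_image)
  then show ?thesis by (simp add: pnorm_def Max_Un)
qed

lemma pnorm_le_Pair:
  assumes "0 < p"
  shows "pnorm p z \<le> pnorm p (z, y::real)"
  using assms
proof (cases p rule: ereal_pos_cases)
  case (real r)
  have "pnorm p z powr r \<le> pnorm p (z, y) powr r" using real by (simp add: pnorm_Pair_powr)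
  then show ?thesis using real by (meson pnorm_nonneg powr_less_mono2 not_le)
qed (auto simp: pnorm_Pair_inf)

lemma pnorm_Pair_0:
  assumes "0 < p"
  shows "pnorm p (z, 0::real) = pnorm p z"
  using assms
proof (cases p rule: ereal_pos_cases)
  case (real r)
  then show ?thesis by (simp add: pnorm_ereal sum_Basis_Pair)
qed (auto simp: pnorm_Pair_inf pnorm_nonneg)

subsection \<open>Hausdorff measure of full dimension\<close>

text \<open>Let Q be the unit cube and integrate 1_A(x) 1_Q(x + y) with M in x and Lebesgue measure
  in y. Integrating over y first gives M(A). Shifting x by y first, which M allows, and then
  integrating over y gives M(Q) times the Lebesgue measure of A.\<close>

lemma translation_invariant_measure_eq_lborel:
  fixes M :: "'a::euclidean_space measure"
  assumes sets_M [simp, measurable_cong]: "sets M = sets borel"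
    and inv: "\<And>a A. A \<in> sets borel \<Longrightarrow> emeasure M ((+) a ` A) = emeasure M A"
    and fin: "emeasure M (cbox 0 One) < \<infinity>" and A: "A \<in> sets borel"
  shows "emeasure M A = emeasure M (cbox 0 One) * emeasure lborel A"
proof -
  have [simp]: "space M = UNIV" using sets_eq_imp_space_eq[OF sets_M] by simp
  \<comment> \<open>Translates of the unit cube by a countable dense set cover the space. They all
    have the measure of the cube, so M is sigma-finite and Fubini's theorem applies.\<close>
  obtain D :: "'a set" where D: "countable D" "\<And>X. open X \<Longrightarrow> X \<noteq> {} \<Longrightarrow> \<exists>d\<in>D. d \<in> X"
    using countable_dense_setE by metis
  have "sigma_finite_measure M"
  proof
    show "\<exists>A. countable A \<and> A \<subseteq> sets M \<and> \<Union> A = space M \<and> (\<forall>a\<in>A. emeasure M a \<noteq> \<infinity>)"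
    proof (intro exI[of _ "(\<lambda>a. (+) a ` cbox 0 One) ` D"] conjI ballI)
      show "\<Union> ((\<lambda>a. (+) a ` cbox 0 One) ` D) = space M"
      proof -
        have "x \<in> (\<Union>a\<in>D. (+) a ` cbox 0 One)" for x
        proof -
          have "(1/2) *\<^sub>R One \<in> box 0 (One::'a)" by (auto simp: mem_box)
          then have ne: "box (0::'a) One \<noteq> {}" by blast
          have "open ((\<lambda>d. x - d) ` box 0 One)" by (intro open_neg_translation open_box)
          then obtain a where "a \<in> D" "a \<in> (\<lambda>d. x - d) ` box 0 One" using D(2) ne by blast
          then show ?thesis using box_subset_cbox[of 0 "One::'a"] by force
        qed
        then show ?thesis by auto
      qed
    qed (use D(1) inv fin in \<open>auto simp: less_top intro!: borel_closed closed_translation\<close>)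
  qed
  then interpret M: sigma_finite_measure M .
  note A[measurable]
  have [measurable]: "cbox 0 (One::'a) \<in> sets borel" by simp
  interpret pair_sigma_finite M lborel
    by (intro pair_sigma_finite.intro M.sigma_finite_measure_axioms sigma_finite_lborel)
  have lb: "emeasure lborel {y. x - y \<in> A} = emeasure lborel A" for x
  proof -
    have "emeasure lborel A = emeasure (distr lborel borel (\<lambda>y. x + (-1) *\<^sub>R y)) A"
      by (subst lborel_affine[of "-1" x]) (auto simp: density_1)
    then show ?thesis using A by (simp add: emeasure_distr vimage_def)
  qed
  have lb2: "emeasure lborel {y. x + y \<in> cbox 0 One} = 1" for x :: 'a
  proof -
    have "emeasure lborel (cbox 0 (One::'a)) = emeasure (distr lborel borel ((+) x)) (cbox 0 One)"
      by (simp add: lborel_distr_plus)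
    also have "\<dots> = emeasure lborel {y. x + y \<in> cbox 0 One}"
      by (subst emeasure_distr) (auto simp: vimage_def)
    finally show ?thesis by simp
  qed
  \<comment> \<open>The invariance of M enters here: translation by y carries one set onto the
    other.\<close>
  have shift: "emeasure M {x. x \<in> A \<and> x + y \<in> cbox 0 One} = emeasure M {x. x \<in> cbox 0 One \<and> x - y \<in> A}" for y
  proof -
    have "(+) y ` {x. x \<in> A \<and> x + y \<in> cbox 0 One} = {x. x \<in> cbox 0 One \<and> x - y \<in> A}"
      by (auto simp: image_iff add.commute intro!: exI[of _ "_ - y"])
    then show ?thesis using inv[of "{x. x \<in> A \<and> x + y \<in> cbox 0 One}" y] A by simp
  qed
  have ind: "(\<integral>\<^sup>+x. indicator X x * indicator Y (g x) \<partial>N) = emeasure N {x. x \<in> X \<and> g x \<in> Y}"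
    if [measurable]: "X \<in> sets borel" "Y \<in> sets borel" "g \<in> borel_measurable borel" "sets N = sets borel"
    for X Y and g :: "'a \<Rightarrow> 'a" and N
  proof -
    have "emeasure N {x. x \<in> X \<and> g x \<in> Y} = (\<integral>\<^sup>+x. indicator {x. x \<in> X \<and> g x \<in> Y} x \<partial>N)"
      using that by (intro nn_integral_indicator[symmetric]) simp
    also have "\<dots> = (\<integral>\<^sup>+x. indicator X x * indicator Y (g x) \<partial>N)"
      by (intro nn_integral_cong) (auto split: split_indicator)
    finally show ?thesis ..
  qed
  have ind_const: "(\<integral>\<^sup>+y. indicator X x * indicator Y (g y) \<partial>lborel) = indicator X x * emeasure lborel {y. g y \<in> Y}"
    if [measurable]: "X \<in> sets borel" "Y \<in> sets borel" "g \<in> borel_measurable borel"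
    for X Y and x :: 'a and g :: "'a \<Rightarrow> 'a"
    using ind[of UNIV Y g lborel] that by (subst nn_integral_cmult) auto
  have "emeasure M A = (\<integral>\<^sup>+x. indicator A x * emeasure lborel {y. x + y \<in> cbox 0 One} \<partial>M)"
    using A by (simp add: lb2)
  also have "\<dots> = (\<integral>\<^sup>+x. \<integral>\<^sup>+y. indicator A x * indicator (cbox 0 One) (x + y) \<partial>lborel \<partial>M)"
    by (simp add: ind_const)
  also have "\<dots> = (\<integral>\<^sup>+y. \<integral>\<^sup>+x. indicator A x * indicator (cbox 0 One) (x + y) \<partial>M \<partial>lborel)"
    by (intro Fubini'[symmetric]) measurable
  also have "\<dots> = (\<integral>\<^sup>+y. emeasure M {x. x \<in> A \<and> x + y \<in> cbox 0 One} \<partial>lborel)"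
    by (simp add: ind)
  also have "\<dots> = (\<integral>\<^sup>+y. emeasure M {x. x \<in> cbox 0 One \<and> x - y \<in> A} \<partial>lborel)"
    by (simp only: shift)
  also have "\<dots> = (\<integral>\<^sup>+y. \<integral>\<^sup>+x. indicator (cbox 0 One) x * indicator A (x - y) \<partial>M \<partial>lborel)"
    by (simp add: ind)
  also have "\<dots> = (\<integral>\<^sup>+x. \<integral>\<^sup>+y. indicator (cbox 0 One) x * indicator A (x - y) \<partial>lborel \<partial>M)"
    by (intro Fubini') measurable
  also have "\<dots> = (\<integral>\<^sup>+x. indicator (cbox 0 One) x * emeasure lborel {y. x - y \<in> A} \<partial>M)"
    by (simp add: ind_const)
  also have "\<dots> = emeasure M (cbox 0 One) * emeasure lborel A"
    unfolding lb by (subst nn_integral_multc) auto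
  finally show ?thesis .
qed

section \<open>Comparison with Lebesgue measure in full dimension\<close>

lemma hausdorff_premeasure_finite_UN:
  assumes "finite I"
  shows "hausdorff_premeasure d k \<delta> (\<Union>i\<in>I. A i) \<le> (\<Sum>i\<in>I. hausdorff_premeasure d k \<delta> (A i))"
proof -
  have 0: "hausdorff_premeasure d k \<delta> {} = 0"
    using hausdorff_premeasure_le[of "{}" "\<lambda>_. {}" d \<delta> k]
    by (auto simp: cover_cost_def diam_wrt_def bot_ennreal)
  have Un: "hausdorff_premeasure d k \<delta> (X \<union> Y) \<le> hausdorff_premeasure d k \<delta> X + hausdorff_premeasure d k \<delta> Y" for X Y
    using hausdorff_premeasure_UN[of d k \<delta> "binaryset X Y"]
    by (simp add: 0 suminf_binaryset_eq UN_binaryset_eq)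
  from assms show ?thesis
  proof (induction I rule: finite_induct)
    case (insert x F)
    then show ?case
      using Un[of "A x" "\<Union>i\<in>F. A i"] by (simp add: add_left_mono order_trans)
  qed (simp add: 0)
qed

lemma hausdorff_premeasure_le_cost:
  assumes "diam_wrt d U \<le> ennreal \<delta>"
  shows "hausdorff_premeasure d k \<delta> U \<le> cover_cost d k U"
proof -
  have "hausdorff_premeasure d k \<delta> U \<le> (\<Sum>i::nat. cover_cost d k (if i = 0 then U else {}))"
    using assms by (intro hausdorff_premeasure_le) (auto simp: diam_wrt_def bot_ennreal)
  also have "\<dots> = (\<Sum>i\<in>{0::nat}. cover_cost d k (if i = 0 then U else {}))"
    by (rule suminf_finite) (auto simp: cover_cost_def)
  finally show ?thesis by simp
qed

text \<open>The cube is cut into N^k cells of side 1/N, each of diameter at most K/N. The total cost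
  is K^k whatever N is, so the scale can be made as small as desired.\<close>

lemma hausdorff_measure_unit_cube_finite:
  assumes p: "0 < p"
  shows "hausdorff_measure (pdist p) DIM('a) (cbox 0 (One :: 'a::euclidean_space)) < \<infinity>"
proof -
  let ?k = "DIM('a)"
  obtain K where K: "0 < K"
    "\<And>(x::'a) c. (\<And>b. b \<in> Basis \<Longrightarrow> \<bar>x \<bullet> b\<bar> \<le> c) \<Longrightarrow> pnorm p x \<le> K * c"
    using pnorm_le_const[OF p] by metis
  have "hausdorff_premeasure (pdist p) ?k \<delta> (cbox 0 (One :: 'a)) \<le> ennreal (K ^ ?k)"
    if \<delta>: "0 < \<delta>" for \<delta>
  proof -
    obtain N :: nat where N: "K / \<delta> < real N" using reals_Archimedean2 by blast
    moreover have "0 < K / \<delta>" using K \<delta> by simp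
    ultimately have N0: "0 < real N" by linarith
    have KN: "K / N \<le> \<delta>" using N N0 \<delta> by (simp add: field_simps)
    define I where "I = PiE (Basis :: 'a set) (\<lambda>_. {..<N})"
    define Q where "Q g = {x::'a. \<forall>b\<in>Basis. real (g b) / N \<le> x \<bullet> b \<and> x \<bullet> b \<le> (real (g b) + 1) / N}" for g
    have fI: "finite I" and cI: "card I = N ^ ?k"
      by (auto simp: I_def finite_PiE card_PiE)
    have cov: "cbox 0 (One::'a) \<subseteq> (\<Union>g\<in>I. Q g)"
    proof
      fix x :: 'a assume x: "x \<in> cbox 0 One"
      \<comment> \<open>The cap at N - 1 assigns points with a coordinate equal to 1 to the last
        cell.\<close>
      define g where "g = (\<lambda>b\<in>Basis. min (N - 1) (nat \<lfloor>N * (x \<bullet> b)\<rfloor>))"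
      have "g \<in> I" using N0 by (auto simp: g_def I_def)
      moreover have "x \<in> Q g"
        unfolding Q_def
      proof (safe)
        fix b :: 'a assume b: "b \<in> Basis"
        then have xb: "0 \<le> x \<bullet> b" "x \<bullet> b \<le> 1" using x by (auto simp: mem_box)
        have fl: "real (nat \<lfloor>N * (x \<bullet> b)\<rfloor>) \<le> N * (x \<bullet> b)" "N * (x \<bullet> b) < real (nat \<lfloor>N * (x \<bullet> b)\<rfloor>) + 1"
          using xb N0 by (auto simp: of_nat_nat)
        have gb: "g b = min (N - 1) (nat \<lfloor>N * (x \<bullet> b)\<rfloor>)" using b by (simp add: g_def)
        have "real (g b) \<le> N * (x \<bullet> b)" using fl gb by (simp add: min_def split: if_splits)
        then show "real (g b) / N \<le> x \<bullet> b" using N0 by (simp add: field_simps)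
        have "N * (x \<bullet> b) \<le> real (g b) + 1"
        proof (cases "nat \<lfloor>N * (x \<bullet> b)\<rfloor> \<le> N - 1")
          case True then show ?thesis using fl gb by simp
        next
          case False
          then have "real (g b) + 1 = N" using gb N0 by (simp add: of_nat_diff)
          then show ?thesis using xb N0 by (simp add: mult_left_le)
        qed
        then show "x \<bullet> b \<le> (real (g b) + 1) / N" using N0 by (simp add: field_simps)
      qed
      ultimately show "x \<in> (\<Union>g\<in>I. Q g)" by blast
    qed
    have diam: "diam_wrt (pdist p) (Q g) \<le> ennreal (K / N)" for g
      unfolding diam_wrt_le_iff
    proof (intro ballI ennreal_leI)
      fix x y assume "x \<in> Q g" "y \<in> Q g"
      then have xy: "real (g b) / N \<le> x \<bullet> b" "x \<bullet> b \<le> real (g b) / N + 1 / N"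
          "real (g b) / N \<le> y \<bullet> b" "y \<bullet> b \<le> real (g b) / N + 1 / N" if "b \<in> Basis" for b
        using that by (simp_all add: Q_def add_divide_distrib)
      have "\<bar>(x - y) \<bullet> b\<bar> \<le> 1 / N" if "b \<in> Basis" for b
        using xy[OF that] unfolding inner_diff_left by linarith
      then show "pnorm p (x - y) \<le> K / N" using K(2)[of "x - y" "1 / N"] by simp
    qed
    have cost: "cover_cost (pdist p) ?k (Q g) \<le> ennreal ((K / N) ^ ?k)" for g
      using power_mono[OF diam[of g], of ?k] K N0 by (auto simp: cover_cost_def ennreal_power)
    have "hausdorff_premeasure (pdist p) ?k \<delta> (cbox 0 (One :: 'a)) \<le>
        hausdorff_premeasure (pdist p) ?k \<delta> (\<Union>g\<in>I. Q g)"
      by (rule hausdorff_premeasure_subset[OF cov])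
    also have "\<dots> \<le> (\<Sum>g\<in>I. hausdorff_premeasure (pdist p) ?k \<delta> (Q g))"
      by (rule hausdorff_premeasure_finite_UN[OF fI])
    also have "\<dots> \<le> (\<Sum>g\<in>I. ennreal ((K / N) ^ ?k))"
      by (intro sum_mono order_trans[OF hausdorff_premeasure_le_cost cost]
            order_trans[OF diam] ennreal_leI KN)
    also have "\<dots> = ennreal (K ^ ?k)"
      using K N0 by (simp add: cI power_divide ennreal_of_nat_eq_real_of_nat flip: ennreal_mult)
    finally show ?thesis .
  qed
  then have "hausdorff_measure (pdist p) ?k (cbox 0 (One :: 'a)) \<le> ennreal (K ^ ?k)"
    unfolding hausdorff_measure_def by (intro SUP_least) auto
  then show ?thesis by (simp add: order_le_less_trans)
qed

text \<open>Coordinates are bounded by the p-norm, so a set of diameter D lies in the cube of side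
  2D around any of its points. This is the source of the factor 2^k.\<close>

lemma lborel_le_hausdorff_measure:
  fixes A :: "'a::euclidean_space set"
  assumes p: "0 < p"
  shows "emeasure lborel A \<le> 2 ^ DIM('a) * hausdorff_measure (pdist p) DIM('a) A"
\<comment> \<open>For other sets \<open>emeasure lborel\<close> is 0 by convention, and the claim is
  trivial.\<close>
proof (cases "A \<in> sets borel")
  case True
  let ?k = "DIM('a)"
  have "emeasure lborel A / 2 ^ ?k \<le> hausdorff_premeasure (pdist p) ?k 1 A"
  proof (rule hausdorff_premeasure_greatest)
    fix U :: "nat \<Rightarrow> 'a set"
    assume U: "A \<subseteq> (\<Union>i. U i)" "\<And>i. diam_wrt (pdist p) (U i) \<le> ennreal 1"
    define D where "D i = enn2real (diam_wrt (pdist p) (U i))" for i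
    have D: "diam_wrt (pdist p) (U i) = ennreal (D i)" for i
      using order_le_less_trans[OF U(2)[of i] ennreal_less_top] by (simp add: D_def)
    have D0: "0 \<le> D i" for i by (simp add: D_def)
    define c where "c i = (SOME x. x \<in> U i)" for i
    define B where "B i = (if U i = {} then {} else cbox (c i - D i *\<^sub>R One) (c i + D i *\<^sub>R One))" for i
    have UB: "U i \<subseteq> B i" for i
    proof
      fix x assume x: "x \<in> U i"
      then have c: "c i \<in> U i" unfolding c_def by (metis someI)
      have "pnorm p (x - c i) \<le> D i"
        using le_diam_wrt[OF x c, of "pdist p"] D0[of i] unfolding D by (simp add: ennreal_le_iff)
      then have "\<bar>x \<bullet> b - c i \<bullet> b\<bar> \<le> D i" if "b \<in> Basis" for b
        using abs_inner_le_pnorm[OF p that, of "x - c i"] unfolding inner_diff_left by linarith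
      then have "c i \<bullet> b - D i \<le> x \<bullet> b" "x \<bullet> b \<le> c i \<bullet> b + D i" if "b \<in> Basis" for b
        using that by (simp_all add: abs_le_iff algebra_simps)
      then show "x \<in> B i"
        using x by (auto simp: B_def mem_box inner_diff_left inner_add_left)
    qed
    have Bm: "B i \<in> sets borel" for i by (simp add: B_def)
    have cost: "emeasure lborel (B i) = 2 ^ ?k * cover_cost (pdist p) ?k (U i)" for i
    proof (cases "U i = {}")
      case False
      have "emeasure lborel (B i) = ennreal (\<Prod>b\<in>(Basis::'a set). 2 * D i)"
        using False D0 by (simp add: B_def emeasure_lborel_cbox_eq inner_diff_left inner_add_left)
      also have "\<dots> = (2 * ennreal (D i)) ^ ?k"
        using D0 by (simp add: ennreal_power[symmetric] ennreal_mult del: ennreal_power)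
      also have "\<dots> = 2 ^ ?k * ennreal (D i) ^ ?k" by (rule power_mult_distrib)
      finally show ?thesis using False by (simp add: cover_cost_def D)
    qed (simp add: B_def cover_cost_def)
    have "A \<subseteq> (\<Union>i. B i)"
      by (rule order_trans[OF U(1)]) (intro UN_mono order_refl UB)
    then have "emeasure lborel A \<le> emeasure lborel (\<Union>i. B i)"
      using Bm by (intro emeasure_mono) auto
    also have "\<dots> \<le> (\<Sum>i. emeasure lborel (B i))"
      using Bm by (intro emeasure_subadditive_countably) auto
    also have "\<dots> = 2 ^ ?k * (\<Sum>i. cover_cost (pdist p) ?k (U i))"
      by (simp add: cost)
    finally show "emeasure lborel A / 2 ^ ?k \<le> (\<Sum>i. cover_cost (pdist p) ?k (U i))"
      by (intro divide_le_posI_ennreal) (auto simp: mult.commute zero_less_iff_neq_zero)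
  qed
  also have "\<dots> \<le> hausdorff_measure (pdist p) ?k A"
    by (rule hausdorff_premeasure_le_measure) simp
  finally have "2 ^ ?k * (emeasure lborel A / 2 ^ ?k) \<le> 2 ^ ?k * hausdorff_measure (pdist p) ?k A"
    by (intro mult_left_mono) auto
  moreover have "2 ^ ?k * (emeasure lborel A / 2 ^ ?k) = emeasure lborel A"
  proof -
    have "2 ^ ?k * (emeasure lborel A / 2 ^ ?k) = emeasure lborel A * 2 ^ ?k / 2 ^ ?k"
      by (simp only: ennreal_times_divide mult.commute)
    also have "\<dots> = emeasure lborel A"
      by (rule ennreal_mult_divide_eq) (auto simp: power_eq_top_ennreal)
    finally show ?thesis .
  qed
  ultimately show ?thesis by simp
qed (simp add: emeasure_notin_sets)

text \<open>The constant is the value on the unit cube: finite by the subdivision into small cells,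
  nonzero by the comparison with Lebesgue measure.\<close>

lemma hausdorff_measure_eq_lborel:
  assumes p: "0 < p"
  obtains \<kappa> where "0 < \<kappa>" "\<And>A. (A :: 'a::euclidean_space set) \<in> sets borel \<Longrightarrow>
    hausdorff_measure (pdist p) DIM('a) A = ennreal \<kappa> * emeasure lborel A"
proof -
  let ?H = "hausdorff_measure (pdist p) DIM('a) :: 'a set \<Rightarrow> ennreal"
  let ?M = "hausdorff_borel (pdist p) DIM('a) :: 'a measure"
  have e: "emeasure ?M A = ?H A" if "A \<in> sets borel" for A
    using that by (rule emeasure_hausdorff_borel[OF controls_dist_pnorm[OF p]])
  have fin: "?H (cbox 0 One) < \<infinity>" by (rule hausdorff_measure_unit_cube_finite[OF p])
  have M: "emeasure ?M A = emeasure ?M (cbox 0 One) * emeasure lborel A" if "A \<in> sets borel" for A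
  proof (rule translation_invariant_measure_eq_lborel)
    fix a :: 'a and A :: "'a set" assume A: "A \<in> sets borel"
    have "(+) a ` A = (\<lambda>x. x - a) -` A \<inter> space borel" by (force simp: image_iff)
    also have "\<dots> \<in> sets borel" by (rule measurable_sets[OF _ A]) measurable
    finally show "emeasure ?M ((+) a ` A) = emeasure ?M A"
      using A by (simp add: e hausdorff_measure_isometric_image)
  qed (use that fin in \<open>auto simp: e\<close>)
  define \<kappa> where "\<kappa> = enn2real (?H (cbox 0 One))"
  have \<kappa>: "?H (cbox 0 One) = ennreal \<kappa>" using fin by (simp add: \<kappa>_def)
  have "1 \<le> 2 ^ DIM('a) * ?H (cbox 0 One)"
    using lborel_le_hausdorff_measure[OF p, of "cbox 0 (One::'a)"] by simp
  then have "?H (cbox 0 One) \<noteq> 0" by auto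
  then have "0 < \<kappa>" using fin by (simp add: \<kappa>_def enn2real_positive_iff zero_less_iff_neq_zero)
  moreover have "?H A = ennreal \<kappa> * emeasure lborel A" if "A \<in> sets borel" for A
    using M[OF that] e[OF that] by (simp add: e \<kappa>)
  ultimately show thesis by (rule that)
qed

subsection \<open>Squigonometric functions\<close>

definition quarter_circle :: "real \<Rightarrow> real \<Rightarrow> real" where
  "quarter_circle r u = (1 - u powr r) powr (1 / r)"

lemma quarter_circle_nonneg [simp]: "0 \<le> quarter_circle r u"
  by (simp add: quarter_circle_def)

lemma powr_le_one_iff: "0 < r \<Longrightarrow> 0 \<le> u \<Longrightarrow> u powr r \<le> 1 \<longleftrightarrow> u \<le> (1::real)"
  using powr_mono2[of r u 1] powr_less_mono2[of r 1 u] by (smt (verit) powr_one_eq_one)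

lemma powr_less_one_iff: "0 < r \<Longrightarrow> 0 \<le> u \<Longrightarrow> u powr r < 1 \<longleftrightarrow> u < (1::real)"
  using powr_mono2[of r 1 u] powr_less_mono2[of r u 1] by (smt (verit) powr_one_eq_one)

lemma quarter_circle_powr: "0 < r \<Longrightarrow> 0 \<le> u \<Longrightarrow> u \<le> 1 \<Longrightarrow> quarter_circle r u powr r = 1 - u powr r"
  by (simp add: quarter_circle_def powr_powr powr_le_one_iff)

lemma quarter_circle_0 [simp]: "quarter_circle r 0 = 1"
  by (simp add: quarter_circle_def)

lemma quarter_circle_1 [simp]: "quarter_circle r 1 = 0"
  by (simp add: quarter_circle_def)

lemma quarter_circle_pos: "0 < r \<Longrightarrow> 0 \<le> u \<Longrightarrow> u < 1 \<Longrightarrow> 0 < quarter_circle r u"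
  using powr_less_one_iff[of r u] by (simp add: quarter_circle_def)

lemma continuous_on_quarter_circle: "0 < r \<Longrightarrow> continuous_on {0..1} (quarter_circle r)"
  unfolding quarter_circle_def[abs_def]
  by (intro continuous_on_powr' continuous_intros ballI) (auto simp: powr_le_one_iff)

lemma quarter_circle_unique:
  assumes "0 < r" "0 \<le> u" "0 \<le> v" "u powr r + v powr r = 1"
  shows "v = quarter_circle r u"
proof -
  have "v powr r = 1 - u powr r" using assms(4) by linarith
  then have "(v powr r) powr (1 / r) = (1 - u powr r) powr (1 / r)" by simp
  then show ?thesis using assms by (simp add: quarter_circle_def powr_powr)
qed

lemma quarter_circle_le_iff:
  assumes "0 < r" "0 \<le> u" "u \<le> 1" "0 \<le> v"
  shows "v \<le> quarter_circle r u \<longleftrightarrow> u powr r + v powr r \<le> 1"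
proof -
  have "v \<le> quarter_circle r u \<longleftrightarrow> v powr r \<le> quarter_circle r u powr r"
    using assms powr_mono2[of r v "quarter_circle r u"] powr_less_mono2[of r "quarter_circle r u" v]
    by (cases "v \<le> quarter_circle r u") auto
  then show ?thesis using assms by (simp add: quarter_circle_powr) linarith
qed

lemma quarter_circle_antimono:
  assumes "0 < r" "0 \<le> u" "u \<le> v" "v \<le> 1"
  shows "quarter_circle r v \<le> quarter_circle r u"
  unfolding quarter_circle_def
  using assms by (intro powr_mono2) (auto simp: powr_le_one_iff intro: powr_mono2)

lemma quarter_circle_has_derivative:
  assumes r: "0 < r" and u: "0 < u" "u < 1"
  shows "(quarter_circle r has_real_derivative
           - (u powr (r - 1) * quarter_circle r u powr (1 - r))) (at u)"
proof -
  have lt: "u powr r < 1" using r u by (simp add: powr_less_one_iff)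
  have "((\<lambda>u. (1 - u powr r) powr (1 / r)) has_real_derivative
      - (r * u powr (r - 1)) * (1 / r * (1 - u powr r) powr (1 / r - 1))) (at u)"
    using r u lt by (auto intro!: derivative_eq_intros simp: field_simps)
  moreover have "(1 - u powr r) powr (1 / r - 1) = quarter_circle r u powr (1 - r)"
    using r by (simp add: quarter_circle_def powr_powr field_simps)
  ultimately show ?thesis
    using r unfolding quarter_circle_def[abs_def] by (simp add: mult.assoc)
qed

text \<open>Fubini over the vertical sections of the disk, each of length twice the profile; the
  symmetry x to -x gives the remaining factor 2.\<close>

lemma squig_pi_eq_integral:
  assumes r: "0 < r"
  shows "squig_pi (ereal r) / 2 = 2 * integral {0..1} (quarter_circle r)"
proof -
  let ?D = "{x :: real \<times> real. pnorm (ereal r) x \<le> 1}"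
  let ?f = "\<lambda>x. 2 * quarter_circle r \<bar>x\<bar>"
  have [measurable]: "pnorm (ereal r) \<in> borel_measurable (borel :: (real \<times> real) measure)"
    using r by (intro borel_measurable_pnorm) simp
  have D: "?D \<in> sets borel" by measurable
  have mem: "(x, y) \<in> ?D \<longleftrightarrow> \<bar>x\<bar> \<le> 1 \<and> \<bar>y\<bar> \<le> quarter_circle r \<bar>x\<bar>" for x y
  proof -
    have "(x, y) \<in> ?D \<longleftrightarrow> pnorm (ereal r) (x, y) powr r \<le> 1"
      using r by (simp add: powr_le_one_iff pnorm_nonneg)
    also have "\<dots> \<longleftrightarrow> \<bar>x\<bar> powr r + \<bar>y\<bar> powr r \<le> 1"
      using r by (subst pnorm_Pair_powr) (auto simp: pnorm_powr)
    also have "\<dots> \<longleftrightarrow> \<bar>x\<bar> \<le> 1 \<and> \<bar>y\<bar> \<le> quarter_circle r \<bar>x\<bar>"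
    proof (cases "\<bar>x\<bar> \<le> 1")
      case True
      then show ?thesis using r by (simp add: quarter_circle_le_iff)
    next
      case False
      then have "\<not> \<bar>x\<bar> powr r \<le> 1" using r by (simp add: powr_le_one_iff)
      then show ?thesis using False by (smt (verit) powr_ge_zero)
    qed
    finally show ?thesis .
  qed
  have cont: "continuous_on {-1..1} ?f"
    by (intro continuous_intros continuous_on_compose2[OF continuous_on_quarter_circle[OF r]]) auto
  have "emeasure lborel ?D = emeasure (lborel \<Otimes>\<^sub>M lborel) ?D" by (simp add: lborel_prod)
  also have "\<dots> = (\<integral>\<^sup>+x. emeasure lborel (Pair x -` ?D) \<partial>lborel)"
    by (rule lborel.emeasure_pair_measure_alt) (simp only: lborel_prod sets_lborel D)
  also have "\<dots> = (\<integral>\<^sup>+x. ennreal (?f x) * indicator {-1..1} x \<partial>lborel)"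
  proof (intro nn_integral_cong)
    fix x
    have "Pair x -` ?D = (if \<bar>x\<bar> \<le> 1 then {- quarter_circle r \<bar>x\<bar>..quarter_circle r \<bar>x\<bar>} else {})"
      unfolding vimage_def mem by (auto simp: abs_le_iff)
    then show "emeasure lborel (Pair x -` ?D) = ennreal (?f x) * indicator {-1..1} x"
      by (auto simp: abs_le_iff indicator_def)
  qed
  also have "\<dots> = ennreal (integral {-1..1} ?f)"
    by (intro nn_integral_has_integral_lebesgue' integrable_integral integrable_continuous_real cont) simp
  finally have em: "emeasure lborel ?D = ennreal (integral {-1..1} ?f)" .
  have "0 \<le> integral {-1..1} ?f"
    by (rule integral_nonneg[OF integrable_continuous_real[OF cont]]) simp
  then have "squig_pi (ereal r) = integral {-1..1} ?f"
    using D unfolding squig_pi_def by (subst measure_completion) (simp_all only: measure_def em enn2real_ennreal sets_lborel)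
  also have "\<dots> = integral {-1..0} ?f + integral {0..1} ?f"
    by (rule Henstock_Kurzweil_Integration.integral_combine[symmetric, OF _ _ integrable_continuous_real[OF cont]])
       simp_all
  also have "integral {-1..0} ?f = integral {0..1} ?f"
    using Henstock_Kurzweil_Integration.integral_reflect_real[of 1 0 ?f] by simp
  also have "integral {0..1} ?f = integral {0..1} (\<lambda>x. 2 * quarter_circle r x)"
    by (rule integral_cong) simp
  finally show ?thesis by simp
qed

text \<open>Twice the area of the sector between the directions \<open>(0, 1)\<close> and \<open>(s, quarter_circle r s)\<close>;
  this is the inverse function of \<open>sin\<^sub>r\<close>.\<close>

definition squig_arcsin :: "real \<Rightarrow> real \<Rightarrow> real" where
  "squig_arcsin r s = 2 * integral {0..s} (quarter_circle r) - s * quarter_circle r s"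

context
  fixes r :: real
  assumes r: "0 < r"
begin

lemma continuous_on_squig_arcsin: "continuous_on {0..1} (squig_arcsin r)"
  unfolding squig_arcsin_def[abs_def]
  by (intro continuous_intros indefinite_integral_continuous_1 integrable_continuous_real
        continuous_on_quarter_circle[OF r])

lemma squig_arcsin_has_derivative:
  assumes s: "0 < s" "s < 1"
  shows "(squig_arcsin r has_real_derivative quarter_circle r s powr (1 - r)) (at s)"
proof -
  let ?y = "quarter_circle r s"
  have y: "0 < ?y" using quarter_circle_pos[OF r] s by simp
  have "((\<lambda>s. integral {0..s} (quarter_circle r)) has_real_derivative ?y) (at s within {0..1})"
    using s by (intro integral_has_real_derivative continuous_on_quarter_circle r) auto
  then have I: "((\<lambda>s. integral {0..s} (quarter_circle r)) has_real_derivative ?y) (at s)"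
    using s by (subst (asm) at_within_interior) auto
  have "(squig_arcsin r has_real_derivative
      2 * ?y - (1 * ?y + - (s powr (r - 1) * ?y powr (1 - r)) * s)) (at s)"
    unfolding squig_arcsin_def[abs_def]
    by (intro DERIV_diff DERIV_mult DERIV_ident DERIV_cmult I quarter_circle_has_derivative r s)
  \<comment> \<open>The relation q^r + s^r = 1 collapses the derivative to q^(1-r). This is the
    reciprocal of S' = C^(r-1), as it must be for an inverse of S.\<close>
  moreover have "2 * ?y - (1 * ?y + - (s powr (r - 1) * ?y powr (1 - r)) * s) = ?y powr (1 - r)"
  proof -
    have "?y = ?y powr r * ?y powr (1 - r)" using y by (simp flip: powr_add)
    moreover have "s powr (r - 1) * s = s powr r" using s by (simp add: powr_mult_base mult.commute)
    ultimately have "?y + s powr (r - 1) * ?y powr (1 - r) * s = (?y powr r + s powr r) * ?y powr (1 - r)"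
      by (simp add: algebra_simps)
    also have "?y powr r + s powr r = 1" using s by (simp add: quarter_circle_powr r)
    finally show ?thesis by simp
  qed
  ultimately show ?thesis by simp
qed

lemma squig_arcsin_0 [simp]: "squig_arcsin r 0 = 0"
  by (simp add: squig_arcsin_def)

lemma squig_arcsin_1: "squig_arcsin r 1 = squig_pi (ereal r) / 2"
  by (simp add: squig_arcsin_def squig_pi_eq_integral[OF r])

lemma squig_arcsin_strict_mono:
  assumes "0 \<le> a" "a < b" "b \<le> 1"
  shows "squig_arcsin r a < squig_arcsin r b"
proof (rule DERIV_pos_imp_increasing_open[OF assms(2)])
  fix x assume "a < x" "x < b"
  then have x: "0 < x" "x < 1" using assms by auto
  show "\<exists>y. (squig_arcsin r has_real_derivative y) (at x) \<and> 0 < y"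
    using squig_arcsin_has_derivative[OF x] quarter_circle_pos[OF r, of x] x by auto
qed (use assms in \<open>auto intro: continuous_on_subset[OF continuous_on_squig_arcsin]\<close>)

lemma squig_pi_pos: "0 < squig_pi (ereal r) / 2"
  using squig_arcsin_strict_mono[of 0 1] by (simp add: squig_arcsin_1)

lemma squig_arcsin_inj: "inj_on (squig_arcsin r) {0..1}"
  by (rule strict_mono_on_imp_inj_on) (auto simp: strict_mono_on_def intro: squig_arcsin_strict_mono)

lemma squig_arcsin_mono: "0 \<le> a \<Longrightarrow> a \<le> b \<Longrightarrow> b \<le> 1 \<Longrightarrow> squig_arcsin r a \<le> squig_arcsin r b"
  using squig_arcsin_strict_mono[of a b] by (cases "a = b") auto

lemma squig_arcsin_image: "squig_arcsin r ` {0..1} = {0..squig_pi (ereal r) / 2}"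
proof
  show "squig_arcsin r ` {0..1} \<subseteq> {0..squig_pi (ereal r) / 2}"
    using squig_arcsin_mono[of 0] squig_arcsin_mono[of _ 1] by (auto simp flip: squig_arcsin_1)
  show "{0..squig_pi (ereal r) / 2} \<subseteq> squig_arcsin r ` {0..1}"
  proof
    fix t assume "t \<in> {0..squig_pi (ereal r) / 2}"
    then have "\<exists>x\<ge>0. x \<le> 1 \<and> squig_arcsin r x = t"
      by (intro IVT') (auto simp: squig_arcsin_1 continuous_on_squig_arcsin)
    then show "t \<in> squig_arcsin r ` {0..1}" by auto
  qed
qed

text \<open>The sine is constructed as the inverse of the sector area. Existence is needed because
  \<open>squig_pair\<close> is a choice, about which nothing could be said if the system had no
  solution.\<close>

lemma squig_system_exists:
  defines "S \<equiv> inv_into {0..1} (squig_arcsin r)"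
  shows "squig_system r (quarter_circle r \<circ> S) S"
proof -
  let ?b = "squig_pi (ereal r) / 2"
  have SF: "S (squig_arcsin r s) = s" if "s \<in> {0..1}" for s
    unfolding S_def using squig_arcsin_inj that by (rule inv_into_f_f)
  have FS: "squig_arcsin r (S t) = t" if "t \<in> {0..?b}" for t
    unfolding S_def by (rule f_inv_into_f) (use that squig_arcsin_image in simp)
  have S01: "S t \<in> {0..1}" if "t \<in> {0..?b}" for t
    unfolding S_def by (rule inv_into_into) (use that squig_arcsin_image in simp)
  have contS: "continuous_on {0..?b} S"
    using continuous_on_inv[OF continuous_on_squig_arcsin, of S] SF squig_arcsin_image by simp
  have S0: "S 0 = 0" using SF[of 0] by simp
  have open01: "0 < S t \<and> S t < 1" if t: "t \<in> {0<..<?b}" for t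
  proof -
    have "S t \<noteq> 0" using FS[of t] t squig_arcsin_0 by force
    moreover have "S t \<noteq> 1" using FS[of t] t squig_arcsin_1 by force
    ultimately show ?thesis using S01[of t] t by auto
  qed
  have dS: "(S has_real_derivative quarter_circle r (S t) powr (r - 1)) (at t)" if t: "t \<in> {0<..<?b}" for t
  proof -
    have "(S has_real_derivative inverse (quarter_circle r (S t) powr (1 - r))) (at t)"
    proof (rule DERIV_inverse_function)
      show "(squig_arcsin r has_real_derivative quarter_circle r (S t) powr (1 - r)) (at (S t))"
        using open01[OF t] by (intro squig_arcsin_has_derivative) auto
      show "quarter_circle r (S t) powr (1 - r) \<noteq> 0"
        using quarter_circle_pos[OF r, of "S t"] open01[OF t] by simp
      show "0 < t" "t < ?b" using t by auto
      show "isCont S t"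
        by (rule continuous_on_interior[OF contS]) (use t in simp)
    qed (use FS in auto)
    then show ?thesis using powr_minus[of "quarter_circle r (S t)" "1 - r"] by simp
  qed
  have dC: "(quarter_circle r \<circ> S has_real_derivative - (S t powr (r - 1))) (at t)"
    if t: "t \<in> {0<..<?b}" for t
  proof -
    have q: "0 < quarter_circle r (S t)" using quarter_circle_pos[OF r, of "S t"] open01[OF t] by simp
    have "(quarter_circle r \<circ> S has_real_derivative
        - (S t powr (r - 1) * quarter_circle r (S t) powr (1 - r)) * quarter_circle r (S t) powr (r - 1)) (at t)"
      using open01[OF t] by (intro DERIV_chain quarter_circle_has_derivative r dS t) auto
    moreover have "quarter_circle r (S t) powr (1 - r) * quarter_circle r (S t) powr (r - 1) = 1"
      using q by (simp flip: powr_add)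
    ultimately show ?thesis by (simp add: mult.assoc)
  qed
  have "continuous_on {0..?b} (quarter_circle r \<circ> S)"
    by (rule continuous_on_compose[OF contS], rule continuous_on_subset[OF continuous_on_quarter_circle[OF r]])
       (use S01 in auto)
  then show ?thesis
    unfolding squig_system_def Let_def
    using contS S0 open01 dS dC quarter_circle_pos[OF r] by (auto simp: less_imp_le)
qed

section \<open>Uniqueness: every solution is determined on the interval\<close>

context
  fixes C S :: "real \<Rightarrow> real"
  assumes sys: "squig_system r C S"
begin

lemma squig_system_nonneg:
  assumes "t \<in> {0..squig_pi (ereal r) / 2}"
  shows "0 \<le> C t" "0 \<le> S t"
proof -
  let ?b = "squig_pi (ereal r) / 2"
  have cl: "closure {0<..<?b} = {0..?b}" using squig_pi_pos by (rule closure_greaterThanLessThan)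
  show "0 \<le> C t"
    by (rule continuous_ge_on_closure[of "{0<..<?b}"])
       (use assms sys in \<open>auto simp: cl squig_system_def Let_def less_imp_le\<close>)
  show "0 \<le> S t"
    by (rule continuous_ge_on_closure[of "{0<..<?b}"])
       (use assms sys in \<open>auto simp: cl squig_system_def Let_def less_imp_le\<close>)
qed

lemma squig_system_pythagoras:
  assumes t: "t \<in> {0..squig_pi (ereal r) / 2}"
  shows "S t powr r + C t powr r = 1"
proof -
  let ?b = "squig_pi (ereal r) / 2"
  have "S t powr r + C t powr r = S 0 powr r + C 0 powr r"
  proof (rule DERIV_isconst2[of 0 ?b])
    show "continuous_on {0..?b} (\<lambda>t. S t powr r + C t powr r)"
      using sys r squig_system_nonneg
      by (intro continuous_intros continuous_on_powr' ballI) (auto simp: squig_system_def Let_def)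
    fix x assume x: "0 < x" "x < ?b"
    then have d: "(C has_real_derivative - (S x powr (r - 1))) (at x)"
      "(S has_real_derivative C x powr (r - 1)) (at x)" "0 < C x" "0 < S x"
      using sys by (auto simp: squig_system_def Let_def)
    have "((\<lambda>t. S t powr r + C t powr r) has_real_derivative
       r * S x powr (r - 1) * C x powr (r - 1) + r * C x powr (r - 1) * - (S x powr (r - 1))) (at x)"
      by (intro DERIV_add DERIV_chain2[OF has_real_derivative_powr] d)
    then show "((\<lambda>t. S t powr r + C t powr r) has_real_derivative 0) (at x)" by (simp add: algebra_simps)
  qed (use squig_pi_pos t in auto)
  also have "\<dots> = 1" using sys r by (simp add: squig_system_def Let_def)
  finally show ?thesis .
qed

lemma squig_system_cos:
  assumes t: "t \<in> {0..squig_pi (ereal r) / 2}"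
  shows "S t \<in> {0..1}" "C t = quarter_circle r (S t)"
proof -
  note n = squig_system_nonneg[OF t] and p = squig_system_pythagoras[OF t]
  show "C t = quarter_circle r (S t)" by (rule quarter_circle_unique[OF r n(2,1) p])
  have "S t powr r \<le> 1" using p by (smt (verit) powr_ge_zero)
  then show "S t \<in> {0..1}" using n powr_le_one_iff[OF r, of "S t"] by simp
qed

text \<open>Along any solution the composition has derivative q^(1-r) C^(r-1), which is 1 because C
  = q(S). Since it starts at 0, it equals t.\<close>

lemma squig_arcsin_sin:
  assumes t: "t \<in> {0..squig_pi (ereal r) / 2}"
  shows "squig_arcsin r (S t) = t"
proof -
  let ?b = "squig_pi (ereal r) / 2"
  have "squig_arcsin r (S t) - t = squig_arcsin r (S 0) - 0"
  proof (rule DERIV_isconst2[of 0 ?b])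
    have "continuous_on {0..?b} (squig_arcsin r \<circ> S)"
      using sys squig_system_cos(1)
      by (intro continuous_on_compose continuous_on_subset[OF continuous_on_squig_arcsin])
         (auto simp: squig_system_def Let_def)
    then show "continuous_on {0..?b} (\<lambda>t. squig_arcsin r (S t) - t)"
      by (auto intro!: continuous_intros simp: o_def)
    fix x assume x: "0 < x" "x < ?b"
    then have d: "(S has_real_derivative C x powr (r - 1)) (at x)" "0 < C x" "0 < S x"
      using sys by (auto simp: squig_system_def Let_def)
    have Cx: "C x = quarter_circle r (S x)" and S1: "S x \<le> 1" using squig_system_cos[of x] x by auto
    then have "S x < 1" using d(2) by (cases "S x = 1") auto
    then have "((\<lambda>t. squig_arcsin r (S t) - t) has_real_derivative
        quarter_circle r (S x) powr (1 - r) * C x powr (r - 1) - 1) (at x)"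
      using d by (intro DERIV_diff DERIV_ident DERIV_chain2[OF squig_arcsin_has_derivative])
    moreover have "quarter_circle r (S x) powr (1 - r) * C x powr (r - 1) = 1"
      using d(2) by (simp flip: Cx powr_add)
    ultimately show "((\<lambda>t. squig_arcsin r (S t) - t) has_real_derivative 0) (at x)" by simp
  qed (use squig_pi_pos t in auto)
  then show ?thesis using sys by (simp add: squig_system_def Let_def)
qed

end

section \<open>The chosen functions and their ranges\<close>

lemma squig_system_squig: "squig_system r (squig_cos (ereal r)) (squig_sin (ereal r))"
proof -
  have "(case squig_pair r of (C, S) \<Rightarrow> squig_system r C S)"
    unfolding squig_pair_def by (rule someI_ex) (use squig_system_exists in auto)
  moreover have "squig_cos (ereal r) = fst (squig_pair r)" "squig_sin (ereal r) = snd (squig_pair r)"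
    by (auto simp: squig_cos_def squig_sin_def)
  ultimately show ?thesis by (simp add: case_prod_beta)
qed

lemma squig_sin_in_unit: "t \<in> {0..squig_pi (ereal r) / 2} \<Longrightarrow> squig_sin (ereal r) t \<in> {0..1}"
  by (rule squig_system_cos(1)[OF squig_system_squig])

lemma squig_cos_eq:
  "t \<in> {0..squig_pi (ereal r) / 2} \<Longrightarrow> squig_cos (ereal r) t = quarter_circle r (squig_sin (ereal r) t)"
  by (rule squig_system_cos(2)[OF squig_system_squig])

lemma squig_sin_arcsin:
  assumes "s \<in> {0..1}"
  shows "squig_sin (ereal r) (squig_arcsin r s) = s"
proof -
  have "squig_arcsin r s \<in> {0..squig_pi (ereal r) / 2}" using squig_arcsin_image assms by blast
  then show ?thesis
    using squig_arcsin_sin[OF squig_system_squig] squig_arcsin_inj assms squig_sin_in_unit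
    by (metis inj_onD)
qed

lemma squig_sin_end: "squig_sin (ereal r) (squig_pi (ereal r) / 2) = 1"
  using squig_sin_arcsin[of 1] by (simp add: squig_arcsin_1)

text \<open>The sine inverts a strictly increasing function. This is what allows s to replace t as
  the parameter of the cap.\<close>

lemma squig_sin_image:
  assumes t: "t \<in> {0..squig_pi (ereal r) / 2}"
  shows "squig_sin (ereal r) ` {0..t} = {0..squig_sin (ereal r) t}"
proof
  note inv = squig_arcsin_sin[OF squig_system_squig]
  show "squig_sin (ereal r) ` {0..t} \<subseteq> {0..squig_sin (ereal r) t}"
  proof safe
    fix x assume x: "x \<in> {0..t}"
    then have x': "x \<in> {0..squig_pi (ereal r) / 2}" using t by auto
    have "squig_sin (ereal r) x \<le> squig_sin (ereal r) t"
    proof (rule ccontr)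
      assume "\<not> ?thesis"
      then have "squig_arcsin r (squig_sin (ereal r) t) < squig_arcsin r (squig_sin (ereal r) x)"
        using squig_sin_in_unit[OF t] squig_sin_in_unit[OF x'] by (intro squig_arcsin_strict_mono) auto
      then show False using x by (simp add: inv[OF t] inv[OF x'])
    qed
    then show "squig_sin (ereal r) x \<in> {0..squig_sin (ereal r) t}" using squig_sin_in_unit[OF x'] by simp
  qed
  show "{0..squig_sin (ereal r) t} \<subseteq> squig_sin (ereal r) ` {0..t}"
  proof
    fix s assume s: "s \<in> {0..squig_sin (ereal r) t}"
    then have s1: "s \<in> {0..1}" using squig_sin_in_unit[OF t] by auto
    have "squig_arcsin r s \<le> t"
      using squig_arcsin_mono[of s "squig_sin (ereal r) t"] s squig_sin_in_unit[OF t] inv[OF t] by auto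
    moreover have "0 \<le> squig_arcsin r s" using squig_arcsin_mono[of 0 s] s1 by simp
    ultimately show "s \<in> squig_sin (ereal r) ` {0..t}"
      using squig_sin_arcsin[OF s1] by (metis atLeastAtMost_iff image_eqI)
  qed
qed

end

subsection \<open>Caps as graphs\<close>

definition orthant_ball :: "ereal \<Rightarrow> real \<Rightarrow> 'a::euclidean_space set" where
  "orthant_ball p s = {z. (\<forall>b\<in>Basis. 0 \<le> z \<bullet> b) \<and> pnorm p z \<le> s}"

definition graph_map :: "real \<Rightarrow> 'a::euclidean_space \<Rightarrow> 'a \<times> real" where
  "graph_map r z = (z, quarter_circle r (pnorm (ereal r) z))"

lemma Setcompr_pair_eq_image: "{(f x y) | x y. x \<in> A \<and> y \<in> B} = (\<lambda>(x, y). f x y) ` (A \<times> B)"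
  by (auto simp: image_iff; blast)

lemma unsigned_sphere_nonempty:
  assumes "0 < p"
  shows "unsigned_sphere p \<noteq> ({} :: 'a::euclidean_space set)"
proof -
  have "(One::'a) \<noteq> 0" by (metis One_non_0)
  then have "0 < pnorm p (One::'a)" using pnorm_eq_0_iff[OF assms] pnorm_nonneg by (metis less_eq_real_def)
  then have "(1 / pnorm p (One::'a)) *\<^sub>R (One::'a) \<in> unsigned_sphere p"
    by (auto simp: unsigned_sphere_def pnorm_scaleR assms)
  then show ?thesis by blast
qed

lemma orthant_ball_polar:
  assumes p: "0 < p" and z: "z \<in> orthant_ball p u"
  obtains x where "x \<in> unsigned_sphere p" "z = pnorm p z *\<^sub>R x"
proof (cases "pnorm p z = 0")
  case True
  obtain x :: 'a where "x \<in> unsigned_sphere p" using unsigned_sphere_nonempty[OF p] by blast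
  then show thesis by (rule that) (use True p in \<open>simp add: pnorm_eq_0_iff\<close>)
next
  case False
  then have s: "0 < pnorm p z" using pnorm_nonneg[of p z] by simp
  show thesis
  proof (rule that[of "(1 / pnorm p z) *\<^sub>R z"])
    show "(1 / pnorm p z) *\<^sub>R z \<in> unsigned_sphere p"
      using z s p by (simp add: unsigned_sphere_def orthant_ball_def pnorm_scaleR)
    show "z = pnorm p z *\<^sub>R ((1 / pnorm p z) *\<^sub>R z)" using s by simp
  qed
qed

lemma cap_eq_graph:
  assumes r: "0 < r" and t: "t \<in> {0..squig_pi (ereal r) / 2}"
  shows "cap (ereal r) t = graph_map r ` orthant_ball (ereal r) (squig_sin (ereal r) t)"
proof -
  let ?p = "ereal r"
  have p: "0 < ?p" using r by simp
  have cos: "squig_cos ?p u = quarter_circle r (squig_sin ?p u)" "0 \<le> squig_sin ?p u" if "u \<in> {0..t}" for u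
    using that t squig_sin_in_unit[OF r, of u] by (auto intro!: squig_cos_eq r)
  let ?U = "unsigned_sphere ?p :: 'a set"
  have "cap ?p t = (\<lambda>(u, x). (squig_sin ?p u *\<^sub>R x, squig_cos ?p u)) ` ({0..t} \<times> ?U)"
    unfolding cap_def Setcompr_pair_eq_image ..
  also have "\<dots> = (\<lambda>(u, x). (squig_sin ?p u *\<^sub>R x, quarter_circle r (squig_sin ?p u))) ` ({0..t} \<times> ?U)"
    by (rule image_cong) (auto simp: cos(1))
  also have "\<dots> = {(s *\<^sub>R x, quarter_circle r s) | s x. s \<in> squig_sin ?p ` {0..t} \<and> x \<in> ?U}"
    unfolding Setcompr_pair_eq_image by (auto simp: image_iff)
  also have "\<dots> = graph_map r ` orthant_ball ?p (squig_sin ?p t)" (is "?L = ?R")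
    unfolding squig_sin_image[OF r t]
  proof (intro equalityI subsetI)
    fix w assume "w \<in> {(s *\<^sub>R x, quarter_circle r s) | s x. s \<in> {0..squig_sin ?p t} \<and> x \<in> (unsigned_sphere ?p :: 'a set)}"
    then obtain s x where w: "w = (s *\<^sub>R x, quarter_circle r s)" "s \<in> {0..squig_sin ?p t}" "x \<in> unsigned_sphere ?p"
      by blast
    then have sx: "pnorm ?p (s *\<^sub>R x) = s" by (simp add: pnorm_scaleR r unsigned_sphere_def)
    have "s *\<^sub>R x \<in> orthant_ball ?p (squig_sin ?p t)"
      unfolding orthant_ball_def mem_Collect_eq sx using w by (simp add: unsigned_sphere_def)
    moreover have "w = graph_map r (s *\<^sub>R x)" using w by (simp add: graph_map_def sx)
    ultimately show "w \<in> ?R" by blast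
  next
    fix w assume "w \<in> ?R"
    then obtain z where z: "w = graph_map r z" "z \<in> orthant_ball ?p (squig_sin ?p t)" by blast
    define s where "s = pnorm ?p z"
    obtain x where x: "x \<in> unsigned_sphere ?p" "z = s *\<^sub>R x"
      unfolding s_def by (rule orthant_ball_polar[OF p z(2)])
    show "w \<in> {(s *\<^sub>R x, quarter_circle r s) | s x. s \<in> {0..squig_sin ?p t} \<and> x \<in> (unsigned_sphere ?p :: 'a set)}"
    proof (intro CollectI exI conjI)
      show "w = (s *\<^sub>R x, quarter_circle r s)" unfolding z(1) graph_map_def s_def[symmetric] using x(2) by metis
      show "s \<in> {0..squig_sin ?p t}"
        using z(2) pnorm_nonneg[of ?p z] by (simp add: orthant_ball_def s_def)
    qed (rule x)
  qed
  finally show ?thesis .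
qed

subsection \<open>Volumes of cones over graphs\<close>

lemma powr_diff_mvt:
  fixes a u v :: real
  assumes "0 < a" "0 \<le> u" "u < v"
  obtains z where "u < z" "z < v" "v powr a - u powr a = (v - u) * (a * z powr (a - 1))"
proof -
  have "\<exists>l z. u < z \<and> z < v \<and> ((\<lambda>x. x powr a) has_real_derivative l) (at z) \<and>
      v powr a - u powr a = (v - u) * l"
  proof (rule MVT[OF assms(3)])
    show "continuous_on {u..v} (\<lambda>x. x powr a)"
      using assms by (intro continuous_on_powr' continuous_intros ballI) auto
    fix x assume x: "u < x" "x < v"
    then have "((\<lambda>x. x powr a) has_real_derivative a * x powr (a - 1)) (at x)"
      using assms by (intro has_real_derivative_powr) auto
    then show "(\<lambda>x. x powr a) differentiable at x" by (auto simp: real_differentiable_def)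
  qed
  then obtain l z where z: "u < z" "z < v" "((\<lambda>x. x powr a) has_real_derivative l) (at z)"
      "v powr a - u powr a = (v - u) * l" by blast
  have "((\<lambda>x. x powr a) has_real_derivative a * z powr (a - 1)) (at z)"
    using assms z(1) by (intro has_real_derivative_powr) auto
  then have "l = a * z powr (a - 1)" using DERIV_unique z(3) by blast
  then show thesis using that[OF z(1,2)] z(4) by simp
qed

lemma powr_diff_le:
  fixes r u v s :: real
  assumes "1 \<le> r" "0 \<le> u" "u \<le> v" "v \<le> s"
  shows "v powr r - u powr r \<le> r * s powr (r - 1) * (v - u)"
proof (cases "u = v")
  case False
  then have "u < v" using assms by simp
  then obtain z where z: "u < z" "z < v" "v powr r - u powr r = (v - u) * (r * z powr (r - 1))"
    using powr_diff_mvt[of r u v] assms by auto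
  have "z powr (r - 1) \<le> s powr (r - 1)" using z assms by (intro powr_mono2) auto
  then have "(v - u) * (r * z powr (r - 1)) \<le> (v - u) * (r * s powr (r - 1))"
    using assms by (intro mult_left_mono) auto
  then show ?thesis using z by (simp add: mult.commute mult.left_commute)
qed simp

section \<open>Estimates of the profile near the pole\<close>

lemma quarter_circle_le_one: "0 < r \<Longrightarrow> 0 \<le> u \<Longrightarrow> u \<le> 1 \<Longrightarrow> quarter_circle r u \<le> 1"
  using quarter_circle_antimono[of r 0 u] by simp

lemma quarter_circle_borel_measurable [measurable]: "quarter_circle r \<in> borel_measurable borel"
  unfolding quarter_circle_def[abs_def] by measurable

text \<open>A number q in [0,1] satisfies q^r \<le> q when r \<ge> 1, and q^r = 1 - s^r on the
  curve.\<close>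

lemma one_minus_quarter_circle_le:
  assumes "1 \<le> r" "0 \<le> s" "s \<le> 1"
  shows "1 - quarter_circle r s \<le> s powr r"
proof -
  let ?q = "quarter_circle r s"
  have "?q powr r \<le> ?q powr 1"
    using assms quarter_circle_le_one[of r s] by (intro powr_mono') auto
  then show ?thesis using quarter_circle_powr[of r s] assms by simp
qed

lemma one_minus_quarter_circle_ge:
  assumes "1 \<le> r" "0 \<le> s" "s \<le> 1"
  shows "s powr r / r \<le> 1 - quarter_circle r s"
  using powr_diff_le[of r "quarter_circle r s" 1 1] quarter_circle_le_one[of r s] assms quarter_circle_powr[of r s]
  by (simp add: field_simps)

text \<open>As a function of u^r the profile is concave. In terms of the weight l = \<rho>^r,
  convexity of the r-th power bounds ((1 - l) + l q)^r by (1 - l) + l q^r = 1 - (s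
  \<rho>)^r.\<close>

lemma quarter_circle_concave:
  assumes "1 \<le> r" "0 \<le> \<rho>" "\<rho> \<le> 1" "0 \<le> s" "s < 1"
  shows "(1 - \<rho> powr r) + \<rho> powr r * quarter_circle r s \<le> quarter_circle r (s * \<rho>)"
proof -
  let ?q = "quarter_circle r s" and ?l = "\<rho> powr r"
  have q: "0 < ?q" using quarter_circle_pos[of r s] assms by simp
  have l: "0 \<le> ?l" "?l \<le> 1" using assms by (auto simp: powr_le_one_iff)
  have "((1 - ?l) *\<^sub>R 1 + ?l *\<^sub>R ?q) powr r \<le> (1 - ?l) * 1 powr r + ?l * ?q powr r"
    using convex_onD[OF powr_convex[OF assms(1)] l, of 1 ?q] q by simp
  also have "\<dots> = 1 - (s * \<rho>) powr r"
    using assms by (simp add: quarter_circle_powr powr_mult algebra_simps)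
  finally have "(s * \<rho>) powr r + ((1 - ?l) + ?l * ?q) powr r \<le> 1" by simp
  then show ?thesis
    using assms l q by (subst quarter_circle_le_iff) (auto intro: mult_le_one)
qed

section \<open>Measure and integration on balls in the orthant\<close>

lemma closed_orthant_ball:
  assumes p: "0 < p"
  shows "closed (orthant_ball p s :: 'a::euclidean_space set)"
proof -
  have "(orthant_ball p s :: 'a set) = (\<Inter>b\<in>Basis. {z. 0 \<le> z \<bullet> b}) \<inter> {z. pnorm p z \<le> s}"
    by (auto simp: orthant_ball_def)
  moreover have "closed \<dots>"
    by (intro closed_Int closed_INT ballI closed_Collect_le continuous_intros p)
  ultimately show ?thesis by simp
qed

lemma bounded_orthant_ball:
  assumes p: "0 < p"
  shows "bounded (orthant_ball p s :: 'a::euclidean_space set)"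
proof -
  have "norm z \<le> DIM('a) * s" if "z \<in> (orthant_ball p s :: 'a set)" for z
    using norm_le_pnorm[OF p, of z] that
    by (auto simp: orthant_ball_def intro: order_trans mult_left_mono)
  then show ?thesis unfolding bounded_iff by blast
qed

lemma orthant_ball_scale:
  assumes p: "0 < p" and s: "0 < s"
  shows "s *\<^sub>R z \<in> orthant_ball p (s * u) \<longleftrightarrow> z \<in> orthant_ball p u"
  using s by (auto simp: orthant_ball_def pnorm_scaleR p zero_le_mult_iff)

lemma orthant_ball_borel [measurable]: "0 < p \<Longrightarrow> orthant_ball p s \<in> sets borel"
  by (simp add: closed_orthant_ball)

lemma emeasure_orthant_ball_finite: "0 < p \<Longrightarrow> emeasure lborel (orthant_ball p s) < \<infinity>"
  by (intro emeasure_bounded_finite bounded_orthant_ball)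

lemma nn_integral_lborel_scale:
  fixes f :: "'a::euclidean_space \<Rightarrow> ennreal"
  assumes [measurable]: "f \<in> borel_measurable borel" and s: "0 < s"
  shows "(\<integral>\<^sup>+z. f z \<partial>lborel) = ennreal (s ^ DIM('a)) * (\<integral>\<^sup>+z. f (s *\<^sub>R z) \<partial>lborel)"
proof -
  have "(\<integral>\<^sup>+z. f z \<partial>lborel) =
      (\<integral>\<^sup>+z. f z \<partial>density (distr lborel borel (\<lambda>x. 0 + s *\<^sub>R x)) (\<lambda>_. ennreal (\<bar>s\<bar> ^ DIM('a))))"
    using s by (subst lborel_affine[of s 0]) auto
  also have "\<dots> = ennreal (s ^ DIM('a)) * (\<integral>\<^sup>+z. f (s *\<^sub>R z) \<partial>lborel)"
    using s by (simp add: nn_integral_density nn_integral_distr nn_integral_cmult)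
  finally show ?thesis .
qed

lemma emeasure_orthant_ball:
  assumes p: "0 < p" and s: "0 < s"
  shows "emeasure lborel (orthant_ball p s :: 'a::euclidean_space set) =
    ennreal (s ^ DIM('a)) * emeasure lborel (orthant_ball p 1 :: 'a set)"
proof -
  have B[measurable]: "orthant_ball p u \<in> sets (borel :: 'a measure)" for u by (rule orthant_ball_borel[OF p])
  have "emeasure lborel (orthant_ball p s :: 'a set) = (\<integral>\<^sup>+z. indicator (orthant_ball p s) (z::'a) \<partial>lborel)"
    by simp
  also have "\<dots> = ennreal (s ^ DIM('a)) * (\<integral>\<^sup>+z. indicator (orthant_ball p s) (s *\<^sub>R (z::'a)) \<partial>lborel)"
    by (rule nn_integral_lborel_scale[OF _ s]) measurable
  also have "(\<lambda>z. indicator (orthant_ball p s) (s *\<^sub>R (z::'a)) :: ennreal) = indicator (orthant_ball p 1)"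
    using orthant_ball_scale[OF p s, of _ 1] by (auto simp: indicator_def fun_eq_iff)
  finally show ?thesis by simp
qed

lemma integrable_on_orthant_ball:
  fixes h :: "'a::euclidean_space \<Rightarrow> real"
  assumes p: "0 < p" and [measurable]: "h \<in> borel_measurable borel"
    and "\<And>z. z \<in> orthant_ball p s \<Longrightarrow> \<bar>h z\<bar> \<le> C"
  shows "integrable lborel (\<lambda>z. indicator (orthant_ball p s) z * h z)"
proof (rule integrableI_bounded_set[where A = "orthant_ball p s" and B = C])
  have [measurable]: "orthant_ball p s \<in> sets (borel :: 'a measure)" by (rule orthant_ball_borel[OF p])
  show "(\<lambda>z. indicator (orthant_ball p s) z * h z) \<in> borel_measurable lborel" by measurable
qed (use assms emeasure_orthant_ball_finite[OF p] orthant_ball_borel[OF p] in auto)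

text \<open>A vanishing integral of a nonnegative function would force it to vanish almost
  everywhere, but it is positive on a small open box at the origin inside the ball.\<close>

lemma integral_orthant_ball_pos:
  fixes h :: "'a::euclidean_space \<Rightarrow> real"
  assumes p: "0 < p" and h[measurable]: "h \<in> borel_measurable borel"
    and bnd: "\<And>z. z \<in> orthant_ball p 1 \<Longrightarrow> 0 \<le> h z \<and> h z \<le> C"
    and pos: "\<And>z. z \<in> orthant_ball p 1 \<Longrightarrow> 0 < pnorm p z \<Longrightarrow> pnorm p z < 1 \<Longrightarrow> 0 < h z"
  shows "0 < (\<integral>z. indicator (orthant_ball p 1) z * h z \<partial>lborel)"
proof -
  let ?B = "orthant_ball p 1 :: 'a set" and ?f = "\<lambda>z. indicator (orthant_ball p 1) z * h z"
  have int: "integrable lborel ?f"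
    using bnd by (intro integrable_on_orthant_ball[OF p h, where C = C]) auto
  have nn: "0 \<le> ?f z" for z using bnd[of z] by (auto simp: indicator_def)
  obtain K where K: "0 < K"
    "\<And>(x::'a) c. (\<And>b. b \<in> Basis \<Longrightarrow> \<bar>x \<bullet> b\<bar> \<le> c) \<Longrightarrow> pnorm p x \<le> K * c"
    using pnorm_le_const[OF p] by metis
  \<comment> \<open>With this side length the p-norm is at most 1/2 on the box.\<close>
  let ?e = "1 / (2 * K)"
  have box: "?f z \<noteq> 0" if z: "z \<in> box 0 (?e *\<^sub>R One)" for z
  proof -
    have zb: "0 < z \<bullet> b" "z \<bullet> b < ?e" if "b \<in> Basis" for b
      using z that by (auto simp: mem_box)
    then have "pnorm p z \<le> K * ?e" by (intro K(2)) (auto simp: less_imp_le)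
    then have lt: "pnorm p z < 1" using K by simp
    obtain b :: 'a where b: "b \<in> Basis" by (meson nonempty_Basis ex_in_conv)
    have "z \<noteq> 0" using zb(1)[OF b] by auto
    then have gt: "0 < pnorm p z" using pnorm_eq_0_iff[OF p] pnorm_nonneg by (metis less_eq_real_def)
    have "z \<in> ?B" using zb lt by (auto simp: orthant_ball_def less_imp_le)
    then show ?thesis using pos[OF _ gt lt] by auto
  qed
  have "integral\<^sup>L lborel ?f \<noteq> 0"
  proof
    assume "integral\<^sup>L lborel ?f = 0"
    then have "AE z in lborel. ?f z = 0"
      using integral_nonneg_eq_0_iff_AE[OF int] nn by auto
    then have "AE z in lborel. z \<notin> box 0 (?e *\<^sub>R (One::'a))"
      by (rule AE_mp) (use box in auto)
    then have "emeasure lborel (box 0 (?e *\<^sub>R (One::'a))) = 0"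
      by (subst (asm) AE_iff_measurable[OF _ refl]) auto
    then show False using K by (simp add: emeasure_lborel_box_eq)
  qed
  moreover have "0 \<le> integral\<^sup>L lborel ?f" using nn by (intro integral_nonneg_AE) auto
  ultimately show ?thesis by linarith
qed

text \<open>The cone is bounded above by the graph and below by the rays through its rim, where the
  height is q(s) at radius s. Only monotonicity of the profile enters, so the description also
  covers r < 1, where the ball is not convex.\<close>

lemma cone_graph:
  assumes r: "0 < r" and s: "0 < s" "s \<le> 1"
  shows "{\<sigma> *\<^sub>R w | \<sigma> w. \<sigma> \<in> {0..1} \<and> w \<in> graph_map r ` orthant_ball (ereal r) s} =
    {(z, y). z \<in> orthant_ball (ereal r) s \<and> quarter_circle r s * pnorm (ereal r) z / s \<le> y \<and>
       y \<le> quarter_circle r (pnorm (ereal r) z)}" (is "?L = ?R")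
proof (intro equalityI subsetI)
  let ?q = "quarter_circle r" and ?N = "pnorm (ereal r)"
  have N0: "0 \<le> ?N z" for z :: 'a by (rule pnorm_nonneg)
  {
    fix w assume "w \<in> ?L"
    then obtain \<sigma> z where w: "w = \<sigma> *\<^sub>R graph_map r z" "0 \<le> \<sigma>" "\<sigma> \<le> 1" "z \<in> orthant_ball (ereal r) s" by (auto simp del: scaleR_Pair)
    have z: "?N z \<le> s" "\<forall>b\<in>Basis. 0 \<le> z \<bullet> b" using w by (auto simp: orthant_ball_def)
    have N\<sigma>: "?N (\<sigma> *\<^sub>R z) = \<sigma> * ?N z" using w r by (simp add: pnorm_scaleR)
    have le: "\<sigma> * ?N z \<le> ?N z" using w N0[of z] by (intro mult_left_le_one_le) auto
    have in_B: "\<sigma> *\<^sub>R z \<in> orthant_ball (ereal r) s"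
      using z w le by (auto simp: orthant_ball_def N\<sigma>)
    have "?q s * ?N z \<le> s * ?q (?N z)"
      unfolding mult.commute[of s]
      using quarter_circle_antimono[OF r N0 z(1) s(2)] z N0 by (intro mult_mono) auto
    then have "\<sigma> * (?q s * ?N z / s) \<le> \<sigma> * ?q (?N z)"
      using s w by (intro mult_left_mono) (auto simp: field_simps)
    then have lower: "?q s * ?N (\<sigma> *\<^sub>R z) / s \<le> \<sigma> * ?q (?N z)" by (simp add: N\<sigma> mult_ac)
    have "(\<sigma> * ?N z) powr r + (\<sigma> * ?q (?N z)) powr r = \<sigma> powr r"
      using w N0[of z] z s r by (simp add: powr_mult quarter_circle_powr flip: distrib_left)
    also have "\<dots> \<le> 1" using w r by (simp add: powr_le_one_iff)
    finally have upper: "\<sigma> * ?q (?N z) \<le> ?q (?N (\<sigma> *\<^sub>R z))"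
      unfolding N\<sigma> using w N0[of z] z le s r by (subst quarter_circle_le_iff) auto
    show "w \<in> ?R" using in_B lower upper by (simp add: w graph_map_def)
  next
    fix w assume "w \<in> ?R"
    then obtain z y where w: "w = (z, y)" "z \<in> orthant_ball (ereal r) s" "?q s * ?N z / s \<le> y" "y \<le> ?q (?N z)"
      by auto
    have z: "?N z \<le> s" "\<forall>b\<in>Basis. 0 \<le> z \<bullet> b" using w by (auto simp: orthant_ball_def)
    have y0: "0 \<le> y" using w(3) s N0[of z] by (smt (verit) divide_nonneg_pos mult_nonneg_nonneg quarter_circle_nonneg)
    \<comment> \<open>Points of the graph have p-norm 1, so the scaling factor of a point of the
      cone is its own p-norm.\<close>
    define \<sigma> where "\<sigma> = ?N (z, y)"
    have \<sigma>0: "0 \<le> \<sigma>" by (simp add: \<sigma>_def pnorm_nonneg)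
    have \<sigma>r: "\<sigma> powr r = ?N z powr r + y powr r" using r y0 by (simp add: \<sigma>_def pnorm_Pair_powr)
    also have "\<dots> \<le> 1" using w(4) z s N0[of z] y0 r by (subst (asm) quarter_circle_le_iff) auto
    finally have \<sigma>1: "\<sigma> \<le> 1" using r \<sigma>0 by (simp add: powr_le_one_iff)
    show "w \<in> ?L"
    proof (cases "\<sigma> = 0")
      case True
      then have "(z, y) = 0" using r by (simp add: \<sigma>_def pnorm_eq_0_iff)
      then have "z = 0" "y = 0" by (simp_all add: zero_prod_def)
      then have "w = 0 *\<^sub>R graph_map r z" using w(1) by (simp add: zero_prod_def)
      then show ?thesis
        using w(2) by (intro CollectI exI[of _ "0::real"] exI[of _ "graph_map r z"] conjI imageI) auto
    next
      case False
      then have \<sigma>: "0 < \<sigma>" using \<sigma>0 by simp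
      let ?z = "(1 / \<sigma>) *\<^sub>R z" and ?y = "y / \<sigma>"
      have Nz: "?N ?z = ?N z / \<sigma>" using \<sigma> r by (simp add: pnorm_scaleR)
      have "?N ?z powr r + ?y powr r = (?N z powr r + y powr r) / \<sigma> powr r"
        using \<sigma> y0 N0[of z] by (simp add: Nz powr_divide add_divide_distrib)
      also have "\<dots> = 1" unfolding \<sigma>r[symmetric] using \<sigma> by simp
      finally have "?N ?z powr r + ?y powr r = 1" .
      then have yq: "?y = ?q (?N ?z)"
        using N0 y0 \<sigma> r by (intro quarter_circle_unique) auto
      have N1: "?N ?z \<le> 1"
        using \<open>?N ?z powr r + ?y powr r = 1\<close> r N0[of ?z] powr_le_one_iff[of r "?N ?z"] by (smt (verit) powr_ge_zero)
      have "?N ?z \<le> s"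
      \<comment> \<open>If the radial projection left the ball of radius s, its height would be at
        most q(s), whereas the lower boundary, being linear in the radius, would force it above
        q(s).\<close>
      proof (rule ccontr)
        assume c: "\<not> ?N ?z \<le> s"
        then have "?q (?N ?z) \<le> ?q s" using s N1 r by (intro quarter_circle_antimono) auto
        moreover have "?q s * ?N ?z / s \<le> ?q (?N ?z)"
        proof -
          have "?q s * ?N ?z / s = (?q s * ?N z / s) / \<sigma>" by (simp add: Nz)
          also have "\<dots> \<le> ?y" using w(3) \<sigma> by (intro divide_right_mono) auto
          finally show ?thesis by (simp add: yq)
        qed
        moreover have "0 < ?q s" using c N1 s r by (intro quarter_circle_pos) auto
        moreover have "?q s < ?q s * ?N ?z / s" using c s \<open>0 < ?q s\<close> by (simp add: field_simps)
        ultimately show False by linarith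
      qed
      then have "?z \<in> orthant_ball (ereal r) s" using z \<sigma> by (simp add: orthant_ball_def)
      moreover have "w = \<sigma> *\<^sub>R graph_map r ?z"
        using \<sigma> by (simp add: w graph_map_def flip: yq)
      ultimately show ?thesis
        using \<sigma>1 \<sigma>0 by (intro CollectI exI[of _ \<sigma>] exI[of _ "graph_map r ?z"] conjI imageI) auto
    qed
  }
qed

text \<open>The cone volume divided by the k-th power of s, where k is the dimension of the base.
  Substituting s z for z makes the domain of integration independent of s.\<close>

definition cone_density :: "'a::euclidean_space itself \<Rightarrow> real \<Rightarrow> real \<Rightarrow> real" where
  "cone_density _ r s = (\<integral>z. indicator (orthant_ball (ereal r) 1) z *
      (quarter_circle r (s * pnorm (ereal r) z) - quarter_circle r s * pnorm (ereal r) (z::'a)) \<partial>lborel)"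

lemma cone_integrand_bounds:
  assumes r: "0 < r" and s: "0 < s" "s \<le> 1" and z: "z \<in> orthant_ball (ereal r) 1"
  shows "0 \<le> quarter_circle r (s * pnorm (ereal r) z) - quarter_circle r s * pnorm (ereal r) z"
    "quarter_circle r (s * pnorm (ereal r) z) - quarter_circle r s * pnorm (ereal r) z \<le> 1"
proof -
  let ?n = "pnorm (ereal r) z"
  have n: "0 \<le> ?n" "?n \<le> 1" using z by (auto simp: orthant_ball_def pnorm_nonneg)
  have sn: "s * ?n \<le> s" "0 \<le> s * ?n" using n s by (auto simp: mult_left_le)
  have "quarter_circle r s * ?n \<le> quarter_circle r s" using n by (simp add: mult_left_le)
  also have "\<dots> \<le> quarter_circle r (s * ?n)" using sn s r by (intro quarter_circle_antimono) auto
  finally show "0 \<le> quarter_circle r (s * ?n) - quarter_circle r s * ?n" by simp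
  have "quarter_circle r (s * ?n) \<le> 1" using sn s r by (intro quarter_circle_le_one) linarith+
  moreover have "0 \<le> quarter_circle r s * ?n" using n by simp
  ultimately show "quarter_circle r (s * ?n) - quarter_circle r s * ?n \<le> 1" by linarith
qed

lemma measure_cone_graph:
  assumes r: "0 < r" and s: "0 < s" "s \<le> 1"
  shows "measure lebesgue {\<sigma> *\<^sub>R w | \<sigma> w. \<sigma> \<in> {0..1} \<and>
      w \<in> graph_map r ` (orthant_ball (ereal r) s :: 'a::euclidean_space set)} =
    s ^ DIM('a) * cone_density TYPE('a) r s"
proof -
  let ?q = "quarter_circle r" and ?N = "pnorm (ereal r) :: 'a \<Rightarrow> real"
  let ?B = "\<lambda>u. orthant_ball (ereal r) u :: 'a set"
  have p: "0 < ereal r" using r by simp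
  have [measurable]: "?N \<in> borel_measurable borel" by (rule borel_measurable_pnorm[OF p])
  have [measurable]: "?B u \<in> sets borel" for u by (rule orthant_ball_borel[OF p])
  let ?W = "{(z::'a, y). z \<in> ?B s \<and> ?q s * ?N z / s \<le> y \<and> y \<le> ?q (?N z)}"
  have W: "?W \<in> sets (borel \<Otimes>\<^sub>M borel)"
  proof -
    have "?W = {w \<in> space (borel \<Otimes>\<^sub>M borel). fst w \<in> ?B s \<and> ?q s * ?N (fst w) / s \<le> snd w \<and> snd w \<le> ?q (?N (fst w))}"
      by (auto simp: space_pair_measure)
    also have "\<dots> \<in> sets (borel \<Otimes>\<^sub>M borel)" by measurable
    finally show ?thesis .
  qed
  then have Wb: "?W \<in> sets borel" unfolding borel_prod .
  let ?g = "\<lambda>z. ennreal (?q (?N z) - ?q s * ?N z / s) * indicator (?B s) z"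
  have "emeasure lborel ?W = emeasure (lborel \<Otimes>\<^sub>M lborel) ?W" by (simp add: lborel_prod)
  also have "\<dots> = (\<integral>\<^sup>+z. emeasure lborel (Pair z -` ?W) \<partial>lborel)"
    by (rule lborel.emeasure_pair_measure_alt) (simp only: lborel_prod sets_lborel Wb)
  also have "\<dots> = (\<integral>\<^sup>+z. ?g z \<partial>lborel)"
  proof (intro nn_integral_cong)
    fix z :: 'a
    have "Pair z -` ?W = (if z \<in> ?B s then {?q s * ?N z / s..?q (?N z)} else {})" by auto
    then show "emeasure lborel (Pair z -` ?W) = ?g z"
      by (cases "?q s * ?N z / s \<le> ?q (?N z)") (auto simp: indicator_def ennreal_neg)
  qed
  also have "\<dots> = ennreal (s ^ DIM('a)) * (\<integral>\<^sup>+z. ?g (s *\<^sub>R z) \<partial>lborel)"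
    by (rule nn_integral_lborel_scale[OF _ s(1)]) measurable
  also have "(\<lambda>z. ?g (s *\<^sub>R z)) = (\<lambda>z. ennreal (indicator (?B 1) z * (?q (s * ?N z) - ?q s * ?N z)))"
    using s r orthant_ball_scale[OF p s(1), of _ 1]
    by (auto simp: fun_eq_iff indicator_def pnorm_scaleR)
  also have "(\<integral>\<^sup>+z. ennreal (indicator (?B 1) z * (?q (s * ?N z) - ?q s * ?N z)) \<partial>lborel) =
      ennreal (cone_density TYPE('a) r s)"
    unfolding cone_density_def
  proof (rule nn_integral_eq_integral)
    show "integrable lborel (\<lambda>z. indicator (?B 1) z * (?q (s * ?N z) - ?q s * ?N z))"
      using cone_integrand_bounds[OF r s]
      by (intro integrable_on_orthant_ball[OF p, where C = 1]) (auto simp: abs_le_iff intro: order_trans[of _ 0 1])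
    show "AE z in lborel. 0 \<le> indicator (?B 1) z * (?q (s * ?N z) - ?q s * ?N z)"
      using cone_integrand_bounds(1)[OF r s] by (auto simp: indicator_def)
  qed
  finally have em: "emeasure lborel ?W = ennreal (s ^ DIM('a)) * ennreal (cone_density TYPE('a) r s)" .
  have "0 \<le> cone_density TYPE('a) r s"
    unfolding cone_density_def
    using cone_integrand_bounds(1)[OF r s] by (intro integral_nonneg_AE) (auto simp: indicator_def)
  then have "measure lborel ?W = s ^ DIM('a) * cone_density TYPE('a) r s"
    using s unfolding measure_def em by (simp flip: ennreal_mult)
  then show ?thesis
    unfolding cone_graph[OF r s] using Wb by (subst measure_completion) simp_all
qed

text \<open>For r = 1 the integrand is (1 - s N) - (1 - s) N = 1 - N with N the norm of z, so s
  cancels.\<close>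

lemma cone_density_one: "0 < s \<Longrightarrow> s \<le> 1 \<Longrightarrow> cone_density TYPE('a) 1 s = cone_density TYPE('a::euclidean_space) 1 1"
  unfolding cone_density_def
proof (intro Bochner_Integration.integral_cong refl)
  fix z :: 'a assume s: "0 < s" "s \<le> 1"
  show "indicator (orthant_ball (ereal 1) 1) z *
         (quarter_circle 1 (s * pnorm (ereal 1) z) - quarter_circle 1 s * pnorm (ereal 1) z) =
        indicator (orthant_ball (ereal 1) 1) z *
         (quarter_circle 1 (1 * pnorm (ereal 1) z) - quarter_circle 1 1 * pnorm (ereal 1) z)"
  proof (cases "z \<in> orthant_ball (ereal 1) 1")
    case True
    then have n: "0 \<le> pnorm (ereal 1) z" "pnorm (ereal 1) z \<le> 1" by (auto simp: orthant_ball_def pnorm_nonneg)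
    have q: "quarter_circle 1 u = 1 - u" if "0 \<le> u" "u \<le> 1" for u using that by (simp add: quarter_circle_def)
    have "s * pnorm (ereal 1) z \<le> 1" using n s by (simp add: mult_le_one)
    then show ?thesis using n s by (simp add: q algebra_simps)
  qed simp
qed

lemma cone_density_1_pos:
  assumes "0 < r"
  shows "0 < cone_density TYPE('a::euclidean_space) r 1"
  unfolding cone_density_def
proof (rule integral_orthant_ball_pos)
  show "0 < ereal r" using assms by simp
  then have [measurable]: "pnorm (ereal r) \<in> borel_measurable (borel :: 'a measure)" by (rule borel_measurable_pnorm)
  show "(\<lambda>z::'a. quarter_circle r (1 * pnorm (ereal r) z) - quarter_circle r 1 * pnorm (ereal r) z) \<in> borel_measurable borel"
    by measurable
next
  fix z :: 'a assume z: "z \<in> orthant_ball (ereal r) 1"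
  then show "0 \<le> quarter_circle r (1 * pnorm (ereal r) z) - quarter_circle r 1 * pnorm (ereal r) z \<and>
      quarter_circle r (1 * pnorm (ereal r) z) - quarter_circle r 1 * pnorm (ereal r) z \<le> 1"
    using cone_integrand_bounds[of r 1 z] assms by simp
  assume "0 < pnorm (ereal r) z" "pnorm (ereal r) z < 1"
  then show "0 < quarter_circle r (1 * pnorm (ereal r) z) - quarter_circle r 1 * pnorm (ereal r) z"
    using quarter_circle_pos[of r "pnorm (ereal r) z"] assms by simp
qed

lemma cone_density_upper:
  assumes r: "0 < r"
  obtains C where "\<And>s. 0 < s \<Longrightarrow> s \<le> 1 \<Longrightarrow> cone_density TYPE('a::euclidean_space) r s \<le> C"
proof
  fix s :: real assume s: "0 < s" "s \<le> 1"
  have p: "0 < ereal r" using r by simp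
  have [measurable]: "pnorm (ereal r) \<in> borel_measurable (borel :: 'a measure)" by (rule borel_measurable_pnorm[OF p])
  show "cone_density TYPE('a) r s \<le> (\<integral>z. indicator (orthant_ball (ereal r) 1) z * (1::real) \<partial>(lborel :: 'a measure))"
    unfolding cone_density_def
  proof (rule integral_mono)
    show "integrable lborel (\<lambda>z::'a. indicator (orthant_ball (ereal r) 1) z *
        (quarter_circle r (s * pnorm (ereal r) z) - quarter_circle r s * pnorm (ereal r) z))"
      using cone_integrand_bounds[OF r s]
      by (intro integrable_on_orthant_ball[OF p, where C = 1]) (auto simp: abs_le_iff intro: order_trans[of _ 0 1])
    show "integrable lborel (\<lambda>z::'a. indicator (orthant_ball (ereal r) 1) z * (1::real))"
      by (intro integrable_on_orthant_ball[OF p, where C = 1]) auto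
  qed (use cone_integrand_bounds(2)[OF r s] in \<open>auto simp: indicator_def\<close>)
qed

text \<open>Second-order behaviour of the cone volume at the pole: concavity of the profile gives the
  lower bound with the exact power \<open>s powr r\<close>.\<close>

lemma cone_density_expansion:
  assumes r: "1 < r"
  obtains V0 c0 c1 where "0 < c1"
    "\<And>s. 0 < s \<Longrightarrow> s < 1 \<Longrightarrow> V0 + c1 * s powr r \<le> cone_density TYPE('a::euclidean_space) r s"
    "\<And>s. 0 < s \<Longrightarrow> s < 1 \<Longrightarrow> cone_density TYPE('a) r s \<le> V0 + c0 * s powr r"
proof -
  let ?q = "quarter_circle r" and ?N = "pnorm (ereal r) :: 'a \<Rightarrow> real"
  let ?I = "indicator (orthant_ball (ereal r) 1) :: 'a \<Rightarrow> real"
  have p: "0 < ereal r" using r by simp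
  have [measurable]: "?N \<in> borel_measurable borel" by (rule borel_measurable_pnorm[OF p])
  have N: "0 \<le> ?N z" "?N z \<le> 1" if "z \<in> orthant_ball (ereal r) 1" for z
    using that by (auto simp: orthant_ball_def pnorm_nonneg)
  have Nr: "0 \<le> ?N z powr r" "?N z powr r \<le> ?N z" if "z \<in> orthant_ball (ereal r) 1" for z
    using N[OF that] powr_mono'[of 1 r "?N z"] r by auto
  \<comment> \<open>\<open>V0\<close> is the limit of the density at s = 0. \<open>c1\<close>
    integrates N - N^r, which is positive inside the ball because r > 1, and \<open>c0\<close>
    integrates the cruder bound N.\<close>
  define V0 where "V0 = (\<integral>z. ?I z * (1 - ?N z) \<partial>lborel)"
  define c0 where "c0 = (\<integral>z. ?I z * ?N z \<partial>lborel)"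
  define c1 where "c1 = (\<integral>z. ?I z * (?N z - ?N z powr r) \<partial>lborel)"
  have int0: "integrable lborel (\<lambda>z. ?I z * (1 - ?N z))"
    using N by (intro integrable_on_orthant_ball[OF p, where C = 1]) (auto simp: abs_le_iff intro: order_trans[of _ 0 1])
  have int1: "integrable lborel (\<lambda>z. ?I z * ?N z)"
    using N by (intro integrable_on_orthant_ball[OF p, where C = 1]) auto
  have int2: "integrable lborel (\<lambda>z. ?I z * (?N z - ?N z powr r))"
  proof (rule integrable_on_orthant_ball[OF p, where C = 1])
    fix z :: 'a assume z: "z \<in> orthant_ball (ereal r) 1"
    show "\<bar>?N z - ?N z powr r\<bar> \<le> 1" using N[OF z] Nr[OF z] by linarith
  qed measurable
  have ints: "integrable lborel (\<lambda>z. ?I z * (?q (s * ?N z) - ?q s * ?N z))" if "0 < s" "s < 1" for s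
    using cone_integrand_bounds[of r s] that r
    by (intro integrable_on_orthant_ball[OF p, where C = 1]) (auto simp: abs_le_iff intro: order_trans[of _ 0 1])
  have c1: "0 < c1"
    unfolding c1_def
  proof (rule integral_orthant_ball_pos[OF p])
    fix z :: 'a assume z: "z \<in> orthant_ball (ereal r) 1"
    show "0 \<le> ?N z - ?N z powr r \<and> ?N z - ?N z powr r \<le> 1" using N[OF z] Nr[OF z] by linarith
    assume "0 < ?N z" "?N z < 1"
    then show "0 < ?N z - ?N z powr r" using powr_less_mono'[of "?N z" 1 r] r by simp
  qed measurable
  show thesis
  proof (rule that[of "c1 / r" V0 c0])
    show "0 < c1 / r" using c1 r by simp
    fix s :: real assume s: "0 < s" "s < 1"
    \<comment> \<open>Concavity with \<rho> = N gives the integrand the lower bound (1 - N) + (1 -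
      q(s)) (N - N^r). The factor 1 - q(s) is at least s^r / r.\<close>
    have "V0 + (s powr r / r) * c1 \<le> V0 + (1 - ?q s) * c1"
      using one_minus_quarter_circle_ge[of r s] s r c1 by (intro add_left_mono mult_right_mono) auto
    also have "\<dots> = (\<integral>z. ?I z * (1 - ?N z) + (1 - ?q s) * (?I z * (?N z - ?N z powr r)) \<partial>lborel)"
      unfolding V0_def c1_def using int0 int2 by simp
    also have "\<dots> \<le> cone_density TYPE('a) r s"
      unfolding cone_density_def
    proof (rule integral_mono)
      show "integrable lborel (\<lambda>z. ?I z * (1 - ?N z) + (1 - ?q s) * (?I z * (?N z - ?N z powr r)))"
        using int0 int2 by simp
      show "integrable lborel (\<lambda>z. ?I z * (?q (s * ?N z) - ?q s * ?N z))" by (rule ints[OF s])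
      fix z
      show "?I z * (1 - ?N z) + (1 - ?q s) * (?I z * (?N z - ?N z powr r)) \<le> ?I z * (?q (s * ?N z) - ?q s * ?N z)"
      proof (cases "z \<in> orthant_ball (ereal r) 1")
        case True
        then show ?thesis
          using quarter_circle_concave[of r "?N z" s] N[OF True] s r by (simp add: algebra_simps)
      qed simp
    qed
    finally show "V0 + c1 / r * s powr r \<le> cone_density TYPE('a) r s" by (simp add: mult.commute)
    \<comment> \<open>Estimating q(s N) by 1 leaves 1 - q(s) N = (1 - N) + (1 - q(s)) N.\<close>
    have "cone_density TYPE('a) r s \<le> (\<integral>z. ?I z * (1 - ?N z) + (1 - ?q s) * (?I z * ?N z) \<partial>lborel)"
      unfolding cone_density_def
    proof (rule integral_mono)
      show "integrable lborel (\<lambda>z. ?I z * (1 - ?N z) + (1 - ?q s) * (?I z * ?N z))"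
        using int0 int1 by simp
      show "integrable lborel (\<lambda>z. ?I z * (?q (s * ?N z) - ?q s * ?N z))" by (rule ints[OF s])
      fix z
      show "?I z * (?q (s * ?N z) - ?q s * ?N z) \<le> ?I z * (1 - ?N z) + (1 - ?q s) * (?I z * ?N z)"
      proof (cases "z \<in> orthant_ball (ereal r) 1")
        case True
        have "s * ?N z \<le> 1" using N[OF True] s by (simp add: mult_le_one)
        then show ?thesis
          using quarter_circle_le_one[of r "s * ?N z"] True N[OF True] s r by (simp add: algebra_simps)
      qed simp
    qed
    also have "\<dots> = V0 + (1 - ?q s) * c0"
      unfolding V0_def c0_def using int0 int1 by simp
    also have "\<dots> \<le> V0 + s powr r * c0"
    proof (intro add_left_mono mult_right_mono)
      show "0 \<le> c0" unfolding c0_def using N by (intro integral_nonneg_AE) (auto simp: indicator_def)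
      show "1 - ?q s \<le> s powr r" using one_minus_quarter_circle_le[of r s] s r by simp
    qed
    finally show "cone_density TYPE('a) r s \<le> V0 + c0 * s powr r" by (simp add: mult.commute)
  qed
qed

subsection \<open>Areas of graphs\<close>

text \<open>Projection of the product along the base direction b, with the target hyperplane
  identified with \<open>'a\<close> itself by storing the height in the vacated coordinate b. This
  makes full-dimensional Hausdorff measure on \<open>'a\<close> available for vertical
  hyperplanes.\<close>

definition replace_coord :: "'a::euclidean_space \<Rightarrow> 'a \<times> real \<Rightarrow> 'a" where
  "replace_coord b w = fst w + (snd w - fst w \<bullet> b) *\<^sub>R b"

lemma inner_replace_coord:
  "b \<in> Basis \<Longrightarrow> b' \<in> Basis \<Longrightarrow> replace_coord b w \<bullet> b' = (if b' = b then snd w else fst w \<bullet> b')"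
  by (auto simp: replace_coord_def inner_add_left inner_Basis)

lemma replace_coord_diff: "replace_coord b w - replace_coord b w' = replace_coord b (w - w')"
  by (simp add: replace_coord_def algebra_simps)

lemma pnorm_inf_le: "(\<And>b. b \<in> Basis \<Longrightarrow> \<bar>x \<bullet> b\<bar> \<le> c) \<Longrightarrow> pnorm \<infinity> x \<le> c"
  by (simp add: pnorm_def)

lemma pnorm_powr_le_iff: "0 < r \<Longrightarrow> pnorm (ereal r) x powr r \<le> pnorm (ereal r) y powr r \<longleftrightarrow>
    pnorm (ereal r) x \<le> pnorm (ereal r) y"
  using powr_mono2[of r "pnorm (ereal r) x" "pnorm (ereal r) y"]
    powr_less_mono2[of r "pnorm (ereal r) y" "pnorm (ereal r) x"]
  by (smt (verit) pnorm_nonneg)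

lemma pnorm_replace_coord_powr:
  assumes "0 < r" "b \<in> Basis"
  shows "pnorm (ereal r) w powr r = pnorm (ereal r) (replace_coord b w) powr r + \<bar>fst w \<bullet> b\<bar> powr r"
proof -
  have "(\<Sum>b'\<in>Basis. \<bar>replace_coord b w \<bullet> b'\<bar> powr r) =
      \<bar>snd w\<bar> powr r + (\<Sum>b'\<in>Basis - {b}. \<bar>fst w \<bullet> b'\<bar> powr r)"
    using assms by (subst sum.remove[of _ b]) (auto simp: inner_replace_coord intro!: sum.cong)
  moreover have "(\<Sum>b'\<in>Basis. \<bar>fst w \<bullet> b'\<bar> powr r) = \<bar>fst w \<bullet> b\<bar> powr r + (\<Sum>b'\<in>Basis - {b}. \<bar>fst w \<bullet> b'\<bar> powr r)"
    using assms by (subst sum.remove[of _ b]) auto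
  moreover have "pnorm (ereal r) w powr r = (\<Sum>b'\<in>Basis. \<bar>fst w \<bullet> b'\<bar> powr r) + \<bar>snd w\<bar> powr r"
    using pnorm_Pair_powr[OF assms(1), of "fst w" "snd w"] assms by (simp add: pnorm_powr)
  ultimately show ?thesis using assms by (simp add: pnorm_powr)
qed

lemma pnorm_replace_coord_le:
  assumes p: "0 < p" and b: "b \<in> Basis"
  shows "pnorm p (replace_coord b w) \<le> pnorm p w"
  using p
proof (cases p rule: ereal_pos_cases)
  case (real r)
  then show ?thesis
    using pnorm_replace_coord_powr[OF real(2) b, of w] by (simp flip: pnorm_powr_le_iff)
next
  case inf
  have "\<bar>replace_coord b w \<bullet> b'\<bar> \<le> pnorm \<infinity> w" if "b' \<in> Basis" for b'
    using abs_inner_le_pnorm[of \<infinity> "(b', 0)" w] abs_inner_le_pnorm[of \<infinity> "(0, 1)" w] that b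
    by (cases w) (auto simp: inner_replace_coord Basis_prod_def)
  then show ?thesis using inf by (simp add: pnorm_inf_le)
qed

text \<open>Applied to differences, this says that the projection is isometric on every hyperplane
  where the coordinate b is constant, such as the side faces of the cube.\<close>

lemma pnorm_replace_coord_eq:
  assumes p: "0 < p" and b: "b \<in> Basis" and 0: "fst w \<bullet> b = 0"
  shows "pnorm p (replace_coord b w) = pnorm p w"
  using p
proof (cases p rule: ereal_pos_cases)
  case (real r)
  then have "pnorm p w powr r = pnorm p (replace_coord b w) powr r"
    using pnorm_replace_coord_powr[OF real(2) b, of w] 0 by simp
  then show ?thesis using real by (intro antisym) (simp_all flip: pnorm_powr_le_iff)
next
  case inf
  let ?v = "replace_coord b w"
  have "\<bar>w \<bullet> c\<bar> \<le> pnorm \<infinity> ?v" if c: "c \<in> Basis" for c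
  proof -
    consider b' where "b' \<in> Basis" "c = (b', 0)" | "c = (0, 1)"
      using c by (auto simp: Basis_prod_def)
    then show ?thesis
    proof cases
      case 1
      show ?thesis
        using abs_inner_le_pnorm[of \<infinity> b' ?v] 1 b 0 pnorm_nonneg[of \<infinity> ?v]
        by (cases w; cases "b' = b") (auto simp: inner_replace_coord)
    next
      case 2
      show ?thesis
        using abs_inner_le_pnorm[of \<infinity> b ?v] 2 b by (cases w) (auto simp: inner_replace_coord)
    qed
  qed
  then have "pnorm \<infinity> w \<le> pnorm \<infinity> ?v" by (rule pnorm_inf_le)
  then show ?thesis using inf pnorm_replace_coord_le[OF p b, of w] by simp
qed

section \<open>Comparison of powers for small arguments\<close>

lemma powr_small:
  fixes e \<eta> :: real
  assumes "0 < e" "0 < \<eta>"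
  obtains \<delta> where "0 < \<delta>" "\<And>s. 0 < s \<Longrightarrow> s \<le> \<delta> \<Longrightarrow> s powr e \<le> \<eta>"
proof
  show "0 < \<eta> powr (1 / e)" using assms by simp
  fix s :: real assume "0 < s" "s \<le> \<eta> powr (1 / e)"
  then have "s powr e \<le> (\<eta> powr (1 / e)) powr e" using assms by (intro powr_mono2) auto
  then show "s powr e \<le> \<eta>" using assms by (simp add: powr_powr)
qed

text \<open>The common end of all asymptotic comparisons: after division by the dominant power, a
  positive constant would be bounded by a multiple of a positive power of s.\<close>

lemma powr_small_contradiction:
  fixes e c C s0 :: real
  assumes "0 < e" "0 < c" "0 < s0" and le: "\<And>s. 0 < s \<Longrightarrow> s \<le> s0 \<Longrightarrow> c \<le> C * s powr e"
  shows False
proof -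
  obtain \<delta> where \<delta>: "0 < \<delta>" "\<And>s. 0 < s \<Longrightarrow> s \<le> \<delta> \<Longrightarrow> s powr e \<le> c / (2 * (\<bar>C\<bar> + 1))"
    using powr_small[of e "c / (2 * (\<bar>C\<bar> + 1))"] assms by auto
  let ?s = "min \<delta> s0"
  have "c \<le> C * ?s powr e" using assms \<delta> by (intro le) auto
  also have "\<dots> \<le> (\<bar>C\<bar> + 1) * ?s powr e" by (intro mult_right_mono) auto
  also have "\<dots> \<le> (\<bar>C\<bar> + 1) * (c / (2 * (\<bar>C\<bar> + 1)))" using \<delta> assms by (intro mult_left_mono \<delta>) auto
  also have "\<dots> = c / 2" by (simp add: field_simps)
  finally show False using assms by simp
qed

lemma powr_diff_ge_of_exponent_ge_one:
  fixes a x y :: real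
  assumes "1 \<le> a" "0 < y" "y \<le> x"
  shows "y powr (a - 1) * (x - y) \<le> x powr a - y powr a"
proof -
  have "x powr a = x powr (a - 1) * x" "y powr a = y powr (a - 1) * y"
    using assms by (simp_all add: powr_mult_base mult.commute[of _ x] mult.commute[of _ y])
  moreover have "y powr (a - 1) * x \<le> x powr (a - 1) * x"
    using assms by (intro mult_right_mono powr_mono2) auto
  ultimately show ?thesis by (simp add: algebra_simps)
qed

text \<open>A negative second summand is truncated to 0 on the right, which can only increase that
  side.\<close>

lemma ennreal_add_le: "0 \<le> x \<Longrightarrow> ennreal (x + y) \<le> ennreal x + ennreal y"
  by (cases "0 \<le> y") (auto simp: ennreal_neg intro!: ennreal_leI)

text \<open>The contraction \<open>replace_coord\<close> forgets one base coordinate. The image of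
  the graph contains a box whose height is of order s^r and whose k - 1 other sides are of order s;
  for r < 1 this is larger than s^k.\<close>

lemma area_lower_exponent_lt_one:
  assumes r: "0 < r" "r < 1"
  obtains c s0 where "0 < c" "0 < s0" "s0 \<le> 1"
    "\<And>s. 0 < s \<Longrightarrow> s \<le> s0 \<Longrightarrow> ennreal (c * s ^ (DIM('a) - 1) * s powr r) \<le>
       hausdorff_measure (pdist (ereal r)) DIM('a) (graph_map r ` (orthant_ball (ereal r) s :: 'a::euclidean_space set))"
proof -
  let ?k = "DIM('a)" and ?q = "quarter_circle r" and ?N = "pnorm (ereal r) :: 'a \<Rightarrow> real"
  have p: "0 < ereal r" using r by simp
  have k0: "0 < real ?k" by simp
  \<comment> \<open>\<open>c0\<close> lets the k - 1 remaining coordinates use at most half of s^r,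
    and \<open>c1\<close> selects heights y with 1 - y^r at least that half. \<open>m\<close> is the
    minimum of (1 - x)^(1/r - 1) for x up to 1/2, the range of s^r when s is at most
    \<open>c1\<close>.\<close>
  define c0 where "c0 = (1 / (2 * ?k)) powr (1 / r)"
  define c1 where "c1 = (1 / 2 :: real) powr (1 / r)"
  define m where "m = (1 / 2 :: real) powr (1 / r - 1)"
  have c0: "0 < c0" "c0 powr r = 1 / (2 * ?k)" using k0 r by (auto simp: c0_def powr_powr)
  have c1: "0 < c1" "c1 powr r = 1 / 2" using r by (auto simp: c1_def powr_powr)
  have c1_le: "c1 \<le> 1" using c1 powr_le_one_iff[of r c1] r by simp
  have m0: "0 < m" by (simp add: m_def)
  obtain b1 :: 'a where b1: "b1 \<in> Basis" by (meson nonempty_Basis ex_in_conv)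
  \<comment> \<open>The factors of the constant come from the base of the box, from its height, and
    from the comparison of Lebesgue with Hausdorff measure.\<close>
  show thesis
  proof (rule that[of "c0 ^ (?k - 1) * m / 2 / 2 ^ ?k" c1])
    show "0 < c0 ^ (?k - 1) * m / 2 / 2 ^ ?k" using c0 m0 by simp
    fix s :: real assume s: "0 < s" "s \<le> c1"
    have sr: "s powr r \<le> 1 / 2" using powr_mono2[of r s c1] s r c1 by simp
    have s1: "s \<le> 1" using s c1_le by simp
    have c1s: "0 \<le> c1 * s" "c1 * s \<le> s" using c1 c1_le s by (auto simp: mult_left_le_one_le)
    have qle: "?q s \<le> ?q (c1 * s)" using c1s s1 r by (intro quarter_circle_antimono) auto
    define X where "X = cbox (?q s *\<^sub>R b1) ((c0 * s) *\<^sub>R (One - b1) + ?q (c1 * s) *\<^sub>R b1)"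
    have X: "x \<in> X \<longleftrightarrow> (?q s \<le> x \<bullet> b1 \<and> x \<bullet> b1 \<le> ?q (c1 * s)) \<and>
        (\<forall>b\<in>Basis - {b1}. 0 \<le> x \<bullet> b \<and> x \<bullet> b \<le> c0 * s)" for x
      using b1 by (auto simp: X_def mem_box inner_add_left inner_diff_left inner_Basis)
    have sub: "X \<subseteq> replace_coord b1 ` graph_map r ` orthant_ball (ereal r) s"
    proof
      fix x assume "x \<in> X"
      then have x: "?q s \<le> x \<bullet> b1" "x \<bullet> b1 \<le> ?q (c1 * s)" "\<And>b. b \<in> Basis \<Longrightarrow> b \<noteq> b1 \<Longrightarrow> 0 \<le> x \<bullet> b \<and> x \<bullet> b \<le> c0 * s"
        unfolding X by auto
      define y where "y = x \<bullet> b1"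
      define T where "T = (\<Sum>b\<in>Basis - {b1}. \<bar>x \<bullet> b\<bar> powr r)"
      have y0: "0 \<le> y" using x(1) quarter_circle_nonneg[of r s] unfolding y_def by linarith
      have ylow: "1 - s powr r \<le> y powr r"
        using powr_mono2[of r "?q s" y] x(1) quarter_circle_powr[of r s] r s s1 by (simp add: y_def)
      have yup: "y powr r \<le> 1 - s powr r / 2"
        using powr_mono2[of r y "?q (c1 * s)"] x(2) y0 quarter_circle_powr[of r "c1 * s"] r s s1 c1 c1s
        by (simp add: y_def powr_mult)
      have "T \<le> (\<Sum>b\<in>Basis - {b1}. (c0 * s) powr r)"
        unfolding T_def using x(3) r by (intro sum_mono powr_mono2) auto
      also have "\<dots> = real (?k - 1) * (s powr r / (2 * ?k))"
        using b1 c0 s by (simp add: powr_mult)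
      also have "\<dots> \<le> real ?k * (s powr r / (2 * ?k))" by (intro mult_right_mono) auto
      also have "\<dots> = s powr r / 2" by simp
      finally have T: "T \<le> s powr r / 2" .
      have T0: "0 \<le> T" by (simp add: T_def sum_nonneg)
      \<comment> \<open>The forgotten coordinate is recovered as the value that completes the sum of
        r-th powers to 1 - y^r, so that the lifted point has height y.\<close>
      define \<tau> where "\<tau> = (1 - y powr r - T) powr (1 / r)"
      have \<tau>: "0 \<le> \<tau>" "\<tau> powr r = 1 - y powr r - T" using T yup r by (auto simp: \<tau>_def powr_powr)
      define z where "z = x + (\<tau> - y) *\<^sub>R b1"
      have zb: "z \<bullet> b = (if b = b1 then \<tau> else x \<bullet> b)" if "b \<in> Basis" for b
        using b1 that by (auto simp: z_def y_def inner_add_left inner_Basis)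
      have Nz: "?N z powr r = 1 - y powr r"
      proof -
        have "?N z powr r = (\<Sum>b\<in>Basis. \<bar>z \<bullet> b\<bar> powr r)" using r(1) by (rule pnorm_powr)
        also have "\<dots> = \<bar>\<tau>\<bar> powr r + (\<Sum>b\<in>Basis - {b1}. \<bar>z \<bullet> b\<bar> powr r)"
          using b1 by (subst sum.remove[of _ b1]) (auto simp: zb)
        also have "(\<Sum>b\<in>Basis - {b1}. \<bar>z \<bullet> b\<bar> powr r) = T"
          unfolding T_def by (intro sum.cong) (auto simp: zb)
        finally show ?thesis using \<tau> by simp
      qed
      have "?N z powr r \<le> s powr r" using ylow by (simp add: Nz)
      then have Ns: "?N z \<le> s" using powr_less_mono2[of r s "?N z"] s r by force
      have "z \<in> orthant_ball (ereal r) s"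
        unfolding orthant_ball_def using Ns zb x(3) \<tau>(1) by auto
      moreover have "x = replace_coord b1 (graph_map r z)"
      proof -
        have "y = ?q (?N z)"
          using y0 r pnorm_nonneg[of _ z] by (intro quarter_circle_unique) (auto simp: Nz)
        then show ?thesis
          using zb[OF b1] by (simp add: replace_coord_def graph_map_def z_def algebra_simps)
      qed
      ultimately show "x \<in> replace_coord b1 ` graph_map r ` orthant_ball (ereal r) s" by blast
    qed
    have vol: "emeasure lborel X = ennreal ((c0 * s) ^ (?k - 1) * (?q (c1 * s) - ?q s))"
    proof -
      have side: "((c0 * s) *\<^sub>R (One - b1) + ?q (c1 * s) *\<^sub>R b1 - ?q s *\<^sub>R b1) \<bullet> b =
          (if b = b1 then ?q (c1 * s) - ?q s else c0 * s)" if "b \<in> Basis" for b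
        using that b1 by (auto simp: inner_add_left inner_diff_left inner_Basis)
      have "emeasure lborel X = ennreal (\<Prod>b\<in>Basis. if b = b1 then ?q (c1 * s) - ?q s else c0 * s)"
        unfolding X_def
        by (subst emeasure_lborel_cbox)
           (use b1 c0 s qle in \<open>auto simp: side[symmetric] inner_add_left inner_diff_left inner_Basis intro!: arg_cong[of _ _ ennreal] prod.cong\<close>)
      also have "(\<Prod>b\<in>Basis. if b = b1 then ?q (c1 * s) - ?q s else c0 * s) =
          (?q (c1 * s) - ?q s) * (c0 * s) ^ (?k - 1)"
        using b1 by (subst prod.remove[of _ b1]) auto
      finally show ?thesis by (simp add: mult.commute)
    qed
    have "m * (s powr r / 2) \<le> ?q (c1 * s) - ?q s"
    proof -
      have "m \<le> (1 - s powr r) powr (1 / r - 1)"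
        unfolding m_def using r sr by (intro powr_mono2) auto
      then have "m * (s powr r / 2) \<le> (1 - s powr r) powr (1 / r - 1) * (s powr r / 2)"
        by (intro mult_right_mono) auto
      also have "\<dots> \<le> (1 - s powr r / 2) powr (1 / r) - (1 - s powr r) powr (1 / r)"
        using powr_diff_ge_of_exponent_ge_one[of "1 / r" "1 - s powr r" "1 - s powr r / 2"] r sr by simp
      also have "\<dots> = ?q (c1 * s) - ?q s"
        using s less_imp_le[OF c1(1)] by (simp add: quarter_circle_def powr_mult c1(2))
      finally show ?thesis .
    qed
    then have "(c0 * s) ^ (?k - 1) * (m * (s powr r / 2)) \<le> (c0 * s) ^ (?k - 1) * (?q (c1 * s) - ?q s)"
      using c0 s by (intro mult_left_mono) auto
    then have "ennreal ((c0 * s) ^ (?k - 1) * (m * (s powr r / 2))) \<le> emeasure lborel X"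
      unfolding vol by (rule ennreal_leI)
    also have "\<dots> \<le> 2 ^ ?k * hausdorff_measure (pdist (ereal r)) ?k X"
      by (rule lborel_le_hausdorff_measure[OF p])
    also have "hausdorff_measure (pdist (ereal r)) ?k X \<le>
        hausdorff_measure (pdist (ereal r)) ?k (replace_coord b1 ` graph_map r ` orthant_ball (ereal r) s)"
      by (rule hausdorff_measure_subset[OF sub])
    also have "\<dots> \<le> ennreal 1 ^ ?k * hausdorff_measure (pdist (ereal r)) ?k (graph_map r ` orthant_ball (ereal r) s :: ('a \<times> real) set)"
      by (rule hausdorff_measure_Lipschitz_image)
         (auto simp: replace_coord_diff intro!: pnorm_replace_coord_le p b1)
    finally have *: "ennreal ((c0 * s) ^ (?k - 1) * (m * (s powr r / 2))) \<le>
        2 ^ ?k * hausdorff_measure (pdist (ereal r)) ?k (graph_map r ` orthant_ball (ereal r) s :: ('a \<times> real) set)"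
      by (simp add: mult_left_mono)
    have "ennreal ((c0 * s) ^ (?k - 1) * (m * (s powr r / 2))) / ennreal (2 ^ ?k) \<le>
        hausdorff_measure (pdist (ereal r)) ?k (graph_map r ` orthant_ball (ereal r) s :: ('a \<times> real) set)"
      by (rule divide_le_posI_ennreal) (use * in \<open>simp_all add: mult.commute zero_less_iff_neq_zero flip: ennreal_power\<close>)
    then show "ennreal (c0 ^ (?k - 1) * m / 2 / 2 ^ ?k * s ^ (?k - 1) * s powr r) \<le>
        hausdorff_measure (pdist (ereal r)) ?k (graph_map r ` orthant_ball (ereal r) s :: ('a \<times> real) set)"
      using c0 s m0 by (simp add: divide_ennreal power_mult_distrib mult_ac)
  qed (use c1 c1_le in auto)
qed

section \<open>Exponents above one: increments of the profile and area bounds\<close>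

lemma quarter_circle_pnorm:
  "0 < r \<Longrightarrow> quarter_circle r (pnorm (ereal r) z) = (1 - (\<Sum>b\<in>Basis. \<bar>z \<bullet> b\<bar> powr r)) powr (1 / r)"
  by (simp add: quarter_circle_def pnorm_powr)

lemma powr_diff_le_of_exponent_le_one:
  fixes r x y :: real
  assumes "1 \<le> r" "1 / 2 \<le> y" "y \<le> x"
  shows "x powr (1 / r) - y powr (1 / r) \<le> 2 * (x - y)"
proof (cases "x = y")
  case False
  then have "y < x" using assms by simp
  then obtain z where z: "y < z" "z < x" "x powr (1 / r) - y powr (1 / r) = (x - y) * (1 / r * z powr (1 / r - 1))"
    using powr_diff_mvt[of "1 / r" y x] assms by auto
  have "z powr (1 / r - 1) \<le> (1 / 2) powr (1 / r - 1)" using z assms by (intro powr_mono2') auto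
  also have "\<dots> \<le> (1 / 2) powr (- 1)" using assms by (intro powr_mono') auto
  finally have "z powr (1 / r - 1) \<le> 2" by (simp add: powr_minus)
  then have "1 / r * z powr (1 / r - 1) \<le> 1 * 2" using assms by (intro mult_mono) auto
  then have "(x - y) * (1 / r * z powr (1 / r - 1)) \<le> (x - y) * 2" using assms by (intro mult_left_mono) auto
  then show ?thesis using z by simp
qed simp

lemma powr_diff_ge_of_exponent_le_one:
  fixes r x y :: real
  assumes "1 \<le> r" "0 \<le> y" "y \<le> x" "x \<le> 1"
  shows "(x - y) / r \<le> x powr (1 / r) - y powr (1 / r)"
proof (cases "x = y")
  case False
  then have "y < x" using assms by simp
  then obtain z where z: "y < z" "z < x" "x powr (1 / r) - y powr (1 / r) = (x - y) * (1 / r * z powr (1 / r - 1))"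
    using powr_diff_mvt[of "1 / r" y x] assms by auto
  have "1 \<le> z powr (1 / r - 1)" using z assms powr_mono'[of "1 / r - 1" 0 z] by simp
  then have "1 / r * 1 \<le> 1 / r * z powr (1 / r - 1)" using assms by (intro mult_left_mono) auto
  then have "(x - y) * (1 / r * 1) \<le> (x - y) * (1 / r * z powr (1 / r - 1))"
    by (rule mult_left_mono) (use assms in simp)
  moreover have "(x - y) / r = (x - y) * (1 / r * 1)" by simp
  ultimately show ?thesis unfolding z(3) by linarith
qed simp

text \<open>\<open>fst\<close> undoes \<open>graph_map r\<close> and does not increase
  norms.\<close>

lemma area_ge_projection:
  assumes p: "0 < q"
  shows "hausdorff_measure (pdist q) k A \<le> hausdorff_measure (pdist q) k (graph_map r ` A)"
proof -
  have "hausdorff_measure (pdist q) k (fst ` graph_map r ` A) \<le>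
      ennreal 1 ^ k * hausdorff_measure (pdist q) k (graph_map r ` A)"
  proof (rule hausdorff_measure_Lipschitz_image)
    fix w w' :: "'a \<times> real"
    show "pnorm q (fst w - fst w') \<le> 1 * pnorm q (w - w')"
      using pnorm_le_Pair[OF p, of "fst w - fst w'" "snd w - snd w'"] by (simp add: minus_prod_def)
  qed simp
  then show ?thesis by (simp add: image_image graph_map_def)
qed

context
  fixes r \<kappa> \<beta> :: real
  assumes r: "1 < r" and \<kappa>: "0 < \<kappa>" and \<beta>: "0 \<le> \<beta>"
    and H\<kappa>: "\<And>A :: 'a::euclidean_space set. A \<in> sets borel \<Longrightarrow>
      hausdorff_measure (pdist (ereal r)) DIM('a) A = ennreal \<kappa> * emeasure lborel A"
    and B\<beta>: "emeasure lborel (orthant_ball (ereal r) 1 :: 'a set) = ennreal \<beta>"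
begin

lemma hausdorff_measure_orthant_ball:
  assumes s: "0 < s"
  shows "hausdorff_measure (pdist (ereal r)) DIM('a) (orthant_ball (ereal r) s :: 'a set) = ennreal (\<kappa> * (s ^ DIM('a) * \<beta>))"
  using s r \<kappa> \<beta> by (simp add: H\<kappa> orthant_ball_borel emeasure_orthant_ball B\<beta> ennreal_mult)

text \<open>Over the ball of radius s the height differs by at most 2 r k s^(r-1) times the distance
  in the base. Its r-th power is added to that of the base distance, so \<open>graph_map r\<close>
  is Lipschitz with constant 1 + O(s^(r(r-1))).\<close>

lemma area_upper:
  obtains C s0 where "0 \<le> C" "0 < s0" "s0 \<le> 1"
    "\<And>s. 0 < s \<Longrightarrow> s \<le> s0 \<Longrightarrow>
       hausdorff_measure (pdist (ereal r)) DIM('a) (graph_map r ` (orthant_ball (ereal r) s :: 'a set)) \<le>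
       ennreal (\<kappa> * (s ^ DIM('a) * \<beta>) * (1 + C * s powr (r * (r - 1))))"
proof -
  let ?k = "DIM('a)" and ?q = "quarter_circle r" and ?N = "pnorm (ereal r) :: 'a \<Rightarrow> real"
  have p: "0 < ereal r" and r0: "0 < r" using r by auto
  \<comment> \<open>The r-th power of the slope factor: r from the derivative of a power, k from the
    number of coordinates, 2 from the r-th root away from 0.\<close>
  define D where "D = (2 * r * ?k) powr r"
  have D: "0 < D" using r0 by (simp add: D_def)
  obtain \<delta>1 where \<delta>1: "0 < \<delta>1" "\<And>s. 0 < s \<Longrightarrow> s \<le> \<delta>1 \<Longrightarrow> s powr r \<le> 1 / 2"
    using powr_small[of r "1 / 2"] r0 by auto
  \<comment> \<open>This bound keeps the excess of the Lipschitz constant below 1, so that its k-th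
    power can be linearized with the factor 2^k.\<close>
  obtain \<delta>2 where \<delta>2: "0 < \<delta>2" "\<And>s. 0 < s \<Longrightarrow> s \<le> \<delta>2 \<Longrightarrow> s powr (r * (r - 1)) \<le> 1 / D"
    using powr_small[of "r * (r - 1)" "1 / D"] r D by auto
  show thesis
  proof (rule that[of "2 ^ ?k * D" "min 1 (min \<delta>1 \<delta>2)"])
    fix s :: real assume s: "0 < s" "s \<le> min 1 (min \<delta>1 \<delta>2)"
    let ?e = "D * s powr (r * (r - 1))"
    have sr: "s powr r \<le> 1 / 2" using s \<delta>1 by auto
    have e: "0 \<le> ?e" "?e \<le> 1" using s \<delta>2(2)[of s] D by (auto simp: field_simps)
    have lip: "pnorm (ereal r) (graph_map r x - graph_map r y) \<le> (1 + ?e) * ?N (x - y)"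
      if xy: "x \<in> orthant_ball (ereal r) s" "y \<in> orthant_ball (ereal r) s" for x y :: 'a
    proof -
      have coord: "0 \<le> w \<bullet> b" "w \<bullet> b \<le> s" if "w \<in> orthant_ball (ereal r) s" "b \<in> Basis" for w b :: 'a
        using that abs_inner_le_pnorm[OF p that(2), of w] by (auto simp: orthant_ball_def)
      \<comment> \<open>\<open>X\<close> is the r-th power of the height; it stays above 1/2, where
        the r-th root is Lipschitz with constant 2.\<close>
      define X where "X w = 1 - (\<Sum>b\<in>Basis. \<bar>w \<bullet> b\<bar> powr r)" for w :: 'a
      have X: "1 / 2 \<le> X w" if "w \<in> orthant_ball (ereal r) s" for w
      proof -
        have "?N w powr r \<le> s powr r" using that r0 pnorm_nonneg[of _ w] by (intro powr_mono2) (auto simp: orthant_ball_def)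
        then show ?thesis using sr r0 by (simp add: X_def pnorm_powr)
      qed
      have "\<bar>X x - X y\<bar> = \<bar>\<Sum>b\<in>Basis. \<bar>y \<bullet> b\<bar> powr r - \<bar>x \<bullet> b\<bar> powr r\<bar>"
        by (simp add: X_def sum_subtractf)
      also have "\<dots> \<le> (\<Sum>b\<in>Basis. \<bar>\<bar>y \<bullet> b\<bar> powr r - \<bar>x \<bullet> b\<bar> powr r\<bar>)" by (rule sum_abs)
      also have "\<dots> \<le> (\<Sum>b\<in>(Basis :: 'a set). r * s powr (r - 1) * ?N (x - y))"
      proof (rule sum_mono)
        fix b :: 'a assume b: "b \<in> Basis"
        have "\<bar>\<bar>y \<bullet> b\<bar> powr r - \<bar>x \<bullet> b\<bar> powr r\<bar> \<le> r * s powr (r - 1) * \<bar>x \<bullet> b - y \<bullet> b\<bar>"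
          using powr_diff_le[of r "x \<bullet> b" "y \<bullet> b" s] powr_diff_le[of r "y \<bullet> b" "x \<bullet> b" s]
            coord[OF xy(1) b] coord[OF xy(2) b] r powr_mono2[of r "x \<bullet> b" "y \<bullet> b"] powr_mono2[of r "y \<bullet> b" "x \<bullet> b"]
          by (cases "x \<bullet> b \<le> y \<bullet> b") auto
        also have "\<dots> \<le> r * s powr (r - 1) * ?N (x - y)"
          using abs_inner_le_pnorm[OF p b, of "x - y"] r0
          by (intro mult_left_mono) (auto simp: inner_diff_left)
        finally show "\<bar>\<bar>y \<bullet> b\<bar> powr r - \<bar>x \<bullet> b\<bar> powr r\<bar> \<le> r * s powr (r - 1) * ?N (x - y)" .
      qed
      finally have dX: "\<bar>X x - X y\<bar> \<le> ?k * (r * s powr (r - 1) * ?N (x - y))" by simp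
      have "\<bar>?q (?N x) - ?q (?N y)\<bar> \<le> 2 * \<bar>X x - X y\<bar>"
        unfolding quarter_circle_pnorm[OF r0] X_def[symmetric]
        using powr_diff_le_of_exponent_le_one[of r "X x" "X y"] powr_diff_le_of_exponent_le_one[of r "X y" "X x"]
          X[OF xy(1)] X[OF xy(2)] r powr_mono2[of "1 / r" "X x" "X y"] powr_mono2[of "1 / r" "X y" "X x"]
        by (cases "X x \<le> X y") auto
      also have "\<dots> \<le> (2 * r * ?k) * s powr (r - 1) * ?N (x - y)" using dX by (simp add: mult_ac)
      finally have "\<bar>?q (?N x) - ?q (?N y)\<bar> powr r \<le> ((2 * r * ?k) * s powr (r - 1) * ?N (x - y)) powr r"
        using r0 by (intro powr_mono2) auto
      also have "\<dots> = ?e * ?N (x - y) powr r"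
        using r0 pnorm_nonneg[of _ "x - y"] by (simp add: powr_mult powr_powr D_def mult.commute)
      finally have "pnorm (ereal r) (graph_map r x - graph_map r y) powr r \<le> (1 + ?e) * ?N (x - y) powr r"
        using r0 by (simp add: graph_map_def pnorm_Pair_powr algebra_simps)
      also have "\<dots> \<le> (1 + ?e) powr r * ?N (x - y) powr r"
        using powr_mono[of 1 r "1 + ?e"] r e by (intro mult_right_mono) auto
      also have "\<dots> = ((1 + ?e) * ?N (x - y)) powr r"
        using e pnorm_nonneg[of _ "x - y"] by (simp add: powr_mult)
      finally show ?thesis
        using powr_less_mono2[of r "(1 + ?e) * ?N (x - y)"] r0 e pnorm_nonneg[of "ereal r"]
        by (smt (verit) mult_nonneg_nonneg)
    qed
    have pow: "(1 + x) ^ m \<le> 1 + 2 ^ m * x" if "0 \<le> x" "x \<le> 1" for x :: real and m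
    proof (induction m)
      case (Suc m)
      have "(1 + x) ^ m \<le> 2 ^ m" using that by (intro power_mono) auto
      then have "x * (1 + x) ^ m \<le> x * 2 ^ m" using that by (intro mult_left_mono) auto
      then show ?case using Suc.IH by (simp add: algebra_simps)
    qed (use that in simp)
    have "hausdorff_measure (pdist (ereal r)) ?k (graph_map r ` (orthant_ball (ereal r) s :: 'a set)) \<le>
        ennreal (1 + ?e) ^ ?k * hausdorff_measure (pdist (ereal r)) ?k (orthant_ball (ereal r) s :: 'a set)"
      using e lip by (intro hausdorff_measure_Lipschitz_image) auto
    also have "\<dots> = ennreal ((1 + ?e) ^ ?k * (\<kappa> * (s ^ ?k * \<beta>)))"
      unfolding hausdorff_measure_orthant_ball[OF s(1)]
      using e \<kappa> \<beta> s by (subst ennreal_power) (auto simp: ennreal_mult[symmetric] simp del: ennreal_plus)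
    also have "\<dots> \<le> ennreal ((1 + 2 ^ ?k * ?e) * (\<kappa> * (s ^ ?k * \<beta>)))"
      using e \<kappa> \<beta> s by (intro ennreal_leI mult_right_mono pow) auto
    finally show "hausdorff_measure (pdist (ereal r)) ?k (graph_map r ` (orthant_ball (ereal r) s :: 'a set)) \<le>
       ennreal (\<kappa> * (s ^ DIM('a) * \<beta>) * (1 + 2 ^ ?k * D * s powr (r * (r - 1))))"
      by (simp add: mult_ac)
  qed (use \<delta>1 \<delta>2 D in auto)
qed

text \<open>For \<open>1 < r < 2\<close> the projection to \<open>'a\<close> is not the best contraction of the graph. On a box where
  the first coordinate dominates, the graph is steep in that direction, and one may stretch it by
  \<open>\<alpha>\<close> at the price of contracting the other directions by \<open>\<gamma>\<close>; the volume grows in total.\<close>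

lemma area_lower_exponent_lt_two:
  assumes r2: "r < 2"
  obtains c where "0 < c"
    "\<And>s. 0 < s \<Longrightarrow> s \<le> 1 \<Longrightarrow>
       ennreal (\<kappa> * (s ^ DIM('a) * (\<beta> + c * s powr (r * (r - 1))))) \<le>
       hausdorff_measure (pdist (ereal r)) DIM('a) (graph_map r ` (orthant_ball (ereal r) s :: 'a set))"
proof -
  let ?k = "DIM('a)" and ?q = "quarter_circle r" and ?N = "pnorm (ereal r) :: 'a \<Rightarrow> real"
  let ?B = "\<lambda>s. orthant_ball (ereal r) s :: 'a set"
  have p: "0 < ereal r" and r0: "0 < r" using r by auto
  have k1: "1 \<le> real ?k" by (simp add: Suc_le_eq)
  obtain b1 :: 'a where b1: "b1 \<in> Basis" by (meson nonempty_Basis ex_in_conv)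
  let ?R = "Basis - {b1}"
  \<comment> \<open>The r-th power of the factor 1/2 that is lost when half of the increment in the
    steep direction absorbs the influence of the other directions.\<close>
  define a where "a = (1 / 2 :: real) powr r"
  have a: "0 < a" "a \<le> 1 / 2"
    using powr_mono'[of 1 r "1 / 2"] r by (auto simp: a_def)
  \<comment> \<open>\<open>\<delta>1\<close> keeps the box inside the ball. \<open>\<delta>2\<close>
    makes k d at most a / 4, so that all contractions together cost less than the single stretch
    gains.\<close>
  obtain \<delta>1 where \<delta>1: "0 < \<delta>1" "\<And>x. 0 < x \<Longrightarrow> x \<le> \<delta>1 \<Longrightarrow> x powr r \<le> 1 / (2 * ?k)"
    using powr_small[of r "1 / (2 * ?k)"] r0 k1 by auto
  obtain \<delta>2 where \<delta>2: "0 < \<delta>2" "\<And>x. 0 < x \<Longrightarrow> x \<le> \<delta>2 \<Longrightarrow> x powr ((r - 1) * r) \<le> a / (4 * ?k * ?k powr r)"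
    using powr_small[of "(r - 1) * r" "a / (4 * ?k * ?k powr r)"] r k1 a by auto
  define \<epsilon> where "\<epsilon> = min \<delta>1 (\<delta>2 / 4)"
  have \<epsilon>: "0 < \<epsilon>" "\<epsilon> powr r \<le> 1 / (2 * ?k)" "(4 * \<epsilon>) powr ((r - 1) * r) \<le> a / (4 * ?k * ?k powr r)"
    using \<delta>1 \<delta>2 by (auto simp: \<epsilon>_def)
  \<comment> \<open>The quotient of two slopes on the box: at most r (\<epsilon> s)^(r-1) in a short
    direction, at least r (s/4)^(r-1) in the long one. It is small because r > 1; \<open>d\<close>
    is the r-th power of k times it.\<close>
  define \<epsilon>' where "\<epsilon>' = (4 * \<epsilon>) powr (r - 1)"
  define d where "d = (\<epsilon>' * ?k) powr r"
  have \<epsilon>': "0 < \<epsilon>'" using \<epsilon> by (simp add: \<epsilon>'_def)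
  have d0: "0 \<le> d" by (simp add: d_def)
  have kd: "?k * d \<le> a / 4"
  proof -
    have "d = (4 * \<epsilon>) powr ((r - 1) * r) * ?k powr r"
      using \<epsilon> by (simp add: d_def \<epsilon>'_def powr_mult powr_powr)
    also have "\<dots> \<le> a / (4 * ?k * ?k powr r) * ?k powr r" using \<epsilon> by (intro mult_right_mono) auto
    also have "\<dots> = a / (4 * ?k)" using k1 by simp
    finally have "?k * d \<le> ?k * (a / (4 * ?k))" using k1 by (intro mult_left_mono) auto
    then show ?thesis using k1 by simp
  qed
  \<comment> \<open>The volume of the box relative to s^k, the relative gain of volume per unit of
    \<open>h\<close>, and \<open>h\<close> relative to \<open>s powr (r * (r - 1))\<close>.\<close>
  define c where "c = \<epsilon> ^ (?k - 1) / 4 * (a / 6) * (1 / 4) powr (r * (r - 1))"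
  show thesis
  proof (rule that[of c])
    show "0 < c" using \<epsilon> a by (simp add: c_def)
    fix s :: real assume s: "0 < s" "s \<le> 1"
    define h where "h = ((s / 4) powr (r - 1)) powr r"
    have h_eq: "h = (1 / 4) powr (r * (r - 1)) * s powr (r * (r - 1))"
      using s by (simp add: h_def powr_powr mult.commute flip: powr_mult)
    have h: "0 < h" "h \<le> 1"
    proof -
      show "0 < h" using s by (simp add: h_def)
      have "s / 4 \<le> 1" using s by simp
      then have "(s / 4) powr (r - 1) \<le> 1" using s r by (subst powr_le_one_iff) auto
      then show "h \<le> 1" using r0 unfolding h_def by (subst powr_le_one_iff) auto
    qed
    \<comment> \<open>In r-th powers the contraction property becomes linear: the stretch adds a h
      times the r-th power of the long increment, the contraction removes d h times the sum for the
      short ones, and the height difference has to cover the balance.\<close>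
    define \<alpha> where "\<alpha> = (1 + a * h) powr (1 / r)"
    define \<gamma> where "\<gamma> = (1 - d * h) powr (1 / r)"
    have dh: "d * h \<le> d" "d \<le> ?k * d"
      using d0 h k1 mult_right_mono[OF k1 d0] by (auto simp: mult_left_le)
    have dh1: "d * h < 1" using dh kd a by linarith
    have ah0: "0 < a * h" using a h by simp
    have \<alpha>: "0 < \<alpha>" "\<alpha> powr r = 1 + a * h"
      using ah0 r0 by (auto simp: \<alpha>_def powr_powr)
    have \<gamma>: "0 < \<gamma>" "\<gamma> powr r = 1 - d * h" using dh1 r0 by (auto simp: \<gamma>_def powr_powr)
    define Z where "Z = cbox ((s / 4) *\<^sub>R b1) ((s / 2) *\<^sub>R b1 + (\<epsilon> * s) *\<^sub>R (One - b1))"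
    define Z' where "Z' = cbox ((\<alpha> * (s / 4)) *\<^sub>R b1) ((\<alpha> * (s / 2)) *\<^sub>R b1 + (\<gamma> * (\<epsilon> * s)) *\<^sub>R (One - b1))"
    have box: "x \<in> cbox (u *\<^sub>R b1) (v *\<^sub>R b1 + w *\<^sub>R (One - b1)) \<longleftrightarrow>
        (u \<le> x \<bullet> b1 \<and> x \<bullet> b1 \<le> v) \<and> (\<forall>b\<in>?R. 0 \<le> x \<bullet> b \<and> x \<bullet> b \<le> w)" for x u v w
      using b1 by (auto simp: mem_box inner_add_left inner_diff_left inner_Basis)
    have box_vol: "emeasure lborel (cbox (u *\<^sub>R b1) (v *\<^sub>R b1 + w *\<^sub>R (One - b1))) =
        ennreal ((v - u) * w ^ (?k - 1))" if "u \<le> v" "0 \<le> w" for u v w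
    proof -
      have side: "(v *\<^sub>R b1 + w *\<^sub>R (One - b1) - u *\<^sub>R b1) \<bullet> b = (if b = b1 then v - u else w)" if "b \<in> Basis" for b
        using that b1 by (auto simp: inner_add_left inner_diff_left inner_Basis)
      have "emeasure lborel (cbox (u *\<^sub>R b1) (v *\<^sub>R b1 + w *\<^sub>R (One - b1))) =
          ennreal (\<Prod>b\<in>Basis. if b = b1 then v - u else w)"
        by (subst emeasure_lborel_cbox)
           (use b1 that in \<open>auto simp: side[symmetric] inner_add_left inner_diff_left inner_Basis intro!: arg_cong[of _ _ ennreal] prod.cong\<close>)
      also have "(\<Prod>b\<in>Basis. if b = b1 then v - u else w) = (v - u) * w ^ (?k - 1)"
        using b1 by (subst prod.remove[of _ b1]) auto
      finally show ?thesis .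
    qed
    have Z: "x \<in> Z \<longleftrightarrow> (s / 4 \<le> x \<bullet> b1 \<and> x \<bullet> b1 \<le> s / 2) \<and> (\<forall>b\<in>?R. 0 \<le> x \<bullet> b \<and> x \<bullet> b \<le> \<epsilon> * s)" for x
      unfolding Z_def by (rule box)
    have split: "(\<Sum>b\<in>Basis. f b) = f b1 + (\<Sum>b\<in>?R. f b)" for f :: "'a \<Rightarrow> real"
      using b1 by (subst sum.remove[of _ b1]) auto
    have ZB: "Z \<subseteq> ?B s"
    proof
      fix x assume "x \<in> Z"
      then have x: "s / 4 \<le> x \<bullet> b1" "x \<bullet> b1 \<le> s / 2" "\<And>b. b \<in> ?R \<Longrightarrow> 0 \<le> x \<bullet> b \<and> x \<bullet> b \<le> \<epsilon> * s"
        using Z by auto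
      have "?N x powr r = \<bar>x \<bullet> b1\<bar> powr r + (\<Sum>b\<in>?R. \<bar>x \<bullet> b\<bar> powr r)"
        using r0 by (simp add: pnorm_powr split)
      also have "\<dots> \<le> (s / 2) powr r + (\<Sum>b\<in>?R. (\<epsilon> * s) powr r)"
        using x s r0 by (intro add_mono sum_mono powr_mono2) auto
      also have "\<dots> = s powr r * (a + real (?k - 1) * \<epsilon> powr r)"
        using b1 s \<epsilon> by (simp add: powr_divide powr_mult a_def algebra_simps)
      also have "\<dots> \<le> s powr r * (1 / 2 + real ?k * (1 / (2 * ?k)))"
        using a \<epsilon> by (intro mult_left_mono add_mono mult_mono) auto
      also have "\<dots> = s powr r" using k1 by simp
      finally have "?N x \<le> s" using powr_less_mono2[of r s "?N x"] s r0 by force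
      moreover have "0 \<le> x \<bullet> b" if "b \<in> Basis" for b using x that s by (cases "b = b1") auto
      ultimately show "x \<in> ?B s" by (simp add: orthant_ball_def)
    qed
    define L where "L w = (\<Sum>b\<in>Basis. ((if b = b1 then \<alpha> else \<gamma>) * (fst w \<bullet> b)) *\<^sub>R b)" for w :: "'a \<times> real"
    have L: "L w \<bullet> b = (if b = b1 then \<alpha> else \<gamma>) * (fst w \<bullet> b)" if "b \<in> Basis" for w b
      using that by (simp add: L_def)
    have lip: "pnorm (ereal r) (L (graph_map r x) - L (graph_map r y)) \<le> pnorm (ereal r) (graph_map r x - graph_map r y)"
      if xy: "x \<in> Z" "y \<in> Z" for x y
    proof -
      define v where "v b = \<bar>x \<bullet> b - y \<bullet> b\<bar>" for b
      define W where "W = (\<Sum>b\<in>?R. v b powr r)"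
      define w where "w = (\<Sum>b\<in>?R. v b)"
      have W0: "0 \<le> W" and w0: "0 \<le> w" and v0: "0 \<le> v b" for b
        by (auto simp: W_def w_def v_def sum_nonneg)
      have wW: "w powr r \<le> ?k powr r * W"
      proof -
        have "v b \<le> W powr (1 / r)" if "b \<in> ?R" for b
        proof -
          have "v b powr r \<le> W" unfolding W_def using that by (intro member_le_sum) auto
          then have "(v b powr r) powr (1 / r) \<le> W powr (1 / r)" using r0 by (intro powr_mono2) auto
          then show ?thesis using r0 v0[of b] by (simp add: powr_powr)
        qed
        then have "w \<le> (\<Sum>b\<in>?R. W powr (1 / r))" unfolding w_def by (intro sum_mono)
        also have "\<dots> = real (?k - 1) * W powr (1 / r)" using b1 by simp
        also have "\<dots> \<le> ?k * W powr (1 / r)" by (intro mult_right_mono) auto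
        finally have "w powr r \<le> (?k * W powr (1 / r)) powr r" using r0 w0 by (intro powr_mono2) auto
        also have "\<dots> = ?k powr r * W" using r0 W0 by (simp add: powr_mult powr_powr)
        finally show ?thesis .
      qed
      have xZ: "s / 4 \<le> z \<bullet> b1" "\<And>b. b \<in> ?R \<Longrightarrow> 0 \<le> z \<bullet> b \<and> z \<bullet> b \<le> \<epsilon> * s" if "z \<in> Z" for z
        using that Z by auto
      define X where "X z = 1 - (\<Sum>b\<in>Basis. \<bar>z \<bullet> b\<bar> powr r)" for z :: 'a
      have X: "0 \<le> X z" "X z \<le> 1" if "z \<in> Z" for z
      proof -
        have "?N z powr r \<le> 1"
          using ZB that s r0 by (subst powr_le_one_iff) (auto simp: orthant_ball_def pnorm_nonneg)
        then show "0 \<le> X z" using r0 by (simp add: X_def pnorm_powr)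
        show "X z \<le> 1" by (simp add: X_def sum_nonneg)
      qed
      have first: "r * (s / 4) powr (r - 1) * v b1 \<le> \<bar>\<bar>x \<bullet> b1\<bar> powr r - \<bar>y \<bullet> b1\<bar> powr r\<bar>"
      proof -
        have mvt: "r * (s / 4) powr (r - 1) * (t - u) \<le> t powr r - u powr r" if "s / 4 \<le> u" "u \<le> t" for u t
        proof (cases "u = t")
          case False
          then have ut: "0 \<le> u" "u < t" using that s by auto
          obtain z where z: "u < z" "z < t" "t powr r - u powr r = (t - u) * (r * z powr (r - 1))"
            using powr_diff_mvt[OF r0 ut] by blast
          have "(s / 4) powr (r - 1) \<le> z powr (r - 1)" using z that s r by (intro powr_mono2) auto
          then have "(t - u) * (r * (s / 4) powr (r - 1)) \<le> (t - u) * (r * z powr (r - 1))"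
            using that r0 by (intro mult_left_mono) auto
          then show ?thesis unfolding z(3) by (simp add: mult_ac)
        qed simp
        show ?thesis
        proof (cases "x \<bullet> b1 \<le> y \<bullet> b1")
          case True
          then show ?thesis
            using mvt[of "x \<bullet> b1" "y \<bullet> b1"] xZ(1)[OF xy(1)] s by (auto simp: v_def abs_minus_commute)
        next
          case False
          then show ?thesis
            using mvt[of "y \<bullet> b1" "x \<bullet> b1"] xZ(1)[OF xy(2)] s by (auto simp: v_def)
        qed
      qed
      have rest: "\<bar>\<Sum>b\<in>?R. \<bar>x \<bullet> b\<bar> powr r - \<bar>y \<bullet> b\<bar> powr r\<bar> \<le> r * (\<epsilon> * s) powr (r - 1) * w"
      proof -
        have "\<bar>\<Sum>b\<in>?R. \<bar>x \<bullet> b\<bar> powr r - \<bar>y \<bullet> b\<bar> powr r\<bar> \<le> (\<Sum>b\<in>?R. \<bar>\<bar>x \<bullet> b\<bar> powr r - \<bar>y \<bullet> b\<bar> powr r\<bar>)"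
          by (rule sum_abs)
        also have "\<dots> \<le> (\<Sum>b\<in>?R. r * (\<epsilon> * s) powr (r - 1) * v b)"
        proof (rule sum_mono)
          fix b assume b: "b \<in> ?R"
          show "\<bar>\<bar>x \<bullet> b\<bar> powr r - \<bar>y \<bullet> b\<bar> powr r\<bar> \<le> r * (\<epsilon> * s) powr (r - 1) * v b"
            using powr_diff_le[of r "x \<bullet> b" "y \<bullet> b" "\<epsilon> * s"] powr_diff_le[of r "y \<bullet> b" "x \<bullet> b" "\<epsilon> * s"]
              xZ(2)[OF xy(1) b] xZ(2)[OF xy(2) b] r powr_mono2[of r "x \<bullet> b" "y \<bullet> b"] powr_mono2[of r "y \<bullet> b" "x \<bullet> b"]
            unfolding v_def by (cases "x \<bullet> b \<le> y \<bullet> b") auto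
        qed
        finally show ?thesis by (simp add: w_def sum_distrib_left)
      qed
      have es: "(\<epsilon> * s) powr (r - 1) = (s / 4) powr (r - 1) * \<epsilon>'"
        unfolding \<epsilon>'_def using s \<epsilon> by (simp add: mult.commute flip: powr_mult)
      have "r * ((s / 4) powr (r - 1) * (v b1 - \<epsilon>' * w)) \<le> \<bar>X x - X y\<bar>"
      proof -
        have "X y - X x = (\<bar>x \<bullet> b1\<bar> powr r - \<bar>y \<bullet> b1\<bar> powr r) + (\<Sum>b\<in>?R. \<bar>x \<bullet> b\<bar> powr r - \<bar>y \<bullet> b\<bar> powr r)"
          by (simp add: X_def split sum_subtractf)
        then have "r * (s / 4) powr (r - 1) * v b1 - r * (\<epsilon> * s) powr (r - 1) * w \<le> \<bar>X x - X y\<bar>"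
          using first rest by linarith
        then show ?thesis by (simp add: es algebra_simps)
      qed
      also have "\<bar>X x - X y\<bar> \<le> r * \<bar>?q (?N x) - ?q (?N y)\<bar>"
      proof -
        have "\<bar>X x - X y\<bar> / r \<le> \<bar>X x powr (1 / r) - X y powr (1 / r)\<bar>"
          using powr_diff_ge_of_exponent_le_one[of r "X x" "X y"] powr_diff_ge_of_exponent_le_one[of r "X y" "X x"]
            X[OF xy(1)] X[OF xy(2)] r
          by (cases "X x \<le> X y") auto
        then show ?thesis
          unfolding quarter_circle_pnorm[OF r0] X_def[symmetric] using r0 by (simp add: pos_divide_le_eq mult.commute)
      qed
      finally have dq: "(s / 4) powr (r - 1) * (v b1 - \<epsilon>' * w) \<le> \<bar>?q (?N x) - ?q (?N y)\<bar>"
        using r0 by simp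
      \<comment> \<open>Either the long increment dominates, and half of it survives in the height
        difference, or it is so small that the left side is not positive.\<close>
      have key: "h * (a * v b1 powr r - d * W) \<le> \<bar>?q (?N x) - ?q (?N y)\<bar> powr r"
      proof (cases "2 * \<epsilon>' * w \<le> v b1")
        case True
        have "(s / 4) powr (r - 1) * (v b1 / 2) \<le> (s / 4) powr (r - 1) * (v b1 - \<epsilon>' * w)"
          using True by (intro mult_left_mono) auto
        then have "((s / 4) powr (r - 1) * (v b1 / 2)) powr r \<le> \<bar>?q (?N x) - ?q (?N y)\<bar> powr r"
          using dq r0 v0[of b1] by (intro powr_mono2) auto
        moreover have "((s / 4) powr (r - 1) * (v b1 / 2)) powr r = h * (a * v b1 powr r)"
          using v0[of b1] by (simp add: h_def a_def powr_mult powr_divide)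
        moreover have "h * (a * v b1 powr r - d * W) \<le> h * (a * v b1 powr r)"
          using h d0 W0 by (intro mult_left_mono) auto
        ultimately show ?thesis by linarith
      next
        case False
        then have "v b1 powr r \<le> (2 * \<epsilon>' * w) powr r" using v0[of b1] r0 by (intro powr_mono2) auto
        then have "a * v b1 powr r \<le> a * (2 * \<epsilon>' * w) powr r" using a by (intro mult_left_mono) auto
        also have "\<dots> = \<epsilon>' powr r * w powr r"
          using \<epsilon>' w0 by (simp add: a_def powr_mult powr_divide)
        also have "\<dots> \<le> \<epsilon>' powr r * (?k powr r * W)" by (intro mult_left_mono wW) auto
        also have "\<dots> = d * W" using \<epsilon>' by (simp add: d_def powr_mult)
        finally have "h * (a * v b1 powr r - d * W) \<le> 0" using h by (simp add: mult_le_0_iff)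
        then show ?thesis by (smt (verit) powr_ge_zero)
      qed
      have "pnorm (ereal r) (L (graph_map r x) - L (graph_map r y)) powr r = \<alpha> powr r * v b1 powr r + \<gamma> powr r * W"
      proof -
        have "\<bar>(L (graph_map r x) - L (graph_map r y)) \<bullet> b\<bar> = (if b = b1 then \<alpha> else \<gamma>) * v b" if "b \<in> Basis" for b
          using that \<alpha>(1) \<gamma>(1) unfolding inner_diff_left L[OF that] v_def graph_map_def fst_conv
          by (auto simp: abs_mult right_diff_distrib[symmetric])
        then have "pnorm (ereal r) (L (graph_map r x) - L (graph_map r y)) powr r =
            (\<Sum>b\<in>Basis. ((if b = b1 then \<alpha> else \<gamma>) * v b) powr r)"
          using r0 by (simp add: pnorm_powr)
        also have "\<dots> = \<alpha> powr r * v b1 powr r + (\<Sum>b\<in>?R. \<gamma> powr r * v b powr r)"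
          using \<alpha>(1) \<gamma>(1) v0 by (simp add: split powr_mult)
        finally show ?thesis by (simp add: W_def sum_distrib_left)
      qed
      also have "\<dots> = v b1 powr r + W + h * (a * v b1 powr r - d * W)"
        by (simp add: \<alpha> \<gamma> algebra_simps)
      also have "\<dots> \<le> v b1 powr r + W + \<bar>?q (?N x) - ?q (?N y)\<bar> powr r" using key by simp
      also have "\<dots> = pnorm (ereal r) (graph_map r x - graph_map r y) powr r"
        using r0 by (simp add: graph_map_def pnorm_Pair_powr pnorm_powr[of r "x - y"] split inner_diff_left v_def W_def)
      finally show ?thesis using r0 by (simp add: pnorm_powr_le_iff)
    qed
    have Z'L: "Z' \<subseteq> L ` graph_map r ` Z"
    proof
      fix x assume "x \<in> Z'"
      then have x: "\<alpha> * (s / 4) \<le> x \<bullet> b1" "x \<bullet> b1 \<le> \<alpha> * (s / 2)"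
        "\<And>b. b \<in> ?R \<Longrightarrow> 0 \<le> x \<bullet> b \<and> x \<bullet> b \<le> \<gamma> * (\<epsilon> * s)"
        unfolding Z'_def box by auto
      define z where "z = (\<Sum>b\<in>Basis. ((x \<bullet> b) / (if b = b1 then \<alpha> else \<gamma>)) *\<^sub>R b)"
      have zb: "z \<bullet> b = (x \<bullet> b) / (if b = b1 then \<alpha> else \<gamma>)" if "b \<in> Basis" for b
        using that by (simp add: z_def)
      have "s / 4 \<le> z \<bullet> b1" "z \<bullet> b1 \<le> s / 2"
        using x(1,2) \<alpha>(1) by (simp_all add: zb[OF b1] field_simps)
      moreover have "0 \<le> z \<bullet> b \<and> z \<bullet> b \<le> \<epsilon> * s" if "b \<in> ?R" for b
        using x(3)[OF that] that \<gamma>(1) by (simp add: zb field_simps)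
      ultimately have "z \<in> Z" unfolding Z by blast
      moreover have "x = L (graph_map r z)"
        by (rule euclidean_eqI) (use \<alpha>(1) \<gamma>(1) in \<open>auto simp: L zb graph_map_def\<close>)
      ultimately show "x \<in> L ` graph_map r ` Z" by blast
    qed
    let ?H = "hausdorff_measure (pdist (ereal r)) ?k :: ('a \<times> real) set \<Rightarrow> ennreal"
    let ?H' = "hausdorff_measure (pdist (ereal r)) ?k :: 'a set \<Rightarrow> ennreal"
    define u where "u = s / 4 * (\<epsilon> * s) ^ (?k - 1)"
    define u' where "u' = \<alpha> * (s / 4) * (\<gamma> * (\<epsilon> * s)) ^ (?k - 1)"
    have u0: "0 \<le> u" "0 \<le> u'" using s \<epsilon> \<alpha>(1) \<gamma>(1) by (auto simp: u_def u'_def)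
    have volZ: "emeasure lborel Z = ennreal u"
      unfolding Z_def u_def using s \<epsilon> by (subst box_vol) (auto simp: field_simps)
    have volZ': "emeasure lborel Z' = ennreal u'"
      unfolding Z'_def u'_def using s \<epsilon> \<alpha>(1) \<gamma>(1) by (subst box_vol) (auto simp: field_simps)
    have in_box: "ennreal (\<kappa> * u') \<le> ?H (graph_map r ` Z)"
    proof -
      have "Z' \<in> sets borel" by (simp add: Z'_def)
      then have "ennreal (\<kappa> * u') = ?H' Z'"
        using \<kappa> u0 by (simp add: H\<kappa> volZ' ennreal_mult)
      also have "\<dots> \<le> ?H' (L ` graph_map r ` Z)" by (rule hausdorff_measure_subset[OF Z'L])
      also have "\<dots> \<le> ennreal 1 ^ ?k * ?H (graph_map r ` Z)"
        using lip by (intro hausdorff_measure_Lipschitz_image) auto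
      finally show ?thesis by simp
    qed
    \<comment> \<open>Away from the box the plain projection to the base is good enough.\<close>
    have out_box: "ennreal (\<kappa> * (s ^ ?k * \<beta> - u)) \<le> ?H (graph_map r ` (?B s - Z))"
    proof -
      have Zb: "Z \<in> sets borel" "?B s \<in> sets borel" by (auto simp: Z_def orthant_ball_borel r0)
      have volB: "emeasure lborel (?B s) = ennreal (s ^ ?k * \<beta>)"
        using s \<beta> by (simp add: emeasure_orthant_ball[OF p] B\<beta> ennreal_mult)
      have "emeasure lborel (?B s - Z) = emeasure lborel (?B s) - emeasure lborel Z"
        using Zb ZB volZ by (intro emeasure_Diff) auto
      also have "\<dots> = ennreal (s ^ ?k * \<beta> - u)"
        unfolding volB volZ using u0 by (simp add: ennreal_minus)
      finally have "?H' (?B s - Z) = ennreal (\<kappa> * (s ^ ?k * \<beta> - u))"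
        using Zb \<kappa> by (simp add: H\<kappa> ennreal_mult')
      then show ?thesis using area_ge_projection[OF p, of ?k "?B s - Z"] by simp
    qed
    \<comment> \<open>Continuity makes the piece over the box compact, hence closed, and this
      permits adding the measures of the two pieces of the graph.\<close>
    have cont: "continuous_on Z (graph_map r)"
    proof -
      have "continuous_on Z (\<lambda>z. quarter_circle r (?N z))"
        by (rule continuous_on_compose2[OF continuous_on_quarter_circle[OF r0] continuous_on_pnorm[OF p]])
           (use ZB s in \<open>auto simp: orthant_ball_def pnorm_nonneg\<close>)
      then show ?thesis unfolding graph_map_def[abs_def] by (intro continuous_intros)
    qed
    have "closed (graph_map r ` Z)"
      by (intro compact_imp_closed compact_continuous_image cont) (simp add: Z_def)
    then have "?H (graph_map r ` ?B s \<inter> graph_map r ` Z) + ?H (graph_map r ` ?B s - graph_map r ` Z) \<le> ?H (graph_map r ` ?B s)"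
      by (rule hausdorff_measure_closed_split[OF controls_dist_pnorm[OF p]])
    moreover have "graph_map r ` ?B s \<inter> graph_map r ` Z = graph_map r ` Z" using ZB by auto
    moreover have "graph_map r ` ?B s - graph_map r ` Z = graph_map r ` (?B s - Z)"
      by (auto simp: graph_map_def)
    ultimately have total: "?H (graph_map r ` Z) + ?H (graph_map r ` (?B s - Z)) \<le> ?H (graph_map r ` ?B s)" by simp
    \<comment> \<open>By Bernoulli's inequality and k d \<le> a / 4, half of the stretch a h
      survives the k - 1 contractions.\<close>
    have gain: "1 + a / 6 * h \<le> \<alpha> * \<gamma> ^ (?k - 1)"
    proof -
      have ah: "0 \<le> a * h" "a * h \<le> 1" using a h by (auto simp: mult_le_one)
      have "1 + a * h / 2 \<le> (1 + a * h) * (1 - ?k * d * h)"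
      proof -
        have "?k * d * h * (1 + a * h) \<le> (a / 4 * h) * (1 + 1)"
          using kd a h d0 ah by (intro mult_mono add_mono mult_right_mono) auto
        then show ?thesis by (simp add: algebra_simps)
      qed
      also have "\<dots> \<le> (1 + a * h) * (1 - d * h) ^ (?k - 1)"
      proof (intro mult_left_mono)
        have "real (?k - 1) * (d * h) \<le> ?k * (d * h)" using d0 h by (intro mult_right_mono) auto
        then have "1 - ?k * d * h \<le> 1 + real (?k - 1) * (- (d * h))" by (simp add: mult.assoc)
        also have "\<dots> \<le> (1 + - (d * h)) ^ (?k - 1)" using dh1 by (intro Bernoulli_inequality) simp
        finally show "1 - ?k * d * h \<le> (1 - d * h) ^ (?k - 1)" by simp
      qed (use ah in auto)
      also have "\<dots> = (\<alpha> * \<gamma> ^ (?k - 1)) powr r"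
      proof -
        have "(\<gamma> ^ (?k - 1)) powr r = (\<gamma> powr r) ^ (?k - 1)"
          using \<gamma>(1) by (simp add: powr_powr mult.commute flip: powr_realpow)
        then show ?thesis using \<alpha> \<gamma> by (simp add: powr_mult)
      qed
      finally have ge: "1 + a * h / 2 \<le> (\<alpha> * \<gamma> ^ (?k - 1)) powr r" .
      \<comment> \<open>Here r < 2 enters. Instead of extracting an r-th root, 1 + a h / 6 is
        squared, and the square stays below 1 + a h / 2.\<close>
      have "(1 + a / 6 * h) powr r \<le> (1 + a / 6 * h) powr 2" using a h r2 by (intro powr_mono) auto
      also have "\<dots> = 1 + a * h / 3 + (a * h) * (a * h) / 36"
        using a h ah by (simp add: power2_eq_square algebra_simps)
      also have "\<dots> \<le> 1 + a * h / 2"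
        using mult_left_mono[OF ah(2,1)] ah by linarith
      finally have "(1 + a / 6 * h) powr r \<le> (\<alpha> * \<gamma> ^ (?k - 1)) powr r" using ge by linarith
      moreover have "0 \<le> \<alpha> * \<gamma> ^ (?k - 1)" using \<alpha>(1) \<gamma>(1) by simp
      ultimately show ?thesis
        using powr_less_mono2[of r "\<alpha> * \<gamma> ^ (?k - 1)" "1 + a / 6 * h"] r0 by force
    qed
    have sk: "s ^ ?k = s * s ^ (?k - 1)" using power_Suc[of s "?k - 1"] by simp
    have "s ^ ?k * (\<beta> + c * s powr (r * (r - 1))) = s ^ ?k * \<beta> + u * (a / 6 * h)"
      by (simp add: c_def h_eq u_def power_mult_distrib sk algebra_simps)
    also have "\<dots> \<le> s ^ ?k * \<beta> + u * (\<alpha> * \<gamma> ^ (?k - 1) - 1)"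
      using gain u0 by (intro add_left_mono mult_left_mono) auto
    also have "\<dots> = u' + (s ^ ?k * \<beta> - u)"
    proof -
      have "u' = u * (\<alpha> * \<gamma> ^ (?k - 1))" by (simp add: u_def u'_def power_mult_distrib)
      then show ?thesis by (simp add: algebra_simps)
    qed
    finally have "\<kappa> * (s ^ ?k * (\<beta> + c * s powr (r * (r - 1)))) \<le> \<kappa> * u' + \<kappa> * (s ^ ?k * \<beta> - u)"
      using \<kappa> by (simp add: distrib_left[symmetric])
    then have "ennreal (\<kappa> * (s ^ ?k * (\<beta> + c * s powr (r * (r - 1))))) \<le> ennreal (\<kappa> * u' + \<kappa> * (s ^ ?k * \<beta> - u))"
      by (rule ennreal_leI)
    also have "\<dots> \<le> ennreal (\<kappa> * u') + ennreal (\<kappa> * (s ^ ?k * \<beta> - u))"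
      using u0 \<kappa> by (intro ennreal_add_le) simp
    also have "\<dots> \<le> ?H (graph_map r ` Z) + ?H (graph_map r ` (?B s - Z))"
      by (intro add_mono in_box out_box)
    also have "\<dots> \<le> ?H (graph_map r ` ?B s)" by (rule total)
    finally show "ennreal (\<kappa> * (s ^ ?k * (\<beta> + c * s powr (r * (r - 1))))) \<le> ?H (graph_map r ` ?B s)" .
  qed
qed

end

text \<open>After division by s^k, area and volume become functions of s whose expansions at 0
  involve incompatible powers. Each case ends in a positive constant bounded by a multiple of a
  positive power of s.\<close>

lemma area_not_proportional_to_volume:
  assumes r: "0 < r" "r \<noteq> 1" "r \<noteq> 2" and l: "0 < l"
    and H: "\<And>s. 0 < s \<Longrightarrow> s \<le> 1 \<Longrightarrow>
      hausdorff_measure (pdist (ereal r)) DIM('a) (graph_map r ` (orthant_ball (ereal r) s :: 'a::euclidean_space set)) =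
      ennreal (l * (s ^ DIM('a) * cone_density TYPE('a) r s))"
  shows False
proof (cases "r < 1")
  case True
  obtain c s0 where c: "0 < c" "0 < s0" "s0 \<le> 1"
    "\<And>s. 0 < s \<Longrightarrow> s \<le> s0 \<Longrightarrow> ennreal (c * s ^ (DIM('a) - 1) * s powr r) \<le>
       hausdorff_measure (pdist (ereal r)) DIM('a) (graph_map r ` (orthant_ball (ereal r) s :: 'a set))"
    using area_lower_exponent_lt_one[OF r(1) True] by metis
  obtain C where C: "\<And>s. 0 < s \<Longrightarrow> s \<le> 1 \<Longrightarrow> cone_density TYPE('a) r s \<le> C"
    using cone_density_upper[OF r(1)] by metis
  show False
  proof (rule powr_small_contradiction)
    show "0 < 1 - r" "0 < c" "0 < s0" using True c by auto
    fix s :: real assume s: "0 < s" "s \<le> s0"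
    have s1: "s \<le> 1" using s c by simp
    let ?v = "cone_density TYPE('a) r s"
    have lhs: "0 < c * s ^ (DIM('a) - 1) * s powr r" using c s by simp
    have "ennreal (c * s ^ (DIM('a) - 1) * s powr r) \<le> ennreal (l * (s ^ DIM('a) * ?v))"
      using c(4)[OF s] H[OF s(1) s1] by simp
    then have "c * s ^ (DIM('a) - 1) * s powr r \<le> l * (s ^ DIM('a) * ?v)"
      using lhs by (simp add: ennreal_le_iff2)
    also have "\<dots> \<le> l * (s ^ DIM('a) * C)"
      using l s C[OF s(1) s1] by (intro mult_left_mono) auto
    also have "\<dots> = s ^ (DIM('a) - 1) * (l * C * s)"
      using power_Suc[of s "DIM('a) - 1"] by simp
    finally have "s ^ (DIM('a) - 1) * (c * s powr r) \<le> s ^ (DIM('a) - 1) * (l * C * s)"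
      by (simp add: mult_ac)
    then have "c * s powr r \<le> l * C * s" using s by simp
    then have "c * s powr r * s powr (- r) \<le> l * C * s * s powr (- r)" by (intro mult_right_mono) auto
    then show "c \<le> l * C * s powr (1 - r)"
      using s by (simp add: mult.assoc powr_mult_base flip: powr_add)
  qed
next
  case False
  then have r1: "1 < r" using r by simp
  then have p: "0 < ereal r" by simp
  obtain \<kappa> where \<kappa>: "0 < \<kappa>" "\<And>A. (A :: 'a set) \<in> sets borel \<Longrightarrow>
      hausdorff_measure (pdist (ereal r)) DIM('a) A = ennreal \<kappa> * emeasure lborel A"
    using hausdorff_measure_eq_lborel[OF p] by metis
  define \<beta> where "\<beta> = measure lborel (orthant_ball (ereal r) 1 :: 'a set)"
  have \<beta>: "0 \<le> \<beta>" "emeasure lborel (orthant_ball (ereal r) 1 :: 'a set) = ennreal \<beta>"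
    using emeasure_orthant_ball_finite[OF p, where s = 1 and 'a = 'a]
    by (simp_all add: \<beta>_def emeasure_eq_ennreal_measure less_top[symmetric])
  let ?k = "DIM('a)" and ?v = "cone_density TYPE('a) r"
  let ?H = "\<lambda>s. hausdorff_measure (pdist (ereal r)) ?k (graph_map r ` (orthant_ball (ereal r) s :: 'a set))"
  obtain V0 c0 c1 where V: "0 < c1"
    "\<And>s. 0 < s \<Longrightarrow> s < 1 \<Longrightarrow> V0 + c1 * s powr r \<le> ?v s"
    "\<And>s. 0 < s \<Longrightarrow> s < 1 \<Longrightarrow> ?v s \<le> V0 + c0 * s powr r"
    using cone_density_expansion[OF r1] by metis
  obtain C s0 where C: "0 \<le> C" "0 < s0" "s0 \<le> 1"
    "\<And>s. 0 < s \<Longrightarrow> s \<le> s0 \<Longrightarrow> ?H s \<le> ennreal (\<kappa> * (s ^ ?k * \<beta>) * (1 + C * s powr (r * (r - 1))))"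
    using area_upper[OF r1 \<kappa>(1) \<beta>(1) \<kappa>(2) \<beta>(2)] by metis
  have v_nonneg: "0 \<le> ?v s" if "0 < s" "s \<le> 1" for s
    unfolding cone_density_def using cone_integrand_bounds(1)[OF r(1) that]
    by (intro integral_nonneg_AE) (auto simp: indicator_def)
  have lower: "\<kappa> * x \<le> l * ?v s" if le: "ennreal (\<kappa> * (s ^ ?k * x)) \<le> ?H s" and s: "0 < s" "s \<le> 1" for x s
  proof -
    have "\<kappa> * (s ^ ?k * x) \<le> l * (s ^ ?k * ?v s)"
      using le l s v_nonneg[OF s] unfolding H[OF s] by (subst (asm) ennreal_le_iff) auto
    then have "s ^ ?k * (\<kappa> * x) \<le> s ^ ?k * (l * ?v s)" by (simp add: mult_ac)
    then show ?thesis using s by simp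
  qed
  have upper: "l * ?v s \<le> \<kappa> * \<beta> + \<kappa> * \<beta> * C * s powr (r * (r - 1))" if s: "0 < s" "s \<le> s0" for s
  proof -
    have s1: "s \<le> 1" using s C by simp
    have "l * (s ^ ?k * ?v s) \<le> \<kappa> * (s ^ ?k * \<beta>) * (1 + C * s powr (r * (r - 1)))"
      using C(4)[OF s] \<kappa> \<beta> C(1) s unfolding H[OF s(1) s1] by (subst (asm) ennreal_le_iff) auto
    then have "s ^ ?k * (l * ?v s) \<le> s ^ ?k * (\<kappa> * \<beta> * (1 + C * s powr (r * (r - 1))))"
      by (simp add: mult_ac)
    then have "l * ?v s \<le> \<kappa> * \<beta> * (1 + C * s powr (r * (r - 1)))" using s by simp
    then show ?thesis by (simp add: algebra_simps)
  qed
  define s1 where "s1 = min s0 (1 / 2)"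
  have s1: "0 < s1" "s1 \<le> s0" "s1 < 1" using C by (auto simp: s1_def)
  have divide: "s powr a * s powr (- b) = s powr (a - b)" for s a b :: real by (simp flip: powr_add)
  show False
  proof (cases "r < 2")
    case True
    obtain c where c: "0 < c" "\<And>s. 0 < s \<Longrightarrow> s \<le> 1 \<Longrightarrow>
       ennreal (\<kappa> * (s ^ ?k * (\<beta> + c * s powr (r * (r - 1))))) \<le> ?H s"
      using area_lower_exponent_lt_two[OF r1 \<kappa>(1) \<beta>(1) \<kappa>(2) \<beta>(2) True] by metis
    \<comment> \<open>If the leading coefficient of the volume were larger, the gap would be bounded
      by the area correction, which tends to 0. In this direction the inequality lets both
      coefficients be dropped when the area correction is bounded by that of the volume.\<close>
    have limit: "l * V0 \<le> \<kappa> * \<beta>"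
    proof (rule ccontr)
      assume "\<not> ?thesis"
      then have gap: "0 < l * V0 - \<kappa> * \<beta>" by simp
      show False
      proof (rule powr_small_contradiction[of "r * (r - 1)" _ s1 "\<kappa> * \<beta> * C"])
        show "0 < r * (r - 1)" using r1 by simp
        fix s assume s: "0 < s" "s \<le> s1"
        have "l * (V0 + c1 * s powr r) \<le> l * ?v s"
          using V(2)[of s] s s1 l by (intro mult_left_mono) auto
        moreover have "0 \<le> l * (c1 * s powr r)" using l V(1) by simp
        ultimately show "l * V0 - \<kappa> * \<beta> \<le> \<kappa> * \<beta> * C * s powr (r * (r - 1))"
          using upper[of s] s s1 by (simp add: algebra_simps)
      qed (use gap s1 in auto)
    qed
    show False
    proof (rule powr_small_contradiction[of "r - r * (r - 1)" "\<kappa> * c" s1 "l * c0"])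
      have "r * (r - 1) < r * 1" using True r by (intro mult_strict_left_mono) auto
      then show "0 < r - r * (r - 1)" by simp
      show "0 < \<kappa> * c" using \<kappa> c by simp
      fix s assume s: "0 < s" "s \<le> s1"
      have "\<kappa> * (\<beta> + c * s powr (r * (r - 1))) \<le> l * ?v s"
        using s s1 C by (intro lower c) auto
      also have "\<dots> \<le> l * (V0 + c0 * s powr r)"
        using V(3)[of s] s s1 l by (intro mult_left_mono) auto
      finally have "\<kappa> * c * s powr (r * (r - 1)) \<le> l * c0 * s powr r"
        using limit by (simp add: algebra_simps)
      then have "\<kappa> * c * s powr (r * (r - 1)) * s powr (- (r * (r - 1))) \<le> l * c0 * s powr r * s powr (- (r * (r - 1)))"
        by (rule mult_right_mono) simp
      then show "\<kappa> * c \<le> l * c0 * s powr (r - r * (r - 1))"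
        unfolding mult.assoc divide using s by simp
    qed (rule s1)
  next
    case False
    then have r2: "2 < r" using r by simp
    have proj: "\<kappa> * \<beta> \<le> l * ?v s" if "0 < s" "s \<le> 1" for s
    proof (rule lower[OF _ that])
      show "ennreal (\<kappa> * (s ^ ?k * \<beta>)) \<le> ?H s"
        by (rule order_trans[OF eq_refl area_ge_projection[OF p]])
           (rule hausdorff_measure_orthant_ball[OF r1 \<kappa>(1) \<beta>(1) \<kappa>(2) \<beta>(2) that(1), symmetric])
    qed
    \<comment> \<open>Opposite to the case r < 2, since the volume correction is now the dominant
      one and has to be bounded by that of the area.\<close>
    have limit: "\<kappa> * \<beta> \<le> l * V0"
    proof (rule ccontr)
      assume "\<not> ?thesis"
      then have gap: "0 < \<kappa> * \<beta> - l * V0" by simp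
      show False
      proof (rule powr_small_contradiction[of r _ s1 "l * c0"])
        fix s assume s: "0 < s" "s \<le> s1"
        have "l * ?v s \<le> l * (V0 + c0 * s powr r)"
          using V(3)[of s] s s1 l by (intro mult_left_mono) auto
        then show "\<kappa> * \<beta> - l * V0 \<le> l * c0 * s powr r"
          using proj[of s] s s1 by (simp add: algebra_simps)
      qed (use gap s1 r in auto)
    qed
    show False
    proof (rule powr_small_contradiction[of "r * (r - 1) - r" "l * c1" s1 "\<kappa> * \<beta> * C"])
      have "r * 1 < r * (r - 1)" using r2 by (intro mult_strict_left_mono) auto
      then show "0 < r * (r - 1) - r" by simp
      show "0 < l * c1" using l V by simp
      fix s assume s: "0 < s" "s \<le> s1"
      have "l * (V0 + c1 * s powr r) \<le> l * ?v s"
        using V(2)[of s] s s1 l by (intro mult_left_mono) auto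
      then have "l * c1 * s powr r \<le> \<kappa> * \<beta> * C * s powr (r * (r - 1))"
        using upper[of s] s s1 limit by (simp add: algebra_simps)
      then have "l * c1 * s powr r * s powr (- r) \<le> \<kappa> * \<beta> * C * s powr (r * (r - 1)) * s powr (- r)"
        by (rule mult_right_mono) simp
      then show "l * c1 \<le> \<kappa> * \<beta> * C * s powr (r * (r - 1) - r)"
        unfolding mult.assoc divide using s by simp
    qed (rule s1)
  qed
qed

subsection \<open>The sphere: uniformly distributed measures\<close>

text \<open>The quantity N(U \<inter> ball x r) is integrated over x with respect to M. Fubini's
  theorem gives g(r) N(U), while the integrand is h(r) wherever the whole ball lies in U. The
  quotient of g and h is eliminated by the same computation for the whole space.\<close>

lemma uniformly_distributed_open_le:
  fixes M N :: "'b::euclidean_space measure"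
  assumes fM: "finite_measure M" and fN: "finite_measure N"
    and sM[measurable_cong]: "sets M = sets borel" and sN[measurable_cong]: "sets N = sets borel"
    and S[measurable]: "S \<in> sets borel" and M0: "emeasure M (- S) = 0" and N0: "emeasure N (- S) = 0"
    and g: "\<And>x r. x \<in> S \<Longrightarrow> 0 < r \<Longrightarrow> emeasure M (ball x r) = g r"
    and h: "\<And>x r. x \<in> S \<Longrightarrow> 0 < r \<Longrightarrow> emeasure N (ball x r) = h r"
    and h_pos: "\<And>r. 0 < r \<Longrightarrow> 0 < h r" and ne: "S \<noteq> {}"
    and U: "open U"
  shows "emeasure N UNIV * emeasure M U \<le> emeasure M UNIV * emeasure N U"
proof -
  interpret M: finite_measure M by (rule fM)
  interpret N: finite_measure N by (rule fN)
  interpret pair_sigma_finite M N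
    by (intro pair_sigma_finite.intro M.sigma_finite_measure_axioms N.sigma_finite_measure_axioms)
  have [simp]: "space M = UNIV" "space N = UNIV"
    using sets_eq_imp_space_eq[OF sM] sets_eq_imp_space_eq[OF sN] by auto
  have aeM: "AE x in M. x \<in> S" and aeN: "AE x in N. x \<in> S"
    using M0 N0 by (auto intro!: AE_I[of _ _ "- S"] simp: sM sN)
  \<comment> \<open>The relation of being at distance less than r is symmetric, and almost every y
    lies in S, where a ball has M-measure g(r).\<close>
  have swap: "(\<integral>\<^sup>+x. emeasure N (W \<inter> ball x r) \<partial>M) = g r * emeasure N W"
    if W[measurable]: "W \<in> sets borel" and r: "0 < r" for W r
  proof -
    have "(\<integral>\<^sup>+x. emeasure N (W \<inter> ball x r) \<partial>M) =
        (\<integral>\<^sup>+x. \<integral>\<^sup>+y. indicator W y * indicator {0..<r} (dist x y) \<partial>N \<partial>M)"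
    proof (rule nn_integral_cong)
      fix x
      have "emeasure N (W \<inter> ball x r) = (\<integral>\<^sup>+y. indicator (W \<inter> ball x r) y \<partial>N)"
        using W by (intro nn_integral_indicator[symmetric]) (simp add: sN)
      also have "\<dots> = (\<integral>\<^sup>+y. indicator W y * indicator {0..<r} (dist x y) \<partial>N)"
        by (intro nn_integral_cong) (auto simp: indicator_def)
      finally show "emeasure N (W \<inter> ball x r) = (\<integral>\<^sup>+y. indicator W y * indicator {0..<r} (dist x y) \<partial>N)" .
    qed
    also have "\<dots> = (\<integral>\<^sup>+y. \<integral>\<^sup>+x. indicator W y * indicator {0..<r} (dist x y) \<partial>M \<partial>N)"
      by (intro Fubini'[symmetric]) measurable
    also have "\<dots> = (\<integral>\<^sup>+y. indicator W y * g r \<partial>N)"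
    proof (rule nn_integral_cong_AE, use aeN in eventually_elim)
      fix y assume y: "y \<in> S"
      have "(\<integral>\<^sup>+x. indicator W y * indicator {0..<r} (dist x y) \<partial>M) = (\<integral>\<^sup>+x. indicator W y * indicator (ball y r) x \<partial>M)"
        by (intro nn_integral_cong) (auto simp: indicator_def dist_commute)
      also have "\<dots> = indicator W y * emeasure M (ball y r)"
        by (subst nn_integral_cmult_indicator) (auto simp: sM)
      finally show "(\<integral>\<^sup>+x. indicator W y * indicator {0..<r} (dist x y) \<partial>M) = indicator W y * g r"
        using g[OF y r] by simp
    qed
    also have "\<dots> = g r * emeasure N W"
      using W by (subst nn_integral_multc) (auto simp: sN mult.commute)
    finally show ?thesis .
  qed
  have total: "h r * emeasure M UNIV = g r * emeasure N UNIV" if r: "0 < r" for r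
  proof -
    have "g r * emeasure N UNIV = (\<integral>\<^sup>+x. emeasure N (UNIV \<inter> ball x r) \<partial>M)"
      using r by (intro swap[symmetric]) auto
    also have "\<dots> = (\<integral>\<^sup>+x. h r \<partial>M)"
      by (rule nn_integral_cong_AE, use aeM in eventually_elim) (use h r in auto)
    finally show ?thesis by simp
  qed
  have h_fin: "h r < top" if "0 < r" for r
    using h[of _ r] ne that N.emeasure_finite by (metis ex_in_conv less_top)
  \<comment> \<open>These sets of points well inside U increase to U because U is open; on each of
    them one fixed radius works.\<close>
  define V where "V n = {x. ball x (1 / real (Suc n)) \<subseteq> U}" for n
  have V_eq: "V n = - (\<Union>y\<in>- U. ball y (1 / real (Suc n)))" for n
    by (auto simp: V_def subset_iff dist_commute)
  have V_borel[measurable]: "V n \<in> sets borel" for n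
    unfolding V_eq by (intro borel_closed closed_Compl open_UN) auto
  have V_le: "emeasure N UNIV * emeasure M (V n) \<le> emeasure M UNIV * emeasure N U" for n
  proof -
    let ?r = "1 / real (Suc n)"
    have r: "0 < ?r" by simp
    have "h ?r * emeasure M (V n) = (\<integral>\<^sup>+x. h ?r * indicator (V n) x \<partial>M)"
      by (subst nn_integral_cmult_indicator) (auto simp: sM)
    also have "\<dots> \<le> (\<integral>\<^sup>+x. emeasure N (U \<inter> ball x ?r) \<partial>M)"
    proof (rule nn_integral_mono_AE, use aeM in eventually_elim)
      fix x assume x: "x \<in> S"
      show "h ?r * indicator (V n) x \<le> emeasure N (U \<inter> ball x ?r)"
      proof (cases "x \<in> V n")
        case True
        then have "U \<inter> ball x ?r = ball x ?r" by (auto simp: V_def)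
        then show ?thesis using h[OF x r] True by simp
      qed simp
    qed
    also have "\<dots> = g ?r * emeasure N U" using U r by (intro swap) auto
    finally have "emeasure N UNIV * (h ?r * emeasure M (V n)) \<le> emeasure N UNIV * (g ?r * emeasure N U)"
      by (rule mult_left_mono) simp
    then have "h ?r * (emeasure N UNIV * emeasure M (V n)) \<le> (g ?r * emeasure N UNIV) * emeasure N U"
      by (simp add: mult_ac)
    also have "\<dots> = h ?r * (emeasure M UNIV * emeasure N U)"
      unfolding total[OF r, symmetric] by (simp add: mult_ac)
    finally show ?thesis
      using h_pos[OF r] h_fin[OF r] by (subst (asm) ennreal_mult_le_mult_iff) auto
  qed
  have inc: "incseq V"
  proof (rule incseq_SucI)
    fix n
    have "1 / real (Suc (Suc n)) \<le> 1 / real (Suc n)" by (intro divide_left_mono) auto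
    then have "ball x (1 / real (Suc (Suc n))) \<subseteq> ball x (1 / real (Suc n))" for x :: 'b
      by (rule subset_ball)
    then show "V n \<subseteq> V (Suc n)" unfolding V_def by blast
  qed
  have UV: "(\<Union>n. V n) = U"
  proof
    show "(\<Union>n. V n) \<subseteq> U" by (force simp: V_def)
    show "U \<subseteq> (\<Union>n. V n)"
    proof
      fix x assume "x \<in> U"
      then obtain e where e: "0 < e" "ball x e \<subseteq> U" using U open_contains_ball by blast
      obtain n where "1 / real (Suc n) < e" using e nat_approx_posE by (metis of_nat_Suc)
      then have "ball x (1 / real (Suc n)) \<subseteq> U" using e by (meson order_trans less_imp_le subset_ball)
      then show "x \<in> (\<Union>n. V n)" by (auto simp: V_def)
    qed
  qed
  have "emeasure N UNIV * emeasure M U = emeasure N UNIV * (SUP n. emeasure M (V n))"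
    using SUP_emeasure_incseq[OF _ inc, of M] by (auto simp: sM UV image_subset_iff)
  also have "\<dots> = (SUP n. emeasure N UNIV * emeasure M (V n))" by (rule SUP_mult_left_ennreal)
  also have "\<dots> \<le> emeasure M UNIV * emeasure N U" by (intro SUP_least V_le)
  finally show ?thesis .
qed

text \<open>The inequality for the open complement holds with M and N in either role; finiteness
  transfers the equality to the closed set.\<close>

lemma uniformly_distributed_closed_eq:
  fixes M N :: "'b::euclidean_space measure"
  assumes fM: "finite_measure M" and fN: "finite_measure N"
    and sM: "sets M = sets borel" and sN: "sets N = sets borel"
    and S: "S \<in> sets borel" and M0: "emeasure M (- S) = 0" and N0: "emeasure N (- S) = 0"
    and g: "\<And>x r. x \<in> S \<Longrightarrow> 0 < r \<Longrightarrow> emeasure M (ball x r) = g r"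
    and h: "\<And>x r. x \<in> S \<Longrightarrow> 0 < r \<Longrightarrow> emeasure N (ball x r) = h r"
    and g_pos: "\<And>r. 0 < r \<Longrightarrow> 0 < g r" and h_pos: "\<And>r. 0 < r \<Longrightarrow> 0 < h r" and ne: "S \<noteq> {}"
    and A: "closed A"
  shows "measure N UNIV * measure M A = measure M UNIV * measure N A"
proof -
  interpret M: finite_measure M by (rule fM)
  interpret N: finite_measure N by (rule fN)
  have sp: "space M = UNIV" "space N = UNIV"
    using sets_eq_imp_space_eq[OF sM] sets_eq_imp_space_eq[OF sN] by auto
  have A': "A \<in> sets M" "A \<in> sets N" using A by (auto simp: sM sN)
  have U: "open (- A)" by (rule open_Compl[OF A])
  have "emeasure N UNIV * emeasure M (- A) = emeasure M UNIV * emeasure N (- A)"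
    by (intro antisym uniformly_distributed_open_le[OF fM fN sM sN S M0 N0 g h h_pos ne U]
        uniformly_distributed_open_le[OF fN fM sN sM S N0 M0 h g g_pos ne U])
  then have "measure N UNIV * measure M (- A) = measure M UNIV * measure N (- A)"
    by (simp add: M.emeasure_eq_measure N.emeasure_eq_measure flip: ennreal_mult)
  moreover have "measure M (- A) = measure M UNIV - measure M A" "measure N (- A) = measure N UNIV - measure N A"
    using M.finite_measure_compl[OF A'(1)] N.finite_measure_compl[OF A'(2)] by (simp_all add: sp Compl_eq_Diff_UNIV)
  ultimately show ?thesis by (simp add: algebra_simps)
qed

lemma emeasure_lborel_open_pos:
  assumes "open X" "X \<noteq> {}"
  shows "0 < emeasure lborel X"
proof (rule ccontr)
  assume "\<not> ?thesis"
  then have "X \<in> null_sets lborel" using assms(1) by (simp add: zero_less_iff_neq_zero null_sets_def)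
  then have "negligible X" by (simp add: negligible_iff_null_sets null_sets_completionI)
  then show False using open_not_negligible assms by blast
qed

text \<open>For u = 0 the quotient is 0 and the map is the identity, so the reflection along x - y
  is also meaningful when x = y.\<close>

definition reflection :: "'b::real_inner \<Rightarrow> 'b \<Rightarrow> 'b" where
  "reflection u x = x - (2 * (x \<bullet> u) / (u \<bullet> u)) *\<^sub>R u"

lemma linear_reflection: "linear (reflection u)"
  by (rule linearI) (auto simp: reflection_def inner_add_left algebra_simps add_divide_distrib)

lemma reflection_reflection [simp]: "reflection u (reflection u x) = x"
  by (cases "u = 0") (auto simp: reflection_def inner_diff_left algebra_simps)

lemma norm_reflection [simp]: "norm (reflection u x) = norm x"
proof (cases "u = 0")
  case False
  then have "reflection u x \<bullet> reflection u x = x \<bullet> x"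
    by (simp add: reflection_def inner_diff_left inner_diff_right inner_commute field_simps)
  then show ?thesis by (simp add: norm_eq_sqrt_inner)
qed (simp add: reflection_def)

lemma dist_reflection [simp]: "dist (reflection u x) (reflection u y) = dist x y"
  by (simp add: dist_norm flip: linear_diff[OF linear_reflection])

text \<open>For points of equal norm the hyperplane orthogonal to x - y through the origin bisects
  the segment between them.\<close>

lemma reflection_swap:
  assumes "norm x = norm y"
  shows "reflection (x - y) x = y"
proof (cases "x = y")
  case False
  have xy: "x \<bullet> x = y \<bullet> y" using assms by (simp add: norm_eq_sqrt_inner)
  have "(x - y) \<bullet> (x - y) = 2 * (x \<bullet> (x - y))"
    by (simp add: inner_diff_left inner_diff_right inner_commute xy)
  moreover have "(x - y) \<bullet> (x - y) \<noteq> 0" using False by simp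
  ultimately show ?thesis by (simp add: reflection_def)
qed (simp add: reflection_def)

lemma reflection_vimage: "reflection u -` A = reflection u ` A"
proof
  show "reflection u -` A \<subseteq> reflection u ` A"
  proof
    fix x assume "x \<in> reflection u -` A"
    then have "reflection u x \<in> A" by simp
    then have "reflection u (reflection u x) \<in> reflection u ` A" by (rule imageI)
    then show "x \<in> reflection u ` A" by simp
  qed
qed auto

lemma borel_measurable_reflection [measurable]:
  "reflection (u :: 'b::euclidean_space) \<in> borel_measurable borel"
  by (intro borel_measurable_continuous_onI linear_continuous_on linear_conv_bounded_linear[THEN iffD1] linear_reflection)

text \<open>The image of Lebesgue measure is again translation invariant, hence a multiple of it.
  The factor is 1 because the unit ball is mapped onto itself.\<close>

lemma emeasure_lborel_reflection:
  fixes A :: "'b::euclidean_space set"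
  assumes A: "A \<in> sets borel"
  shows "emeasure lborel (reflection u ` A) = emeasure lborel A"
proof -
  let ?D = "distr lborel borel (reflection u) :: 'b measure"
  have D: "emeasure ?D X = emeasure lborel (reflection u ` X)" if "X \<in> sets borel" for X
    using that by (simp add: emeasure_distr reflection_vimage)
  have borel_image: "reflection u ` X \<in> sets borel" if "X \<in> sets borel" for X
    using measurable_sets[OF borel_measurable_reflection[of u] that] by (simp add: reflection_vimage)
  have eq: "emeasure ?D X = emeasure ?D (cbox 0 One) * emeasure lborel X" if "X \<in> sets borel" for X
  proof (rule translation_invariant_measure_eq_lborel)
    fix a :: 'b and Y :: "'b set" assume Y: "Y \<in> sets borel"
    have aY: "(+) a ` Y \<in> sets borel"
    proof -
      have "(+) a ` Y = (\<lambda>x. x - a) -` Y \<inter> space borel" by (force simp: image_iff)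
      also have "\<dots> \<in> sets borel" by (rule measurable_sets[OF _ Y]) measurable
      finally show ?thesis .
    qed
    have "reflection u ` (+) a ` Y = (+) (reflection u a) ` reflection u ` Y"
      by (simp add: image_image linear_add[OF linear_reflection])
    moreover have "emeasure lborel ((+) b ` Z) = emeasure lborel Z" if "Z \<in> sets borel" for b :: 'b and Z
    proof -
      have "emeasure lborel ((+) b ` Z) = emeasure (distr lborel borel ((+) b)) ((+) b ` Z)"
        by (simp add: lborel_distr_plus)
      also have "\<dots> = emeasure lborel Z"
      proof (subst emeasure_distr)
        have "(+) b ` Z = (\<lambda>x. x - b) -` Z \<inter> space borel" by (force simp: image_iff)
        also have "\<dots> \<in> sets borel" by (rule measurable_sets[OF _ that]) measurable
        finally show "(+) b ` Z \<in> sets borel" .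
        have "(+) b -` (+) b ` Z = Z" by auto
        then show "emeasure lborel ((+) b -` (+) b ` Z \<inter> space lborel) = emeasure lborel Z" by simp
      qed simp
      finally show ?thesis .
    qed
    ultimately show "emeasure ?D ((+) a ` Y) = emeasure ?D Y"
      using Y aY borel_image by (simp add: D)
  next
    have "bounded (reflection u ` cbox 0 (One::'b))"
      by (intro bounded_linear_image bounded_cbox linear_conv_bounded_linear[THEN iffD1] linear_reflection)
    then show "emeasure ?D (cbox 0 One) < \<infinity>"
      by (subst D) (simp, rule emeasure_bounded_finite)
  qed (use that in simp_all)
  have "reflection u ` ball 0 1 = ball 0 1"
  proof -
    have "reflection u -` ball 0 1 = ball 0 1" by auto
    then show ?thesis by (simp add: reflection_vimage)
  qed
  then have "emeasure lborel (ball 0 1 :: 'b set) = emeasure ?D (cbox 0 One) * emeasure lborel (ball 0 1 :: 'b set)"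
    using eq[of "ball 0 1"] by (simp add: D)
  moreover have "emeasure lborel (ball 0 1 :: 'b set) \<noteq> 0"
    using emeasure_lborel_open_pos[of "ball 0 1 :: 'b set"] by simp
  moreover have "emeasure lborel (ball 0 1 :: 'b set) < top"
    by (rule emeasure_bounded_finite[unfolded infinity_ennreal_def]) simp
  ultimately have "emeasure ?D (cbox 0 One) = 1"
    by (metis ennreal_mult_cancel_left less_irrefl mult.commute mult.right_neutral)
  then show ?thesis using eq[OF A] by (simp add: D[OF A])
qed

section \<open>Hausdorff measure and cone measure on the Euclidean sphere\<close>

lemma pnorm_2: "pnorm (ereal 2) x = norm x"
  by (simp add: pnorm_ereal powr_half_sqrt sum_nonneg euclidean_inner[of x x] norm_eq_sqrt_inner power2_eq_square)

lemma hausdorff_measure_bounded_finite: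
  assumes p: "0 < p" and A: "bounded (A :: 'a::euclidean_space set)"
  shows "hausdorff_measure (pdist p) DIM('a) A < \<infinity>"
proof -
  obtain \<kappa> where \<kappa>: "0 < \<kappa>" "\<And>A. (A :: 'a set) \<in> sets borel \<Longrightarrow>
      hausdorff_measure (pdist p) DIM('a) A = ennreal \<kappa> * emeasure lborel A"
    using hausdorff_measure_eq_lborel[OF p] by metis
  obtain a :: 'a where a: "A \<subseteq> cbox (- a) a" using bounded_subset_cbox_symmetric[OF A] by blast
  have "hausdorff_measure (pdist p) DIM('a) A \<le> hausdorff_measure (pdist p) DIM('a) (cbox (- a) a)"
    by (rule hausdorff_measure_subset[OF a])
  also have "\<dots> < \<infinity>" by (simp add: \<kappa> ennreal_mult_less_top emeasure_lborel_cbox_finite[unfolded infinity_ennreal_def])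
  finally show ?thesis .
qed

context
  fixes TYP :: "'a::euclidean_space itself"
begin

private abbreviation "S \<equiv> sphere 0 1 :: ('a \<times> real) set"

private abbreviation "H \<equiv> hausdorff_measure (pdist (ereal 2)) DIM('a) :: ('a \<times> real) set \<Rightarrow> ennreal"

lemma hausdorff_reflection: "H (reflection u ` X) = H X"
  by (rule hausdorff_measure_isometric_image)
     (simp_all add: pnorm_2 inj_on_inverseI[of _ "reflection u"] flip: dist_norm)

lemma reflection_ball_sphere:
  assumes "x \<in> S" "y \<in> S"
  shows "reflection (x - y) ` (ball x r \<inter> S) = ball y r \<inter> S"
proof -
  let ?R = "reflection (x - y)"
  have xy: "?R x = y" using assms by (intro reflection_swap) simp
  have "?R -` (ball x r \<inter> S) = ball y r \<inter> S"
  proof (intro equalityI subsetI)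
    fix w assume w: "w \<in> ?R -` (ball x r \<inter> S)"
    then have "dist (?R x) (?R (?R w)) < r" by (subst dist_reflection) simp
    then show "w \<in> ball y r \<inter> S" using w by (simp add: xy)
  next
    fix w assume w: "w \<in> ball y r \<inter> S"
    then have "dist (?R (?R x)) (?R w) < r" by (subst dist_reflection) (simp add: xy)
    then show "w \<in> ?R -` (ball x r \<inter> S)" using w by simp
  qed
  then show ?thesis unfolding reflection_vimage .
qed

text \<open>Near the pole the sphere is a Lipschitz graph over a disk. Reflections carry this
  neighbourhood to every other point, and finitely many copies cover the sphere.\<close>

lemma hausdorff_sphere_finite: "H S < \<infinity>"
proof -
  let ?e = "(0, 1) :: 'a \<times> real"
  \<comment> \<open>Over this disk the height is at least 1/2, so the square root has bounded slope;
    and points within 1/2 of the pole have height above 1/2.\<close>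
  let ?D = "cball 0 (sqrt (3 / 4)) :: 'a set"
  let ?\<phi> = "\<lambda>z::'a. (z, sqrt (1 - (norm z)\<^sup>2))"
  have e: "?e \<in> S" by (simp add: norm_Pair)
  have D: "(norm z)\<^sup>2 \<le> 3 / 4" if "z \<in> ?D" for z
    using that power_mono[of "norm z" "sqrt (3 / 4)" 2] by simp
  have lip: "pnorm (ereal 2) (?\<phi> x - ?\<phi> y) \<le> 3 * pnorm (ereal 2) (x - y)" if xy: "x \<in> ?D" "y \<in> ?D" for x y
  proof -
    define f where "f z = sqrt (1 - (norm z)\<^sup>2)" for z :: 'a
    have f: "1 / 2 \<le> f z" "(f z)\<^sup>2 = 1 - (norm z)\<^sup>2" if "z \<in> ?D" for z
    proof -
      show "1 / 2 \<le> f z" unfolding f_def by (rule real_le_rsqrt) (use D[OF that] in \<open>simp add: power2_eq_square\<close>)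
      show "(f z)\<^sup>2 = 1 - (norm z)\<^sup>2" unfolding f_def using D[OF that] by simp
    qed
    have n1: "norm z \<le> 1" if "z \<in> ?D" for z
      by (rule power2_le_imp_le) (use D[OF that] in auto)
    have "\<bar>f x - f y\<bar> \<le> \<bar>f x - f y\<bar> * (f x + f y)"
      using f(1)[OF xy(1)] f(1)[OF xy(2)] by (simp add: mult_le_cancel_left1)
    also have "\<dots> = \<bar>(f x - f y) * (f x + f y)\<bar>"
      using f(1)[OF xy(1)] f(1)[OF xy(2)] by (simp add: abs_mult)
    also have "(f x - f y) * (f x + f y) = (f x)\<^sup>2 - (f y)\<^sup>2"
      by (simp add: power2_eq_square algebra_simps)
    also have "(f x)\<^sup>2 - (f y)\<^sup>2 = (norm y - norm x) * (norm x + norm y)"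
      unfolding f(2)[OF xy(1)] f(2)[OF xy(2)] by (simp add: power2_eq_square algebra_simps)
    also have "\<bar>\<dots>\<bar> = \<bar>norm x - norm y\<bar> * (norm x + norm y)"
      by (simp add: abs_mult abs_minus_commute)
    also have "\<dots> \<le> norm (x - y) * 2"
      using n1[OF xy(1)] n1[OF xy(2)] by (intro mult_mono norm_triangle_ineq3) auto
    finally have "\<bar>f x - f y\<bar> \<le> 2 * norm (x - y)" by simp
    moreover have "norm (?\<phi> x - ?\<phi> y) \<le> norm (x - y) + norm (f x - f y)"
      unfolding f_def using norm_Pair_le[of "x - y" "sqrt (1 - (norm x)\<^sup>2) - sqrt (1 - (norm y)\<^sup>2)"] by simp
    ultimately show ?thesis by (simp add: pnorm_2)
  qed
  have "ball ?e (1 / 2) \<inter> S \<subseteq> ?\<phi> ` ?D"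
  proof
    fix w assume w: "w \<in> ball ?e (1 / 2) \<inter> S"
    obtain z y where zy: "w = (z, y)" by (cases w)
    have "\<bar>1 - y\<bar> \<le> dist ?e w" using dist_snd_le[of ?e w] by (simp add: zy dist_real_def)
    then have y: "1 / 2 < y" using w by auto
    have n: "(norm z)\<^sup>2 + y\<^sup>2 = 1" using w by (simp add: zy norm_Pair real_sqrt_eq_1_iff)
    have "1 / 4 \<le> y\<^sup>2" using power_mono[of "1 / 2" y 2] y by (simp add: power2_eq_square)
    then have "norm z \<le> sqrt (3 / 4)" using n by (intro real_le_rsqrt) simp
    moreover have "y = sqrt (1 - (norm z)\<^sup>2)"
    proof -
      have "1 - (norm z)\<^sup>2 = y\<^sup>2" using n by simp
      then show ?thesis using y by simp
    qed
    ultimately show "w \<in> ?\<phi> ` ?D" by (auto simp: zy)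
  qed
  then have "H (ball ?e (1 / 2) \<inter> S) \<le> H (?\<phi> ` ?D)" by (rule hausdorff_measure_subset)
  also have "\<dots> \<le> ennreal 3 ^ DIM('a) * hausdorff_measure (pdist (ereal 2)) DIM('a) ?D"
    using lip by (intro hausdorff_measure_Lipschitz_image) auto
  also have "\<dots> < \<infinity>"
    using hausdorff_measure_bounded_finite[of "ereal 2" ?D] by (simp add: ennreal_mult_less_top power_less_top_ennreal)
  finally have fin_e: "H (ball ?e (1 / 2) \<inter> S) < \<infinity>" .
  have fin: "H (ball x (1 / 2) \<inter> S) < \<infinity>" if "x \<in> S" for x
    unfolding reflection_ball_sphere[OF e that, symmetric] hausdorff_reflection by (rule fin_e)
  obtain C where C: "C \<subseteq> S" "finite C" "S \<subseteq> (\<Union>c\<in>C. ball c (1 / 2))"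
    by (rule compactE_image[of S S "\<lambda>x. ball x (1 / 2)"]) auto
  have "H S \<le> H (\<Union>c\<in>C. ball c (1 / 2) \<inter> S)" using C(3) by (intro hausdorff_measure_subset) auto
  also have "\<dots> \<le> (\<Sum>c\<in>C. H (ball c (1 / 2) \<inter> S))" by (rule hausdorff_measure_finite_UN[OF C(2)])
  also have "\<dots> < \<infinity>"
  proof -
    have "H (ball c (1 / 2) \<inter> S) < top" if "c \<in> C" for c
      using fin[of c] C(1) that by auto
    then show ?thesis using C(2) by simp
  qed
  finally show ?thesis .
qed

lemma hausdorff_sphere_pos: "0 < H S"
proof -
  have "cball 0 1 \<subseteq> fst ` S"
  proof
    fix z :: 'a assume z: "z \<in> cball 0 1"
    then have "(norm z)\<^sup>2 \<le> 1" by (simp add: power_le_one)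
    then have "(z, sqrt (1 - (norm z)\<^sup>2)) \<in> S" by (simp add: norm_Pair)
    then show "z \<in> fst ` S" by force
  qed
  then have "hausdorff_measure (pdist (ereal 2)) DIM('a) (cball 0 1 :: 'a set) \<le> hausdorff_measure (pdist (ereal 2)) DIM('a) (fst ` S)"
    by (rule hausdorff_measure_subset)
  also have "\<dots> \<le> ennreal 1 ^ DIM('a) * H S"
  proof (rule hausdorff_measure_Lipschitz_image)
    fix w w' :: "'a \<times> real"
    show "pnorm (ereal 2) (fst w - fst w') \<le> 1 * pnorm (ereal 2) (w - w')"
      using norm_fst_le[of "fst (w - w')" "snd (w - w')"] by (simp add: pnorm_2 minus_prod_def)
  qed simp
  finally have le: "hausdorff_measure (pdist (ereal 2)) DIM('a) (cball 0 1 :: 'a set) \<le> H S" by simp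
  have "0 < emeasure lborel (ball 0 1 :: 'a set)" by (rule emeasure_lborel_open_pos) auto
  also have "\<dots> \<le> emeasure lborel (cball 0 1 :: 'a set)" by (intro emeasure_mono) auto
  finally have "0 < emeasure lborel (cball 0 1 :: 'a set)" .
  then have "hausdorff_measure (pdist (ereal 2)) DIM('a) (cball 0 1 :: 'a set) \<noteq> 0"
    using lborel_le_hausdorff_measure[of "ereal 2" "cball 0 1 :: 'a set"] by auto
  then show ?thesis using le by (metis le_zero_eq zero_less_iff_neq_zero)
qed

text \<open>The second measure is the image of Lebesgue measure on the unit ball under radial
  projection, which assigns to A the volume of its cone. Reflections act transitively on the sphere
  and commute with the projection, so both measures are uniformly distributed.\<close>

lemma hausdorff_sphere_eq_cone:
  obtains c where "0 < c"
    "\<And>A. closed A \<Longrightarrow> A \<subseteq> S \<Longrightarrow> enn2real (H A) = c * measure lebesgue {s *\<^sub>R y | s y. s \<in> {0..1} \<and> y \<in> A}"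
proof -
  let ?M = "density (hausdorff_borel (pdist (ereal 2)) DIM('a)) (indicator S) :: ('a \<times> real) measure"
  \<comment> \<open>At the origin this map takes the value 0, by the convention for division by
    zero: a point off the sphere, fed by a single null point.\<close>
  let ?n = "\<lambda>w::'a \<times> real. (1 / norm w) *\<^sub>R w"
  let ?N = "distr (density lborel (indicator (cball 0 1))) borel ?n :: ('a \<times> real) measure"
  have [measurable]: "S \<in> sets borel" by simp
  have n_refl: "?n (reflection u w) = reflection u (?n w)" for u w
    by (simp add: linear_scale[OF linear_reflection])
  have M: "emeasure ?M X = H (X \<inter> S)" if [measurable]: "X \<in> sets borel" for X
  proof -
    have "emeasure ?M X = (\<integral>\<^sup>+x. indicator S x * indicator X x \<partial>hausdorff_borel (pdist (ereal 2)) DIM('a))"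
      by (rule emeasure_density) auto
    also have "\<dots> = (\<integral>\<^sup>+x. indicator (X \<inter> S) x \<partial>hausdorff_borel (pdist (ereal 2)) DIM('a))"
      by (intro nn_integral_cong) (auto simp: indicator_def)
    also have "\<dots> = emeasure (hausdorff_borel (pdist (ereal 2)) DIM('a)) (X \<inter> S)"
      by (rule nn_integral_indicator) simp
    also have "\<dots> = H (X \<inter> S)" by (rule emeasure_hausdorff_borel[OF controls_dist_pnorm]) auto
    finally show ?thesis .
  qed
  have nm[measurable]: "?n \<in> borel_measurable borel" by measurable
  define pre where "pre X = cball 0 1 \<inter> {w. ?n w \<in> X}" for X
  have pre_borel: "pre X \<in> sets borel" if [measurable]: "X \<in> sets borel" for X
  proof -
    have "{w. ?n w \<in> X} = ?n -` X \<inter> space borel" by auto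
    also have "\<dots> \<in> sets borel" by (rule measurable_sets[OF nm that])
    finally show ?thesis unfolding pre_def by auto
  qed
  have N: "emeasure ?N X = emeasure lborel (pre X)" if X: "X \<in> sets borel" for X
  proof -
    have nX: "?n -` X \<in> sets borel" using measurable_sets[OF nm X] by simp
    have ind: "(indicator (cball 0 1) :: 'a \<times> real \<Rightarrow> ennreal) \<in> borel_measurable lborel"
      by (rule borel_measurable_indicator) simp
    have "emeasure ?N X = emeasure (density lborel (indicator (cball 0 1))) (?n -` X)"
      using X by (subst emeasure_distr) auto
    also have "\<dots> = (\<integral>\<^sup>+x. indicator (cball 0 1) x * indicator (?n -` X) x \<partial>lborel)"
      using nX by (intro emeasure_density ind) simp
    also have "\<dots> = (\<integral>\<^sup>+x. indicator (pre X) x \<partial>lborel)"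
      by (intro nn_integral_cong) (auto simp: indicator_def pre_def)
    also have "\<dots> = emeasure lborel (pre X)" using pre_borel[OF X] by simp
    finally show ?thesis .
  qed
  let ?e = "(0, 1) :: 'a \<times> real"
  have e: "?e \<in> S" by (simp add: norm_Pair)
  have prop_eq: "measure ?N UNIV * measure ?M A = measure ?M UNIV * measure ?N A" if A: "closed A" for A
  proof (rule uniformly_distributed_closed_eq[where S = S and g = "\<lambda>r. emeasure ?M (ball ?e r)" and h = "\<lambda>r. emeasure ?N (ball ?e r)"])
    show "finite_measure ?M"
      by (rule finite_measureI) (use hausdorff_sphere_finite in \<open>simp add: M[of UNIV] less_top[symmetric]\<close>)
    show "finite_measure ?N"
    proof (rule finite_measureI)
      have "emeasure lborel (pre UNIV) \<le> emeasure lborel (cball 0 1 :: ('a \<times> real) set)"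
        by (intro emeasure_mono) (auto simp: pre_def)
      also have "\<dots> < \<infinity>" by (rule emeasure_bounded_finite) simp
      finally show "emeasure ?N (space ?N) \<noteq> \<infinity>" by (simp add: N[of UNIV])
    qed
    show "emeasure ?M (- S) = 0" by (subst M) auto
    have "emeasure lborel (pre (- S)) \<le> emeasure lborel {0 :: 'a \<times> real}"
      by (intro emeasure_mono) (auto simp: pre_def)
    then show "emeasure ?N (- S) = 0" by (subst N) auto
    fix x :: "'a \<times> real" and r :: real assume x: "x \<in> S" and r: "0 < r"
    have "H (ball x r \<inter> S) = H (ball ?e r \<inter> S)"
      unfolding reflection_ball_sphere[OF e x, symmetric] hausdorff_reflection ..
    then show "emeasure ?M (ball x r) = emeasure ?M (ball ?e r)"
      unfolding M[OF borel_open[OF open_ball]] .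
    \<comment> \<open>The reflection exchanging the pole and x preserves the unit ball and commutes
      with radial projection, so it carries one preimage onto the other.\<close>
    have "pre (ball x r) = reflection (?e - x) ` pre (ball ?e r)"
    proof -
      let ?R = "reflection (?e - x)"
      have Re: "?R ?e = x" using x e by (intro reflection_swap) simp
      have Rx: "?R x = ?e" by (metis Re reflection_reflection)
      have "dist x v = dist ?e (?R v)" for v
        using dist_reflection[of "?e - x" x v] by (simp add: Rx)
      then have "w \<in> ?R -` pre (ball ?e r) \<longleftrightarrow> w \<in> pre (ball x r)" for w
        using n_refl[of "?e - x" w]
        unfolding pre_def vimage_eq Int_iff mem_Collect_eq mem_ball mem_cball dist_0_norm norm_reflection
        by (simp only:)
      then have "?R -` pre (ball ?e r) = pre (ball x r)" by blast
      then show ?thesis by (simp add: reflection_vimage)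
    qed
    then show "emeasure ?N (ball x r) = emeasure ?N (ball ?e r)"
      by (simp add: N emeasure_lborel_reflection pre_borel)
  next
    fix r :: real assume r: "0 < r"
    show hr: "0 < emeasure ?N (ball ?e r)"
    proof -
      have cont: "continuous_on (ball 0 1 - {0}) ?n" by (intro continuous_intros) auto
      have op: "open ((ball 0 1 - {0}) \<inter> ?n -` ball ?e r)"
        by (rule continuous_open_preimage[OF cont]) auto
      have "(1 / 2) *\<^sub>R ?e \<in> (ball 0 1 - {0}) \<inter> ?n -` ball ?e r"
      proof -
        have n2: "norm ((1 / 2) *\<^sub>R ?e) = 1 / 2" by (simp add: norm_Pair)
        have n3: "?n ((1 / 2) *\<^sub>R ?e) = ?e" unfolding n2 scaleR_scaleR by simp
        have "(1 / 2) *\<^sub>R ?e \<noteq> 0" using n2 by (metis norm_zero zero_neq_one divide_eq_0_iff zero_neq_numeral)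
        then show ?thesis
          using r unfolding Int_iff Diff_iff mem_ball dist_0_norm vimage_eq n2 n3 dist_self by auto
      qed
      then have "(ball 0 1 - {0}) \<inter> ?n -` ball ?e r \<noteq> {}" by blast
      then have "0 < emeasure lborel ((ball 0 1 - {0}) \<inter> ?n -` ball ?e r)" using op by (intro emeasure_lborel_open_pos)
      also have "\<dots> \<le> emeasure lborel (pre (ball ?e r))"
        using pre_borel[of "ball ?e r"] by (intro emeasure_mono) (auto simp: pre_def)
      finally show ?thesis by (simp add: N)
    qed
    show "0 < emeasure ?M (ball ?e r)"
    proof (rule ccontr)
      assume "\<not> ?thesis"
      then have 0: "H (ball ?e r \<inter> S) = 0" by (simp add: M zero_less_iff_neq_zero)
      have z: "H (ball x r \<inter> S) = 0" if "x \<in> S" for x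
        unfolding reflection_ball_sphere[OF e that, symmetric] hausdorff_reflection by (rule 0)
      obtain C where C: "C \<subseteq> S" "finite C" "S \<subseteq> (\<Union>c\<in>C. ball c r)"
        by (rule compactE_image[of S S "\<lambda>x. ball x r"]) (use r in auto)
      have "H S \<le> H (\<Union>c\<in>C. ball c r \<inter> S)" using C(3) by (intro hausdorff_measure_subset) auto
      also have "\<dots> \<le> (\<Sum>c\<in>C. H (ball c r \<inter> S))" by (rule hausdorff_measure_finite_UN[OF C(2)])
      also have "\<dots> = 0" using z C(1) by (intro sum.neutral) auto
      finally show False using hausdorff_sphere_pos by simp
    qed
  qed (use A e in auto)
  have m_pos: "0 < measure ?M UNIV"
    using hausdorff_sphere_pos hausdorff_sphere_finite
    by (simp add: measure_def M[of UNIV] enn2real_positive_iff)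
  have n_pos: "0 < measure ?N UNIV"
  proof -
    have "0 < emeasure lborel (ball 0 1 :: ('a \<times> real) set)" by (rule emeasure_lborel_open_pos) auto
    also have "\<dots> \<le> emeasure lborel (pre UNIV)"
      using pre_borel[of UNIV] by (intro emeasure_mono) (auto simp: pre_def)
    finally have "0 < emeasure lborel (pre UNIV)" .
    moreover have "emeasure lborel (pre UNIV) < top"
      by (rule emeasure_bounded_finite[unfolded infinity_ennreal_def]) (auto simp: pre_def)
    ultimately show ?thesis by (simp add: measure_def N[of UNIV] enn2real_positive_iff)
  qed
  show thesis
  proof (rule that[of "measure ?M UNIV / measure ?N UNIV"])
    show "0 < measure ?M UNIV / measure ?N UNIV" using m_pos n_pos by simp
    fix A :: "('a \<times> real) set" assume A: "closed A" "A \<subseteq> S"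
    let ?C = "{s *\<^sub>R y | s y. s \<in> {0..1} \<and> y \<in> A}"
    have "A \<inter> S = A" using A(2) by blast
    then have MA: "measure ?M A = enn2real (H A)" using A(1) by (simp add: measure_def M)
    have NA: "measure ?N A = measure lebesgue ?C"
    proof (cases "A = {}")
      case False
      \<comment> \<open>The cone differs from the preimage by the origin only, which is a null
        set.\<close>
      have C: "?C = pre A \<union> {0}"
      proof (intro equalityI subsetI)
        fix w assume "w \<in> ?C"
        then obtain s y where w: "w = s *\<^sub>R y" "0 \<le> s" "s \<le> 1" "y \<in> A" by auto
        then have "norm y = 1" using A(2) by auto
        then show "w \<in> pre A \<union> {0}" using w by (cases "s = 0") (auto simp: pre_def)
      next
        fix w assume w: "w \<in> pre A \<union> {0}"
        show "w \<in> ?C"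
        proof (cases "w = 0")
          case True
          obtain y where "y \<in> A" using False by blast
          then show ?thesis using True by (intro CollectI exI[of _ "0::real"] exI[of _ y]) auto
        next
          case False
          then show ?thesis using w
            by (intro CollectI exI[of _ "norm w"] exI[of _ "?n w"]) (auto simp: pre_def)
        qed
      qed
      have "pre A \<in> sets borel" using A(1) by (intro pre_borel) auto
      then have "emeasure lebesgue ?C = emeasure lborel (pre A)"
        unfolding C by (subst emeasure_Un_null_set) (auto intro!: null_setsI)
      then show ?thesis using A(1) by (simp add: measure_def N)
    qed simp
    show "enn2real (H A) = measure ?M UNIV / measure ?N UNIV * measure lebesgue ?C"
      using prop_eq[OF A(1)] n_pos unfolding MA NA by (simp add: field_simps)
  qed
qed

end

lemma compact_graph:
  assumes r: "0 < r" and s: "s \<le> 1"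
  shows "compact (graph_map r ` (orthant_ball (ereal r) s :: 'a::euclidean_space set))"
proof (rule compact_continuous_image)
  have p: "0 < ereal r" using r by simp
  have "continuous_on (orthant_ball (ereal r) s) (\<lambda>z::'a. quarter_circle r (pnorm (ereal r) z))"
    by (rule continuous_on_compose2[OF continuous_on_quarter_circle[OF r] continuous_on_pnorm[OF p]])
       (use s in \<open>auto simp: orthant_ball_def pnorm_nonneg\<close>)
  then show "continuous_on (orthant_ball (ereal r) s :: 'a set) (graph_map r)"
    unfolding graph_map_def[abs_def] by (intro continuous_intros)
  show "compact (orthant_ball (ereal r) s :: 'a set)"
    by (simp add: compact_eq_bounded_closed closed_orthant_ball[OF p] bounded_orthant_ball[OF p])
qed

lemma graph_subset_sphere:
  assumes "s \<le> 1"
  shows "graph_map 2 ` (orthant_ball (ereal 2) s :: 'a::euclidean_space set) \<subseteq> sphere 0 1"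
proof (rule image_subsetI)
  fix z :: 'a assume z: "z \<in> orthant_ball (ereal 2) s"
  have n: "pnorm (ereal 2) z = norm z" using pnorm_2[of z] by simp
  have "norm z \<le> 1" using z assms by (simp add: orthant_ball_def n)
  then have "quarter_circle 2 (norm z) powr 2 = 1 - norm z powr 2" by (intro quarter_circle_powr) auto
  then have "(norm z)\<^sup>2 + (quarter_circle 2 (norm z))\<^sup>2 = 1" by simp
  then show "graph_map 2 z \<in> sphere 0 1" by (simp add: graph_map_def norm_Pair n)
qed

subsection \<open>The simplex\<close>

lemma hausdorff_measure_scaled_image:
  assumes L: "0 < L" and f: "\<And>x y. x \<in> A \<Longrightarrow> y \<in> A \<Longrightarrow> d' (f x) (f y) = L * d x y" and inj: "inj_on f A"
  shows "hausdorff_measure d' k (f ` A) = ennreal L ^ k * hausdorff_measure d k A"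
proof (rule antisym)
  show "hausdorff_measure d' k (f ` A) \<le> ennreal L ^ k * hausdorff_measure d k A"
    by (rule hausdorff_measure_Lipschitz_image[OF L]) (simp add: f)
  have "hausdorff_measure d k (inv_into A f ` f ` A) \<le> ennreal (1 / L) ^ k * hausdorff_measure d' k (f ` A)"
  proof (rule hausdorff_measure_Lipschitz_image)
    fix x y assume "x \<in> f ` A" "y \<in> f ` A"
    then obtain u v where uv: "u \<in> A" "v \<in> A" "x = f u" "y = f v" by blast
    show "d (inv_into A f x) (inv_into A f y) \<le> 1 / L * d' x y"
      unfolding uv(3,4) inv_into_f_f[OF inj uv(1)] inv_into_f_f[OF inj uv(2)] f[OF uv(1,2)] using L by simp
  qed (use L in simp)
  then have "ennreal L ^ k * hausdorff_measure d k A \<le> ennreal L ^ k * (ennreal (1 / L) ^ k * hausdorff_measure d' k (f ` A))"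
    using inj by (intro mult_left_mono) (auto simp: inv_into_image_cancel)
  also have "\<dots> = (ennreal L * ennreal (1 / L)) ^ k * hausdorff_measure d' k (f ` A)"
    by (simp add: power_mult_distrib mult.assoc)
  also have "ennreal L * ennreal (1 / L) = 1" using L by (subst ennreal_mult[symmetric]) auto
  finally show "ennreal L ^ k * hausdorff_measure d k A \<le> hausdorff_measure d' k (f ` A)" by simp
qed

text \<open>A point is an isometric copy of a point of the base, where the measure is a multiple of
  Lebesgue measure. This settles the degenerate cap at t = 0.\<close>

lemma hausdorff_measure_singleton:
  assumes p: "0 < p"
  shows "hausdorff_measure (pdist p) DIM('a::euclidean_space) {w :: 'a \<times> real} = 0"
proof -
  obtain \<kappa> where \<kappa>: "\<And>A. (A :: 'a set) \<in> sets borel \<Longrightarrow>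
      hausdorff_measure (pdist p) DIM('a) A = ennreal \<kappa> * emeasure lborel A"
    using hausdorff_measure_eq_lborel[OF p] by metis
  have "hausdorff_measure (pdist p) DIM('a) ((\<lambda>_. w) ` {0 :: 'a}) = hausdorff_measure (pdist p) DIM('a) {0 :: 'a}"
    using p by (intro hausdorff_measure_isometric_image) auto
  then show ?thesis by (simp add: \<kappa>)
qed

lemma orthant_ball_0:
  assumes p: "0 < p"
  shows "orthant_ball p 0 = {0 :: 'a::euclidean_space}"
proof -
  have "pnorm p z \<le> 0 \<longleftrightarrow> pnorm p z = 0" for z :: 'a
    using pnorm_nonneg[of p z] by linarith
  then have "orthant_ball p 0 = {z :: 'a. (\<forall>b\<in>Basis. 0 \<le> z \<bullet> b) \<and> z = 0}"
    unfolding orthant_ball_def by (simp only: pnorm_eq_0_iff[OF p])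
  also have "\<dots> = {0}" by auto
  finally show ?thesis .
qed

lemma measure_cone_point:
  "measure lebesgue {s *\<^sub>R y | s y. s \<in> {0..1} \<and> y \<in> {(0 :: 'a::euclidean_space, 1 :: real)}} = 0"
proof -
  obtain b :: 'a where b: "b \<in> Basis" by (meson nonempty_Basis ex_in_conv)
  have "{s *\<^sub>R y | s y. s \<in> {0..1} \<and> y \<in> {(0 :: 'a, 1 :: real)}} \<subseteq> {w. w \<bullet> (b, 0) = 0}" by auto
  moreover have "negligible {w :: 'a \<times> real. w \<bullet> (b, 0) = 0}"
    using b by (intro negligible_standard_hyperplane) (auto simp: Basis_prod_def)
  ultimately have "negligible {s *\<^sub>R y | s y. s \<in> {0..1} \<and> y \<in> {(0 :: 'a, 1 :: real)}}"
    by (rule negligible_subset[rotated])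
  then show ?thesis by (rule negligible_imp_measure0)
qed

lemma quarter_circle_one: "0 \<le> u \<Longrightarrow> u \<le> 1 \<Longrightarrow> quarter_circle 1 u = 1 - u"
  by (simp add: quarter_circle_def)

text \<open>The homothety with centre at the pole and ratio s maps the full cap onto the cap of
  parameter s and multiplies every q-distance by s, whatever q is.\<close>

lemma simplex_area:
  assumes q: "0 < q"
  obtains h where "0 < h"
    "\<And>s. 0 < s \<Longrightarrow> s \<le> 1 \<Longrightarrow> enn2real (hausdorff_measure (pdist q) DIM('a)
       (graph_map 1 ` (orthant_ball (ereal 1) s :: 'a::euclidean_space set))) = s ^ DIM('a) * h"
proof -
  let ?B = "\<lambda>s. orthant_ball (ereal 1) s :: 'a set"
  let ?H = "\<lambda>s. hausdorff_measure (pdist q) DIM('a) (graph_map 1 ` ?B s)"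
  have B1: "z \<in> ?B 1 \<Longrightarrow> graph_map 1 z = (z, 1 - pnorm (ereal 1) z)" for z
    by (auto simp: graph_map_def orthant_ball_def quarter_circle_one pnorm_nonneg)
  have scale: "?H s = ennreal s ^ DIM('a) * ?H 1" if s: "0 < s" "s \<le> 1" for s
  proof -
    let ?f = "\<lambda>w :: 'a \<times> real. s *\<^sub>R w + (1 - s) *\<^sub>R (0, 1)"
    have f: "?f (graph_map 1 z) = graph_map 1 (s *\<^sub>R z)" if "z \<in> ?B 1" for z
    proof -
      have "pnorm (ereal 1) (s *\<^sub>R z) = s * pnorm (ereal 1) z" using s by (simp add: pnorm_scaleR)
      moreover have "s * pnorm (ereal 1) z \<le> 1"
        using that s by (auto simp: orthant_ball_def pnorm_nonneg intro: mult_le_one)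
      ultimately show ?thesis
        using s pnorm_nonneg[of "ereal 1" z] that
        by (simp add: B1, simp add: graph_map_def quarter_circle_one algebra_simps)
    qed
    have sB: "(*\<^sub>R) s ` ?B 1 = ?B s"
    proof (intro equalityI subsetI)
      fix z assume "z \<in> ?B s"
      then have "(1 / s) *\<^sub>R z \<in> ?B 1"
        using orthant_ball_scale[of "ereal 1" s "(1 / s) *\<^sub>R z" 1] s by simp
      then have "s *\<^sub>R ((1 / s) *\<^sub>R z) \<in> (*\<^sub>R) s ` ?B 1" by (rule imageI)
      then show "z \<in> (*\<^sub>R) s ` ?B 1" using s by simp
    next
      fix z assume "z \<in> (*\<^sub>R) s ` ?B 1"
      then show "z \<in> ?B s" using orthant_ball_scale[of "ereal 1" s _ 1] s by auto
    qed
    have "?f ` graph_map 1 ` ?B 1 = graph_map 1 ` (*\<^sub>R) s ` ?B 1"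
      unfolding image_image by (rule image_cong[OF refl f])
    then have "?H s = hausdorff_measure (pdist q) DIM('a) (?f ` graph_map 1 ` ?B 1)" by (simp add: sB)
    also have "\<dots> = ennreal s ^ DIM('a) * ?H 1"
    proof (rule hausdorff_measure_scaled_image[OF s(1)])
      fix x y :: "'a \<times> real"
      have "?f x - ?f y = s *\<^sub>R (x - y)" by (simp add: algebra_simps)
      then show "pnorm q (?f x - ?f y) = s * pnorm q (x - y)" using s q by (simp only: pnorm_scaleR abs_of_pos)
    qed (use s in \<open>simp add: inj_on_def\<close>)
    finally show ?thesis .
  qed
  have pos: "0 < ?H 1"
  proof -
    have "box 0 ((1 / DIM('a)) *\<^sub>R One) \<subseteq> ?B 1"
    proof
      fix z :: 'a assume z: "z \<in> box 0 ((1 / DIM('a)) *\<^sub>R One)"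
      have "pnorm (ereal 1) z = (\<Sum>b\<in>Basis. \<bar>z \<bullet> b\<bar>)" by (simp add: pnorm_ereal sum_nonneg)
      also have "\<dots> \<le> (\<Sum>b\<in>(Basis :: 'a set). 1 / DIM('a))"
        using z by (intro sum_mono) (auto simp: mem_box less_imp_le)
      also have "\<dots> = 1" by simp
      finally show "z \<in> ?B 1" using z by (auto simp: orthant_ball_def mem_box less_imp_le)
    qed
    then have "emeasure lborel (box 0 ((1 / DIM('a)) *\<^sub>R One :: 'a)) \<le> emeasure lborel (?B 1)"
      by (intro emeasure_mono) (auto simp: orthant_ball_borel)
    moreover have "0 < emeasure lborel (box 0 ((1 / DIM('a)) *\<^sub>R One :: 'a))"
      by (rule emeasure_lborel_open_pos) (auto simp: box_ne_empty)
    ultimately have "0 < emeasure lborel (?B 1)" by (rule order_less_le_trans[rotated])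
    then have "hausdorff_measure (pdist q) DIM('a) (?B 1) \<noteq> 0"
      using lborel_le_hausdorff_measure[OF q, of "?B 1"] by auto
    then show ?thesis
      using area_ge_projection[OF q, of "DIM('a)" "?B 1" 1] by (metis le_zero_eq zero_less_iff_neq_zero)
  qed
  have fin: "?H 1 < \<infinity>"
  proof -
    obtain K where K: "0 < K"
      "\<And>(x::'a \<times> real) c. (\<And>b. b \<in> Basis \<Longrightarrow> \<bar>x \<bullet> b\<bar> \<le> c) \<Longrightarrow> pnorm q x \<le> K * c"
      \<comment> \<open>The height is a sum of coordinates and hence Lipschitz, so the full cap is a
        Lipschitz image of a bounded set.\<close>
      using pnorm_le_const[OF q] by metis
    have lip: "pnorm q (graph_map 1 x - graph_map 1 y) \<le> (K * DIM('a)) * pnorm q (x - y)"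
      if xy: "x \<in> ?B 1" "y \<in> ?B 1" for x y
    proof -
      have n1: "pnorm (ereal 1) z = (\<Sum>b\<in>Basis. \<bar>z \<bullet> b\<bar>)" for z :: 'a
        by (simp add: pnorm_ereal sum_nonneg)
      have c: "\<bar>(x - y) \<bullet> b\<bar> \<le> pnorm q (x - y)" if "b \<in> Basis" for b
        by (rule abs_inner_le_pnorm[OF q that])
      have "\<bar>pnorm (ereal 1) y - pnorm (ereal 1) x\<bar> = \<bar>\<Sum>b\<in>Basis. \<bar>y \<bullet> b\<bar> - \<bar>x \<bullet> b\<bar>\<bar>"
        by (simp add: n1 sum_subtractf)
      also have "\<dots> \<le> (\<Sum>b\<in>Basis. \<bar>\<bar>y \<bullet> b\<bar> - \<bar>x \<bullet> b\<bar>\<bar>)" by (rule sum_abs)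
      also have "\<dots> \<le> (\<Sum>b\<in>(Basis::'a set). pnorm q (x - y))"
      proof (rule sum_mono)
        fix b :: 'a assume "b \<in> Basis"
        then show "\<bar>\<bar>y \<bullet> b\<bar> - \<bar>x \<bullet> b\<bar>\<bar> \<le> pnorm q (x - y)"
          using c[of b] unfolding inner_diff_left by linarith
      qed
      finally have d: "\<bar>pnorm (ereal 1) y - pnorm (ereal 1) x\<bar> \<le> DIM('a) * pnorm q (x - y)" by simp
      have k: "pnorm q (x - y) \<le> DIM('a) * pnorm q (x - y)"
        using mult_right_mono[of 1 "real DIM('a)" "pnorm q (x - y)"] pnorm_nonneg[of q "x - y"]
        by (simp add: Suc_le_eq)
      have "pnorm q (graph_map 1 x - graph_map 1 y) \<le> K * (DIM('a) * pnorm q (x - y))"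
      proof (rule K(2))
        fix b :: "'a \<times> real" assume "b \<in> Basis"
        then consider b' where "b' \<in> Basis" "b = (b', 0)" | "b = (0, 1)" by (auto simp: Basis_prod_def)
        then show "\<bar>(graph_map 1 x - graph_map 1 y) \<bullet> b\<bar> \<le> DIM('a) * pnorm q (x - y)"
        proof cases
          case 1
          then show ?thesis using c[of b'] k by (simp add: B1[OF xy(1)] B1[OF xy(2)])
        next
          case 2
          then show ?thesis using d by (simp add: B1[OF xy(1)] B1[OF xy(2)])
        qed
      qed
      then show ?thesis by simp
    qed
    have "?H 1 \<le> ennreal (K * DIM('a)) ^ DIM('a) * hausdorff_measure (pdist q) DIM('a) (?B 1)"
      using lip K(1) by (intro hausdorff_measure_Lipschitz_image) auto
    also have "\<dots> < \<infinity>"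
      using hausdorff_measure_bounded_finite[OF q bounded_orthant_ball[of "ereal 1" 1, where 'a = 'a]]
      by (simp add: ennreal_mult_less_top power_less_top_ennreal)
    finally show ?thesis .
  qed
  show thesis
  proof (rule that[of "enn2real (?H 1)"])
    show "0 < enn2real (?H 1)" using pos fin by (simp add: enn2real_positive_iff)
    fix s :: real assume s: "0 < s" "s \<le> 1"
    show "enn2real (?H s) = s ^ DIM('a) * enn2real (?H 1)"
      unfolding scale[OF s] using s by (simp add: enn2real_mult ennreal_power)
  qed
qed

subsection \<open>The cube\<close>

lemma pnorm_inf_real: "pnorm \<infinity> (x::real) = \<bar>x\<bar>"
  by (simp add: pnorm_def)

lemma squig_pi_inf: "squig_pi \<infinity> = 4"
proof -
  have "{x :: real \<times> real. pnorm \<infinity> x \<le> 1} = cbox (-1, -1) (1, 1)"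
    by (auto simp: pnorm_Pair_inf pnorm_inf_real cbox_Pair_eq)
  then have "squig_pi \<infinity> = measure lborel (cbox (-1, -1) (1, 1) :: (real \<times> real) set)"
    unfolding squig_pi_def by (simp add: measure_completion)
  also have "\<dots> = 4" by (simp add: content_Pair)
  finally show ?thesis .
qed

lemma orthant_ball_inf:
  assumes "0 \<le> s"
  shows "orthant_ball \<infinity> s = cbox 0 (s *\<^sub>R One)"
proof -
  have "pnorm \<infinity> z \<le> s \<longleftrightarrow> (\<forall>b\<in>Basis. \<bar>z \<bullet> b\<bar> \<le> s)" for z :: 'a
    by (simp add: pnorm_def)
  then show ?thesis by (auto simp: orthant_ball_def mem_box)
qed

lemma unsigned_sphere_inf: "x \<in> unsigned_sphere \<infinity> \<longleftrightarrow> x \<in> cbox 0 One \<and> (\<exists>b\<in>Basis. x \<bullet> b = 1)"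
proof
  assume x: "x \<in> unsigned_sphere \<infinity>"
  then have "x \<in> orthant_ball \<infinity> 1" by (auto simp: unsigned_sphere_def orthant_ball_def)
  moreover have "pnorm \<infinity> x \<in> (\<lambda>b. \<bar>x \<bullet> b\<bar>) ` Basis"
    by (simp only: pnorm_def simp_thms if_True) (rule Max_in, auto)
  then have "1 \<in> (\<lambda>b. \<bar>x \<bullet> b\<bar>) ` Basis" using x by (simp add: unsigned_sphere_def)
  ultimately show "x \<in> cbox 0 One \<and> (\<exists>b\<in>Basis. x \<bullet> b = 1)"
    using x by (auto simp: orthant_ball_inf unsigned_sphere_def)
next
  assume x: "x \<in> cbox 0 One \<and> (\<exists>b\<in>Basis. x \<bullet> b = 1)"
  then have "x \<in> orthant_ball \<infinity> 1" by (simp add: orthant_ball_inf)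
  moreover have "1 \<le> pnorm \<infinity> x" using x abs_inner_le_pnorm[of \<infinity> _ x] by force
  ultimately show "x \<in> unsigned_sphere \<infinity>" by (auto simp: unsigned_sphere_def orthant_ball_def)
qed

lemma cap_inf_top:
  assumes t: "0 \<le> t" "t \<le> 1"
  shows "(cap \<infinity> t :: ('a::euclidean_space \<times> real) set) = (\<lambda>z. (z, 1)) ` orthant_ball \<infinity> t"
proof (intro equalityI subsetI)
  fix w :: "'a \<times> real" assume "w \<in> cap \<infinity> t"
  then obtain u x where w: "w = (squig_sin \<infinity> u *\<^sub>R x, squig_cos \<infinity> u)" "0 \<le> u" "u \<le> t" "x \<in> unsigned_sphere \<infinity>"
    unfolding cap_def by auto
  then have "w = (u *\<^sub>R x, 1)" using t by (simp add: squig_sin_def squig_cos_def)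
  moreover have "u *\<^sub>R x \<in> orthant_ball \<infinity> t"
    using w t by (simp add: orthant_ball_def unsigned_sphere_def pnorm_scaleR)
  ultimately show "w \<in> (\<lambda>z. (z, 1)) ` orthant_ball \<infinity> t" by blast
next
  fix w :: "'a \<times> real" assume "w \<in> (\<lambda>z. (z, 1)) ` orthant_ball \<infinity> t"
  then obtain z where z: "w = (z, 1)" "z \<in> orthant_ball \<infinity> t" by blast
  then obtain x where x: "x \<in> unsigned_sphere \<infinity>" "z = pnorm \<infinity> z *\<^sub>R x"
    using orthant_ball_polar[of \<infinity> z t] by auto
  have u: "0 \<le> pnorm \<infinity> z" "pnorm \<infinity> z \<le> t" using z by (auto simp: orthant_ball_def pnorm_nonneg)
  have "w = (squig_sin \<infinity> (pnorm \<infinity> z) *\<^sub>R x, squig_cos \<infinity> (pnorm \<infinity> z))"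
    using u t x(2) z(1) by (simp add: squig_sin_def squig_cos_def)
  then show "w \<in> cap \<infinity> t" unfolding cap_def using u x(1) by auto
qed

text \<open>Beyond t = 1 the sine stays at 1 while the cosine decreases as 2 - t. The cap is then
  the top face together with a strip on the sides that grows downward.\<close>

lemma cap_inf_side:
  assumes t: "1 \<le> t" "t \<le> 2"
  shows "(cap \<infinity> t :: ('a::euclidean_space \<times> real) set) = (\<lambda>z. (z, 1)) ` orthant_ball \<infinity> 1 \<union> unsigned_sphere \<infinity> \<times> {2 - t..1}"
proof (intro equalityI subsetI)
  fix w :: "'a \<times> real" assume "w \<in> cap \<infinity> t"
  then obtain u x where w: "w = (squig_sin \<infinity> u *\<^sub>R x, squig_cos \<infinity> u)" "0 \<le> u" "u \<le> t" "x \<in> unsigned_sphere \<infinity>"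
    unfolding cap_def by auto
  show "w \<in> (\<lambda>z. (z, 1)) ` orthant_ball \<infinity> 1 \<union> unsigned_sphere \<infinity> \<times> {2 - t..1}"
  proof (cases "u \<le> 1")
    case True
    then have "w \<in> cap \<infinity> 1" unfolding cap_def using w by auto
    then show ?thesis by (simp add: cap_inf_top)
  next
    case False
    then have "w = (x, 2 - u)" using w by (simp add: squig_sin_def squig_cos_def)
    then show ?thesis using w False by auto
  qed
next
  fix w :: "'a \<times> real" assume "w \<in> (\<lambda>z. (z, 1)) ` orthant_ball \<infinity> 1 \<union> unsigned_sphere \<infinity> \<times> {2 - t..1}"
  then consider "w \<in> cap \<infinity> 1" | x y where "w = (x, y)" "x \<in> unsigned_sphere \<infinity>" "2 - t \<le> y" "y \<le> 1"
    by (auto simp: cap_inf_top)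
  then show "w \<in> cap \<infinity> t"
  proof cases
    case 1
    then show ?thesis unfolding cap_def using t by force
  next
    case 2
    then have "w = (squig_sin \<infinity> (2 - y) *\<^sub>R x, squig_cos \<infinity> (2 - y))"
      by (simp add: squig_sin_def squig_cos_def)
    then show ?thesis unfolding cap_def using 2 by (auto intro!: exI[of _ "2 - y"])
  qed
qed

text \<open>The top face and each of the k side faces are isometric to boxes in \<open>'a\<close>
  for every q-norm, so a single constant relates their areas to Lebesgue measure. Different faces
  meet in null sets, and the areas add up.\<close>

lemma cube_area:
  assumes q: "0 < q"
  obtains \<kappa> :: real where "0 < \<kappa>"
    "\<And>t. 0 \<le> t \<Longrightarrow> t \<le> 1 \<Longrightarrow> hyper_area TYPE('a::euclidean_space) q \<infinity> t = \<kappa> * t ^ DIM('a)"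
    "\<And>t. 1 \<le> t \<Longrightarrow> t \<le> 2 \<Longrightarrow> hyper_area TYPE('a) q \<infinity> t = \<kappa> * (1 + real DIM('a) * (t - 1))"
proof -
  let ?k = "DIM('a)"
  let ?H' = "hausdorff_measure (pdist q) ?k :: 'a set \<Rightarrow> ennreal"
  let ?H = "hausdorff_measure (pdist q) ?k :: ('a \<times> real) set \<Rightarrow> ennreal"
  let ?M = "hausdorff_borel (pdist q) ?k :: ('a \<times> real) measure"
  obtain \<kappa> where \<kappa>: "0 < \<kappa>" "\<And>A. (A :: 'a set) \<in> sets borel \<Longrightarrow> ?H' A = ennreal \<kappa> * emeasure lborel A"
    using hausdorff_measure_eq_lborel[OF q] by metis
  have M: "emeasure ?M A = ?H A" if "A \<in> sets borel" for A
    by (rule emeasure_hausdorff_borel[OF controls_dist_pnorm[OF q] that])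
  let ?T = "\<lambda>X :: 'a set. (\<lambda>z. (z, 1::real)) ` X"
  have top: "?H (?T X) = ?H' X" for X
  proof (rule hausdorff_measure_isometric_image)
    fix x y :: 'a
    show "pnorm q ((x, 1) - (y, 1::real)) = pnorm q (x - y)" using pnorm_Pair_0[OF q, of "x - y"] by simp
  qed (simp add: inj_on_def)
  \<comment> \<open>The strip of the side face with b-coordinate 1 between the heights m and
    1.\<close>
  define F where "F m b = (cbox 0 (One::'a) \<inter> {z. z \<bullet> b = 1}) \<times> {m..1::real}" for m b
  \<comment> \<open>On a side face the coordinate b is constant, so replacing it by the height loses
    nothing.\<close>
  have chart: "?H A = ?H' (replace_coord b ` A)" if "A \<subseteq> F m b" "b \<in> Basis" for A m b
  proof (rule hausdorff_measure_isometric_image[symmetric])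
    have fb: "fst w \<bullet> b = 1" if "w \<in> A" for w using subsetD[OF \<open>A \<subseteq> F m b\<close> that] by (auto simp: F_def)
    fix v w assume vw: "v \<in> A" "w \<in> A"
    have "fst (v - w) \<bullet> b = 0" using fb[OF vw(1)] fb[OF vw(2)] by (simp add: inner_diff_left)
    then show "pnorm q (replace_coord b v - replace_coord b w) = pnorm q (v - w)"
      unfolding replace_coord_diff by (rule pnorm_replace_coord_eq[OF q \<open>b \<in> Basis\<close>])
  next
    show "inj_on (replace_coord b) A"
    proof (rule inj_onI)
      fix v w assume vw: "v \<in> A" "w \<in> A" and eq: "replace_coord b v = replace_coord b w"
      have c: "replace_coord b v \<bullet> b' = replace_coord b w \<bullet> b'" for b' by (simp add: eq)
      have s: "snd v = snd w" using c[of b] \<open>b \<in> Basis\<close> by (simp add: inner_replace_coord)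
      have "fst v = fst w"
      proof (rule euclidean_eqI)
        fix b' :: 'a assume b': "b' \<in> Basis"
        show "fst v \<bullet> b' = fst w \<bullet> b'"
        proof (cases "b' = b")
          case True
          then show ?thesis
            using subsetD[OF \<open>A \<subseteq> F m b\<close> vw(1)] subsetD[OF \<open>A \<subseteq> F m b\<close> vw(2)] by (auto simp: F_def)
        next
          case False
          then show ?thesis using c[of b'] b' \<open>b \<in> Basis\<close> by (simp add: inner_replace_coord)
        qed
      qed
      then show "v = w" using s by (simp add: prod_eq_iff)
    qed
  qed
  have F_closed: "closed (F m b)" for m b
    unfolding F_def by (intro closed_Times closed_Int closed_cbox closed_Collect_eq continuous_intros closed_atLeastAtMost)
  have side_area: "?H (F m b) = ennreal (\<kappa> * (1 - m))" if b: "b \<in> Basis" and m: "0 \<le> m" "m \<le> 1" for m b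
  proof -
    have "replace_coord b ` F m b = cbox (m *\<^sub>R b) One"
    proof (intro equalityI subsetI)
      fix x assume "x \<in> replace_coord b ` F m b"
      then obtain z y where x: "x = replace_coord b (z, y)" "z \<in> cbox 0 One" "m \<le> y" "y \<le> 1" by (auto simp: F_def)
      have "m *\<^sub>R b \<bullet> b' \<le> x \<bullet> b' \<and> x \<bullet> b' \<le> One \<bullet> b'" if "b' \<in> Basis" for b'
        using x b that m by (auto simp: inner_replace_coord mem_box inner_Basis)
      then show "x \<in> cbox (m *\<^sub>R b) One" by (simp add: mem_box)
    next
      fix x assume x: "x \<in> cbox (m *\<^sub>R b) One"
      have x': "(if b' = b then m else 0) \<le> x \<bullet> b' \<and> x \<bullet> b' \<le> 1" if "b' \<in> Basis" for b'
        using x that b by (auto simp: mem_box inner_Basis split: if_splits)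
      let ?z = "x + (1 - x \<bullet> b) *\<^sub>R b"
      have zb: "?z \<bullet> b' = (if b' = b then 1 else x \<bullet> b')" if "b' \<in> Basis" for b'
        using that b by (auto simp: inner_add_left inner_Basis)
      have "0 \<le> x \<bullet> b' \<and> x \<bullet> b' \<le> 1" if "b' \<in> Basis" for b'
        using x'[OF that] m by (auto split: if_splits)
      then have "?z \<in> cbox 0 One" unfolding mem_box by (auto simp: zb)
      then have "(?z, x \<bullet> b) \<in> F m b" using x'[OF b] zb[OF b] by (simp add: F_def)
      moreover have "replace_coord b (?z, x \<bullet> b) = x"
        unfolding replace_coord_def fst_conv snd_conv zb[OF b] by (simp add: algebra_simps)
      ultimately show "x \<in> replace_coord b ` F m b" by (metis imageI)
    qed
    then have "?H (F m b) = ennreal \<kappa> * emeasure lborel (cbox (m *\<^sub>R b) (One::'a))"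
      using chart[OF order_refl b, of m] by (simp add: \<kappa>)
    also have "emeasure lborel (cbox (m *\<^sub>R b) (One::'a)) = ennreal (\<Prod>b'\<in>Basis. (One - m *\<^sub>R b) \<bullet> b')"
      using b m by (intro emeasure_lborel_cbox) (auto simp: inner_Basis)
    also have "(\<Prod>b'\<in>Basis. (One - m *\<^sub>R b) \<bullet> b') = 1 - m"
      using b by (subst prod.remove[of _ b]) (auto simp: inner_diff_left inner_Basis intro!: prod.neutral split: if_splits)
    finally show ?thesis using \<kappa>(1) m by (simp add: ennreal_mult)
  qed
  let ?E = "\<lambda>b. cbox 0 (One::'a) \<inter> {x. x \<bullet> b = 1}"
  have E_borel: "?E b \<in> sets borel" for b
    by (intro borel_closed closed_Int closed_cbox closed_Collect_eq continuous_intros)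
  have null: "?H' X = 0" if X: "X \<subseteq> ?E b" and b: "b \<in> Basis" for X b
  proof -
    have "negligible {x :: 'a. x \<bullet> b = 1}" by (rule negligible_standard_hyperplane[OF b])
    then have "negligible (?E b)" by (rule negligible_subset) auto
    then have "emeasure lborel (?E b) = 0"
      using E_borel[of b] negligible_iff_emeasure0[of "?E b"] by simp
    then have "?H' (?E b) = 0" by (simp add: \<kappa> E_borel)
    then show ?thesis using hausdorff_measure_subset[OF X, of "pdist q" ?k] by simp
  qed
  show thesis
  proof (rule that[OF \<kappa>(1)])
    fix t :: real assume t: "0 \<le> t" "t \<le> 1"
    have "emeasure lborel (cbox 0 (t *\<^sub>R (One::'a))) = ennreal (t ^ ?k)"
      using t by (simp add: emeasure_lborel_cbox_eq)
    then have "?H (cap \<infinity> t) = ennreal (\<kappa> * t ^ ?k)"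
      using t \<kappa>(1) unfolding cap_inf_top[OF t] top orthant_ball_inf[OF t(1)] by (simp add: \<kappa>(2) ennreal_mult)
    then show "hyper_area TYPE('a) q \<infinity> t = \<kappa> * t ^ ?k"
      using t \<kappa>(1) by (simp add: hyper_area_def)
  next
    fix t :: real assume t: "1 \<le> t" "t \<le> 2"
    let ?T1 = "?T (cbox 0 One)" and ?F = "F (2 - t)"
    have cap: "cap \<infinity> t = ?T1 \<union> (\<Union>b\<in>Basis. ?F b)"
      unfolding cap_inf_side[OF t] F_def using orthant_ball_inf[of 1, where 'a = 'a] by (auto simp: unsigned_sphere_inf)
    have T1: "?T1 \<in> fmeasurable ?M" "measure ?M ?T1 = \<kappa>"
    proof -
      have "?T1 = cbox 0 One \<times> {1}" by auto
      moreover have "closed (cbox 0 (One::'a) \<times> {1::real})" by (intro closed_Times) auto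
      ultimately have cl: "closed ?T1" by simp
      have e: "emeasure ?M ?T1 = ennreal \<kappa>"
        using cl by (simp add: M top \<kappa>(2))
      then show "?T1 \<in> fmeasurable ?M" using cl by (intro fmeasurableI) auto
      show "measure ?M ?T1 = \<kappa>" using e \<kappa>(1) by (simp add: measure_def)
    qed
    have Fb: "?F b \<in> fmeasurable ?M" "measure ?M (?F b) = \<kappa> * (t - 1)" if b: "b \<in> Basis" for b
    proof -
      have e: "emeasure ?M (?F b) = ennreal (\<kappa> * (t - 1))"
        using side_area[OF b, of "2 - t"] t F_closed[of "2 - t" b] by (simp add: M)
      then show "?F b \<in> fmeasurable ?M" using F_closed[of "2 - t" b] by (intro fmeasurableI) auto
      show "measure ?M (?F b) = \<kappa> * (t - 1)" using e \<kappa>(1) t by (simp add: measure_def)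
    qed
    have ae: "AE w in ?M. w \<notin> A \<or> w \<notin> B" if "closed A" "closed B" "?H (A \<inter> B) = 0" for A B
      by (rule AE_I[of _ _ "A \<inter> B"]) (use that in \<open>auto simp: M\<close>)
    \<comment> \<open>Seen through the chart of one face, the common part has another coordinate
      equal to 1 and lies in a hyperplane.\<close>
    have FF: "AE w in ?M. w \<notin> ?F b \<or> w \<notin> ?F b'" if b: "b \<in> Basis" "b' \<in> Basis" "b \<noteq> b'" for b b'
    proof (rule ae[OF F_closed F_closed])
      have "?H (?F b \<inter> ?F b') = ?H' (replace_coord b ` (?F b \<inter> ?F b'))"
        by (rule chart[OF _ b(1)]) auto
      also have "\<dots> = 0"
      proof (rule null[OF _ b(2)], rule subsetI)
        fix x assume "x \<in> replace_coord b ` (?F b \<inter> ?F b')"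
        then obtain z y where x: "x = replace_coord b (z, y)" "z \<in> cbox 0 One" "z \<bullet> b' = 1" "2 - t \<le> y" "y \<le> 1"
          by (auto simp: F_def)
        have "0 \<le> x \<bullet> c \<and> x \<bullet> c \<le> 1" if "c \<in> Basis" for c
          using x that b t by (auto simp: inner_replace_coord mem_box)
        moreover have "x \<bullet> b' = 1" using x b by (simp add: inner_replace_coord)
        ultimately show "x \<in> ?E b'" by (simp add: mem_box)
      qed
      finally show "?H (?F b \<inter> ?F b') = 0" .
    qed
    have TF: "AE w in ?M. w \<notin> ?T1 \<or> w \<notin> ?F b" if b: "b \<in> Basis" for b
    proof (rule ae[OF _ F_closed])
      have "?T1 = cbox 0 One \<times> {1}" by auto
      moreover have "closed (cbox 0 (One::'a) \<times> {1::real})" by (intro closed_Times) auto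
      ultimately show "closed ?T1" by simp
      have "?T1 \<inter> ?F b \<subseteq> ?T (?E b)" by (auto simp: F_def)
      then have "?H (?T1 \<inter> ?F b) \<le> ?H' (?E b)" unfolding top[symmetric] by (rule hausdorff_measure_subset)
      then show "?H (?T1 \<inter> ?F b) = 0" using null[OF order_refl b] by simp
    qed
    have U_meas: "(\<Union>b\<in>Basis. ?F b) \<in> fmeasurable ?M" using Fb(1) by (intro fmeasurable.finite_UN) auto
    have "AE w in ?M. \<forall>b\<in>Basis. w \<notin> ?T1 \<or> w \<notin> ?F b" using TF by (intro AE_finite_allI) auto
    then have "AE w in ?M. w \<notin> ?T1 \<or> w \<notin> (\<Union>b\<in>Basis. ?F b)" by (rule AE_mp) auto
    then have "measure ?M (cap \<infinity> t) = measure ?M ?T1 + measure ?M (\<Union>b\<in>Basis. ?F b)"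
      unfolding cap by (rule measure_Un_AE[OF _ T1(1) U_meas])
    also have "measure ?M (\<Union>b\<in>Basis. ?F b) = (\<Sum>b\<in>Basis. measure ?M (?F b))"
      by (rule measure_UNION_AE) (use Fb FF in \<open>auto simp: pairwise_def\<close>)
    also have "\<dots> = ?k * (\<kappa> * (t - 1))" by (simp add: Fb(2))
    finally have "measure ?M (cap \<infinity> t) = \<kappa> * (1 + ?k * (t - 1))" by (simp add: T1(2) algebra_simps)
    moreover have "cap \<infinity> t \<in> sets ?M"
      unfolding cap by (intro sets.Un fmeasurableD T1 U_meas)
    ultimately show "hyper_area TYPE('a) q \<infinity> t = \<kappa> * (1 + ?k * (t - 1))"
      by (simp add: hyper_area_def measure_def M)
  qed
qed

section \<open>Volumes of the cones over the caps of the cube\<close>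

lemma cone_cap_inf_top:
  assumes t: "0 \<le> t" "t \<le> 1"
  shows "{s *\<^sub>R w | s w. s \<in> {0..1} \<and> w \<in> (cap \<infinity> t :: ('a::euclidean_space \<times> real) set)} =
    {(z, y). y \<in> {0..1} \<and> z \<in> cbox 0 ((t * y) *\<^sub>R One)}"
proof (intro equalityI subsetI)
  fix v assume "v \<in> {s *\<^sub>R w | s w. s \<in> {0..1} \<and> w \<in> (cap \<infinity> t :: ('a \<times> real) set)}"
  then obtain s w where sw: "v = s *\<^sub>R w" "0 \<le> s" "s \<le> 1" "w \<in> cap \<infinity> t" by auto
  then obtain z where z: "w = (z, 1)" "z \<in> cbox 0 (t *\<^sub>R One)"
    unfolding cap_inf_top[OF t] orthant_ball_inf[OF t(1)] by blast
  have v: "v = (s *\<^sub>R z, s)" "0 \<le> s" "s \<le> 1" "z \<in> cbox 0 (t *\<^sub>R One)" using sw z by auto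
  then show "v \<in> {(z, y). y \<in> {0..1} \<and> z \<in> cbox 0 ((t * y) *\<^sub>R One)}"
    by (auto simp: mem_box mult.commute[of t] intro: mult_left_mono)
next
  fix v assume "v \<in> {(z :: 'a, y). y \<in> {0..1} \<and> z \<in> cbox 0 ((t * y) *\<^sub>R One)}"
  then obtain z y where v: "v = (z, y)" "0 \<le> y" "y \<le> 1" "z \<in> cbox 0 ((t * y) *\<^sub>R One)" by auto
  define x where "x = (1 / y) *\<^sub>R z"
  have "z = y *\<^sub>R x \<and> x \<in> cbox 0 (t *\<^sub>R One)"
  proof (cases "y = 0")
    case True
    then have "z \<in> cbox 0 0" using v by simp
    then have "z = 0" by (simp add: cbox_idem)
    then show ?thesis using True t by (simp add: x_def mem_box)
  next
    case False
    then show ?thesis using v by (auto simp: x_def mem_box field_simps)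
  qed
  then have "v = y *\<^sub>R (x, 1)" "(x, 1) \<in> (cap \<infinity> t :: ('a \<times> real) set)"
    using v unfolding cap_inf_top[OF t] orthant_ball_inf[OF t(1)] by auto
  then show "v \<in> {s *\<^sub>R w | s w. s \<in> {0..1} \<and> w \<in> (cap \<infinity> t :: ('a \<times> real) set)}"
    using v by (intro CollectI exI[of _ y] exI[of _ "(x, 1)"]) auto
qed

lemma cone_cap_inf_side:
  assumes t: "1 \<le> t" "t \<le> 2"
  shows "{s *\<^sub>R w | s w. s \<in> {0..1} \<and> w \<in> (cap \<infinity> t :: ('a::euclidean_space \<times> real) set)} =
    {(z, y). z \<in> orthant_ball \<infinity> 1 \<and> (2 - t) * pnorm \<infinity> z \<le> y \<and> y \<le> 1}" (is "?L = ?R")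
proof (intro equalityI subsetI)
  fix v assume "v \<in> ?L"
  then obtain s w where v: "v = s *\<^sub>R w" "0 \<le> s" "s \<le> 1" "w \<in> cap \<infinity> t" by auto
  then obtain z y where w: "w = (z, y)" "z \<in> orthant_ball \<infinity> 1" "(2 - t) * pnorm \<infinity> z \<le> y" "y \<le> 1"
    using t unfolding cap_inf_side[OF t] by (auto simp: orthant_ball_def unsigned_sphere_def mult_le_one pnorm_nonneg)
  have "s * ((2 - t) * pnorm \<infinity> z) \<le> s * y" using w v by (intro mult_left_mono) auto
  moreover have "s * y \<le> 1" using mult_left_mono[OF w(4) v(2)] v(3) by simp
  moreover have "s * pnorm \<infinity> z \<le> 1" using v w by (auto simp: orthant_ball_def pnorm_nonneg intro: mult_le_one)
  ultimately show "v \<in> ?R" using v w by (auto simp: orthant_ball_def pnorm_scaleR mult.left_commute)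
next
  fix v assume "v \<in> ?R"
  then obtain z y where v: "v = (z, y)" "z \<in> orthant_ball \<infinity> 1" "(2 - t) * pnorm \<infinity> z \<le> y" "y \<le> 1" by auto
  have n: "0 \<le> pnorm \<infinity> z" "pnorm \<infinity> z \<le> 1" using v by (auto simp: orthant_ball_def pnorm_nonneg)
  have "0 \<le> (2 - t) * pnorm \<infinity> z" using n t by simp
  then have y0: "0 \<le> y" using v by linarith
  \<comment> \<open>The scaling factor is the max-norm of the point; whether it is attained by the
    height or by the base decides between top face and side strip.\<close>
  define s where "s = max y (pnorm \<infinity> z)"
  have s: "0 \<le> s" "s \<le> 1" "y \<le> s" "pnorm \<infinity> z \<le> s" using y0 n v by (auto simp: s_def)
  show "v \<in> ?L"
  proof (cases "s = 0")
    case True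
    then have "v = 0 *\<^sub>R (0, 1)" using s y0 n pnorm_eq_0_iff[of \<infinity> z] v(1) by (auto simp: zero_prod_def)
    moreover have "(0, 1) \<in> (cap \<infinity> t :: ('a \<times> real) set)"
      unfolding cap_inf_side[OF t] by (auto simp: orthant_ball_def)
    ultimately show ?thesis by (intro CollectI exI[of _ "0::real"] exI[of _ "(0, 1)"]) auto
  next
    case False
    then have s0: "0 < s" using s by simp
    let ?z = "(1 / s) *\<^sub>R z"
    have nz: "pnorm \<infinity> ?z = pnorm \<infinity> z / s" using s0 by (simp add: pnorm_scaleR)
    have oz: "\<forall>b\<in>Basis. 0 \<le> ?z \<bullet> b" using v s0 by (auto simp: orthant_ball_def)
    have "(?z, y / s) \<in> cap \<infinity> t"
    proof (cases "pnorm \<infinity> z \<le> y")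
      case True
      then have "y / s = 1" using s0 by (simp add: s_def)
      then have "(?z, y / s) = (\<lambda>z. (z, 1)) ?z" by simp
      moreover have "?z \<in> orthant_ball \<infinity> 1" using oz s s0 by (simp add: orthant_ball_def nz)
      ultimately show ?thesis unfolding cap_inf_side[OF t] by blast
    next
      case False
      then have sz: "s = pnorm \<infinity> z" by (simp add: s_def)
      have "pnorm \<infinity> ?z = 1" unfolding nz sz[symmetric] using s0 by simp
      then have "?z \<in> unsigned_sphere \<infinity>" using oz by (simp add: unsigned_sphere_def)
      moreover have "2 - t \<le> y / s" "y / s \<le> 1"
        using s0 s v(3) unfolding sz[symmetric] by (simp_all add: pos_le_divide_eq)
      ultimately show ?thesis unfolding cap_inf_side[OF t] by simp
    qed
    moreover have "v = s *\<^sub>R (?z, y / s)" using s0 v by simp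
    ultimately show ?thesis
      by (intro CollectI exI[of _ s] exI[of _ "(?z, y / s)"] conjI) (simp_all add: s)
  qed
qed

text \<open>The slice of the cone at height y is a cube of side t y; its volume is integrated over y
  from 0 to 1.\<close>

lemma cube_volume_top:
  assumes t: "0 \<le> t" "t \<le> 1"
  shows "hyper_volume TYPE('a::euclidean_space) \<infinity> t = t ^ DIM('a) / (real DIM('a) + 1)"
proof -
  let ?k = "DIM('a)"
  let ?W = "{(z :: 'a, y). y \<in> {0..1} \<and> z \<in> cbox 0 ((t * y) *\<^sub>R One)}"
  have "closed ?W"
  proof -
    have "?W = {w. 0 \<le> snd w} \<inter> {w. snd w \<le> 1} \<inter> (\<Inter>b\<in>Basis. {w. 0 \<le> fst w \<bullet> b} \<inter> {w. fst w \<bullet> b \<le> t * snd w})"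
      by (auto simp: mem_box)
    also have "closed \<dots>"
      by (intro closed_Int closed_INT ballI closed_Collect_le continuous_intros)
    finally show ?thesis .
  qed
  then have W: "?W \<in> sets borel" by simp
  have "emeasure lborel ?W = emeasure (lborel \<Otimes>\<^sub>M lborel) ?W" by (simp add: lborel_prod)
  also have "\<dots> = (\<integral>\<^sup>+y. emeasure lborel ((\<lambda>z. (z, y)) -` ?W) \<partial>lborel)"
    by (rule lborel_pair.emeasure_pair_measure_alt2) (simp only: lborel_prod sets_lborel W)
  also have "\<dots> = (\<integral>\<^sup>+y. ennreal ((t * y) ^ ?k) * indicator {0..1} y \<partial>lborel)"
  proof (rule nn_integral_cong)
    fix y :: real
    have "(\<lambda>z. (z, y)) -` ?W = (if y \<in> {0..1} then cbox 0 ((t * y) *\<^sub>R One) else {})" by auto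
    moreover have "emeasure lborel (cbox 0 ((t * y) *\<^sub>R (One::'a))) = ennreal ((t * y) ^ ?k)" if "0 \<le> y"
      using t that by (simp add: emeasure_lborel_cbox_eq)
    ultimately show "emeasure lborel ((\<lambda>z. (z, y)) -` ?W) = ennreal ((t * y) ^ ?k) * indicator {0..1} y"
      by (simp add: indicator_def)
  qed
  also have "\<dots> = ennreal (t ^ ?k * 1 ^ (?k + 1) / (real ?k + 1) - t ^ ?k * 0 ^ (?k + 1) / (real ?k + 1))"
  proof (rule nn_integral_FTC_Icc[where F = "\<lambda>y. t ^ ?k * y ^ (?k + 1) / (real ?k + 1)"])
    fix y :: real assume y: "y \<in> {0..1}"
    have "real ?k + 1 \<noteq> 0" by linarith
    then have "t ^ ?k * (real (?k + 1) * y ^ (?k + 1 - Suc 0)) / (real ?k + 1) = (t * y) ^ ?k"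
      by (simp add: power_mult_distrib add.commute)
    then show "((\<lambda>y. t ^ ?k * y ^ (?k + 1) / (real ?k + 1)) has_real_derivative (t * y) ^ ?k) (at y)"
      using DERIV_cdivide[OF DERIV_cmult[OF DERIV_pow[of "?k + 1" y UNIV]], of "t ^ ?k" "real ?k + 1"]
      by (simp add: add.commute power_mult_distrib)
    show "0 \<le> (t * y) ^ ?k" using t y by simp
  qed auto
  finally have em: "emeasure lborel ?W = ennreal (t ^ ?k / (real ?k + 1))" by simp
  have m: "measure lborel ?W = t ^ ?k / (real ?k + 1)"
    unfolding measure_def em using t by simp
  show ?thesis
    unfolding hyper_volume_def cone_cap_inf_top[OF t]
    by (subst measure_completion) (simp_all only: m sets_lborel W)
qed

text \<open>The volume is affine in t, namely 1 - (2 - t) J with J the integral of the max-norm over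
  the unit cube. J is never integrated directly but read off at t = 1.\<close>

lemma cube_volume_side:
  assumes t: "1 \<le> t" "t \<le> 2"
  shows "hyper_volume TYPE('a::euclidean_space) \<infinity> t = (1 + real DIM('a) * (t - 1)) / (real DIM('a) + 1)"
proof -
  let ?k = "DIM('a)"
  let ?B = "orthant_ball \<infinity> 1 :: 'a set"
  define J where "J = (\<integral>z. indicator ?B z * pnorm \<infinity> z \<partial>lborel)"
  have B_eq: "?B = cbox 0 One" using orthant_ball_inf[of 1, where 'a = 'a] by simp
  have N: "0 \<le> pnorm \<infinity> z" "pnorm \<infinity> z \<le> 1" if "z \<in> ?B" for z using that by (auto simp: orthant_ball_def pnorm_nonneg)
  have [measurable]: "pnorm \<infinity> \<in> borel_measurable (borel :: 'a measure)" by (rule borel_measurable_pnorm) simp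
  have [measurable]: "?B \<in> sets borel" by (simp add: B_eq)
  have ge1: "hyper_volume TYPE('a) \<infinity> t = 1 - (2 - t) * J" if t: "1 \<le> t" "t \<le> 2" for t
  proof -
    let ?W = "{(z :: 'a, y). z \<in> ?B \<and> (2 - t) * pnorm \<infinity> z \<le> y \<and> y \<le> 1}"
    have "?W \<in> sets (borel \<Otimes>\<^sub>M borel)"
    proof -
      have "?W = {w \<in> space (borel \<Otimes>\<^sub>M borel). fst w \<in> ?B \<and> (2 - t) * pnorm \<infinity> (fst w) \<le> snd w \<and> snd w \<le> 1}"
        by (auto simp: space_pair_measure)
      also have "\<dots> \<in> sets (borel \<Otimes>\<^sub>M borel)" by measurable
      finally show ?thesis .
    qed
    then have W: "?W \<in> sets borel" unfolding borel_prod .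
    have bnd: "0 \<le> 1 - (2 - t) * pnorm \<infinity> z" "1 - (2 - t) * pnorm \<infinity> z \<le> 1" if "z \<in> ?B" for z
      using N[OF that] t by (auto intro: mult_le_one)
    have int1: "integrable lborel (\<lambda>z. indicator ?B z * (1::real))"
      by (rule integrable_on_orthant_ball[where C = 1]) auto
    have intN: "integrable lborel (\<lambda>z. indicator ?B z * pnorm \<infinity> z)"
      by (rule integrable_on_orthant_ball[where C = 1]) (use N in auto)
    have "emeasure lborel ?W = emeasure (lborel \<Otimes>\<^sub>M lborel) ?W" by (simp add: lborel_prod)
    also have "\<dots> = (\<integral>\<^sup>+z. emeasure lborel (Pair z -` ?W) \<partial>lborel)"
      by (rule lborel.emeasure_pair_measure_alt) (simp only: lborel_prod sets_lborel W)
    also have "\<dots> = (\<integral>\<^sup>+z. ennreal (indicator ?B z * 1 - (2 - t) * (indicator ?B z * pnorm \<infinity> z)) \<partial>lborel)"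
    proof (rule nn_integral_cong)
      fix z :: 'a
      have "Pair z -` ?W = (if z \<in> ?B then {(2 - t) * pnorm \<infinity> z..1} else {})" by auto
      then show "emeasure lborel (Pair z -` ?W) = ennreal (indicator ?B z * 1 - (2 - t) * (indicator ?B z * pnorm \<infinity> z))"
        using bnd[of z] by (auto simp: indicator_def)
    qed
    also have "\<dots> = ennreal (\<integral>z. indicator ?B z * 1 - (2 - t) * (indicator ?B z * pnorm \<infinity> z) \<partial>lborel)"
    proof (rule nn_integral_eq_integral)
      show "integrable lborel (\<lambda>z. indicator ?B z * 1 - (2 - t) * (indicator ?B z * pnorm \<infinity> z))"
        using int1 intN by simp
      show "AE z in lborel. 0 \<le> indicator ?B z * 1 - (2 - t) * (indicator ?B z * pnorm \<infinity> z)"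
        using bnd(1) by (auto simp: indicator_def)
    qed
    also have "(\<integral>z. indicator ?B z * 1 - (2 - t) * (indicator ?B z * pnorm \<infinity> z) \<partial>lborel) = 1 - (2 - t) * J"
    proof -
      have "(\<integral>z. indicator ?B z * 1 - (2 - t) * (indicator ?B z * pnorm \<infinity> z) \<partial>lborel) =
          (\<integral>z. indicator ?B z * (1::real) \<partial>lborel) - (2 - t) * J"
        using int1 intN by (simp add: J_def)
      also have "(\<integral>z. indicator ?B z * (1::real) \<partial>lborel) = 1" by (simp add: B_eq)
      finally show ?thesis .
    qed
    finally have em: "emeasure lborel ?W = ennreal (1 - (2 - t) * J)" .
    have "0 \<le> 1 - (2 - t) * J"
    proof -
      have "J \<le> (\<integral>z. indicator ?B z * (1::real) \<partial>lborel)"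
        unfolding J_def by (rule integral_mono[OF intN int1]) (use N in \<open>auto simp: indicator_def\<close>)
      then have "J \<le> 1" by (simp add: B_eq)
      moreover have "0 \<le> J" unfolding J_def using N by (intro integral_nonneg_AE) (auto simp: indicator_def)
      ultimately show ?thesis using t by (simp add: mult_le_one)
    qed
    then show ?thesis
      unfolding hyper_volume_def cone_cap_inf_side[OF t]
      using W by (subst measure_completion) (simp_all add: measure_def em)
  qed
  \<comment> \<open>At t = 1 both descriptions of the cap apply, which determines J.\<close>
  have "1 / (real ?k + 1) = 1 - J"
    using cube_volume_top[of 1, where 'a = 'a] ge1[of 1] by simp
  then have J: "J = 1 - 1 / (real ?k + 1)" by simp
  have "real ?k + 1 \<noteq> 0" by linarith
  then show ?thesis using ge1[OF t] by (simp add: J field_simps)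
qed

subsection \<open>The main theorem\<close>

lemma hyper_volume_real:
  assumes "0 < r" "t \<in> {0..squig_pi (ereal r) / 2}"
  shows "hyper_volume TYPE('a::euclidean_space) (ereal r) t =
    measure lebesgue {\<sigma> *\<^sub>R w | \<sigma> w. \<sigma> \<in> {0..1} \<and>
      w \<in> graph_map r ` (orthant_ball (ereal r) (squig_sin (ereal r) t) :: 'a set)}"
  unfolding hyper_volume_def cap_eq_graph[OF assms] ..

lemma hyper_area_real:
  assumes "0 < r" "t \<in> {0..squig_pi (ereal r) / 2}"
  shows "hyper_area TYPE('a::euclidean_space) q (ereal r) t =
    enn2real (hausdorff_measure (pdist q) DIM('a)
      (graph_map r ` (orthant_ball (ereal r) (squig_sin (ereal r) t) :: 'a set)))"
  unfolding hyper_area_def cap_eq_graph[OF assms] ..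

text \<open>Equality of the ratios makes area a fixed positive multiple of volume in the parameter
  s, which is impossible for these exponents.\<close>

lemma ratios_differ:
  assumes r: "0 < r" "r \<noteq> 1" "r \<noteq> 2"
    and ratio: "\<forall>t\<in>{0..squig_pi (ereal r) / 2}.
      hyper_volume TYPE('a::euclidean_space) (ereal r) t / hyper_volume TYPE('a) (ereal r) (squig_pi (ereal r) / 2) =
      hyper_area TYPE('a) (ereal r) (ereal r) t / hyper_area TYPE('a) (ereal r) (ereal r) (squig_pi (ereal r) / 2)"
  shows False
proof -
  let ?b = "squig_pi (ereal r) / 2"
  let ?G = "\<lambda>s. graph_map r ` (orthant_ball (ereal r) s :: 'a set)"
  let ?H = "\<lambda>s. hausdorff_measure (pdist (ereal r)) DIM('a) (?G s)"
  let ?V = "\<lambda>s. s ^ DIM('a) * cone_density TYPE('a) r s"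
  have b: "?b \<in> {0..?b}" using squig_pi_pos[OF r(1)] by simp
  have V1: "0 < ?V 1" using cone_density_1_pos[OF r(1), where 'a = 'a] by simp
  have eq: "?V s / ?V 1 = enn2real (?H s) / enn2real (?H 1)" if s: "0 < s" "s \<le> 1" for s
  proof -
    define t where "t = squig_arcsin r s"
    have "s \<in> {0..1}" using s by simp
    then have t: "t \<in> {0..?b}" and sin_t: "squig_sin (ereal r) t = s"
      using squig_arcsin_image[OF r(1)] squig_sin_arcsin[OF r(1)] by (auto simp: t_def)
    have "hyper_volume TYPE('a) (ereal r) t / hyper_volume TYPE('a) (ereal r) ?b =
      hyper_area TYPE('a) (ereal r) (ereal r) t / hyper_area TYPE('a) (ereal r) (ereal r) ?b"
      using ratio t by blast
    then show ?thesis
      unfolding hyper_volume_real[OF r(1) t] hyper_volume_real[OF r(1) b] hyper_area_real[OF r(1) t]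
        hyper_area_real[OF r(1) b] sin_t squig_sin_end[OF r(1)] measure_cone_graph[OF r(1) s]
        measure_cone_graph[OF r(1) zero_less_one order_refl] .
  qed
  \<comment> \<open>If the total area were 0 or infinite, \<open>enn2real\<close> would be 0 and the
    quotient at s = 1 would read 1 = 0. So the equation itself yields the finiteness that makes
    \<open>enn2real\<close> faithful.\<close>
  have H1: "0 < enn2real (?H 1)" using eq[of 1] V1 by (cases "enn2real (?H 1) = 0") (auto simp: less_le)
  define l where "l = enn2real (?H 1) / ?V 1"
  show False
  proof (rule area_not_proportional_to_volume[OF r])
    show "0 < l" using H1 V1 by (simp add: l_def)
    fix s :: real assume s: "0 < s" "s \<le> 1"
    have "?H s \<le> ?H 1"
      using s by (intro hausdorff_measure_subset image_mono) (auto simp: orthant_ball_def)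
    also have "?H 1 < top" using H1 by (auto simp: enn2real_positive_iff)
    finally have "?H s = ennreal (enn2real (?H s))" by simp
    also have "enn2real (?H s) = l * ?V s" using eq[OF s] V1 H1 by (simp add: l_def field_simps)
    finally show "?H s = ennreal (l * ?V s)" .
  qed
qed

text \<open>Volume and area are both constant multiples of s^k. The value s = 0 is treated
  separately because the scaling results concern positive s.\<close>

lemma ratios_agree_1:
  assumes q: "0 < q" and t: "t \<in> {0..squig_pi 1 / 2}"
  shows "hyper_volume TYPE('a::euclidean_space) 1 t / hyper_volume TYPE('a) 1 (squig_pi 1 / 2) =
    hyper_area TYPE('a) q 1 t / hyper_area TYPE('a) q 1 (squig_pi 1 / 2)"
proof -
  have one: "(1 :: ereal) = ereal 1" by (simp add: one_ereal_def)
  have t': "t \<in> {0..squig_pi (ereal 1) / 2}" using t by (simp add: one)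
  have r: "0 < (1::real)" by simp
  have b: "squig_pi (ereal 1) / 2 \<in> {0..squig_pi (ereal 1) / 2}" using squig_pi_pos[OF r] by simp
  define s where "s = squig_sin (ereal 1) t"
  have s: "0 \<le> s" "s \<le> 1" using squig_sin_in_unit[OF r t'] by (auto simp: s_def)
  obtain h where h: "0 < h" "\<And>s. 0 < s \<Longrightarrow> s \<le> 1 \<Longrightarrow> enn2real (hausdorff_measure (pdist q) DIM('a)
       (graph_map 1 ` (orthant_ball (ereal 1) s :: 'a set))) = s ^ DIM('a) * h"
    using simplex_area[OF q] by metis
  have V: "hyper_volume TYPE('a) (ereal 1) t = s ^ DIM('a) * cone_density TYPE('a) 1 1"
  proof (cases "s = 0")
    case True
    then show ?thesis
      using measure_cone_point[where 'a = 'a]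
      unfolding hyper_volume_real[OF r t'] s_def[symmetric] by (simp add: orthant_ball_0 graph_map_def del: ereal_eq_1)
  next
    case False
    then have "0 < s" using s by simp
    then show ?thesis
      unfolding hyper_volume_real[OF r t'] s_def[symmetric] measure_cone_graph[OF r \<open>0 < s\<close> s(2)]
      using cone_density_one[of s, where 'a = 'a] s by simp
  qed
  have A: "hyper_area TYPE('a) q (ereal 1) t = s ^ DIM('a) * h"
  proof (cases "s = 0")
    case True
    then show ?thesis
      unfolding hyper_area_real[OF r t'] s_def[symmetric]
      by (simp add: orthant_ball_0 hausdorff_measure_singleton[OF q])
  next
    case False
    then show ?thesis unfolding hyper_area_real[OF r t'] s_def[symmetric] using h s by simp
  qed
  have Vb: "hyper_volume TYPE('a) (ereal 1) (squig_pi (ereal 1) / 2) = cone_density TYPE('a) 1 1"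
    unfolding hyper_volume_real[OF r b] squig_sin_end[OF r] measure_cone_graph[OF r zero_less_one order_refl] by simp
  have Ab: "hyper_area TYPE('a) q (ereal 1) (squig_pi (ereal 1) / 2) = h"
    unfolding hyper_area_real[OF r b] squig_sin_end[OF r] using h(2)[of 1] by simp
  show ?thesis
    unfolding one V A Vb Ab using h(1) cone_density_1_pos[OF r, where 'a = 'a] by simp
qed

lemma ratios_agree_2:
  assumes t: "t \<in> {0..squig_pi 2 / 2}"
  shows "hyper_volume TYPE('a::euclidean_space) 2 t / hyper_volume TYPE('a) 2 (squig_pi 2 / 2) =
    hyper_area TYPE('a) 2 2 t / hyper_area TYPE('a) 2 2 (squig_pi 2 / 2)"
proof -
  have two: "(2 :: ereal) = ereal 2" by simp
  have r: "0 < (2::real)" by simp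
  obtain c where c: "0 < c" "\<And>A :: ('a \<times> real) set. closed A \<Longrightarrow> A \<subseteq> sphere 0 1 \<Longrightarrow>
      enn2real (hausdorff_measure (pdist (ereal 2)) DIM('a) A) =
      c * measure lebesgue {s *\<^sub>R y | s y. s \<in> {0..1} \<and> y \<in> A}"
    using hausdorff_sphere_eq_cone[where 'a = 'a] by blast
  have A: "hyper_area TYPE('a) (ereal 2) (ereal 2) u = c * hyper_volume TYPE('a) (ereal 2) u"
    if u: "u \<in> {0..squig_pi (ereal 2) / 2}" for u
  proof -
    have "squig_sin (ereal 2) u \<le> 1" using squig_sin_in_unit[OF r u] by simp
    then show ?thesis
      unfolding hyper_area_real[OF r u] hyper_volume_real[OF r u]
      by (intro c(2) compact_imp_closed compact_graph r graph_subset_sphere)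
  qed
  have t': "t \<in> {0..squig_pi (ereal 2) / 2}" using t by (simp only: two)
  have b: "squig_pi (ereal 2) / 2 \<in> {0..squig_pi (ereal 2) / 2}" using squig_pi_pos[OF r] by simp
  show ?thesis unfolding two A[OF t'] A[OF b] using c(1) by simp
qed

text \<open>On both branches the area is \<kappa> (k + 1) times the volume, with the same
  constant.\<close>

lemma ratios_agree_inf:
  assumes q: "0 < q" and t: "t \<in> {0..squig_pi \<infinity> / 2}"
  shows "hyper_volume TYPE('a::euclidean_space) \<infinity> t / hyper_volume TYPE('a) \<infinity> (squig_pi \<infinity> / 2) =
    hyper_area TYPE('a) q \<infinity> t / hyper_area TYPE('a) q \<infinity> (squig_pi \<infinity> / 2)"
proof -
  obtain \<kappa> :: real where \<kappa>: "0 < \<kappa>"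
    "\<And>t. 0 \<le> t \<Longrightarrow> t \<le> 1 \<Longrightarrow> hyper_area TYPE('a) q \<infinity> t = \<kappa> * t ^ DIM('a)"
    "\<And>t. 1 \<le> t \<Longrightarrow> t \<le> 2 \<Longrightarrow> hyper_area TYPE('a) q \<infinity> t = \<kappa> * (1 + real DIM('a) * (t - 1))"
    using cube_area[OF q, where 'a = 'a] by metis
  have two: "squig_pi \<infinity> / 2 = 2" by (simp add: squig_pi_inf)
  have k: "real DIM('a) + 1 \<noteq> 0" by linarith
  have "hyper_area TYPE('a) q \<infinity> u = \<kappa> * (real DIM('a) + 1) * hyper_volume TYPE('a) \<infinity> u"
    if u: "0 \<le> u" "u \<le> 2" for u
  proof (cases "u \<le> 1")
    case True
    then show ?thesis using k \<kappa>(2)[OF u(1) True] cube_volume_top[OF u(1) True, where 'a = 'a] by simp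
  next
    case False
    then have "1 \<le> u" by simp
    then show ?thesis using k \<kappa>(3)[OF _ u(2)] cube_volume_side[OF _ u(2), where 'a = 'a] by simp
  qed
  then show ?thesis using t \<kappa>(1) k by (simp add: two)
qed

theorem proposition4p1:
  fixes n :: nat and p :: ereal
  assumes "2 \<le> n" and "DIM('a::euclidean_space) = n - 1" and "0 < p"
  shows
    "((\<forall>t\<in>{0..squig_pi p / 2}.
         hyper_volume TYPE('a) p t / hyper_volume TYPE('a) p (squig_pi p / 2)
           = hyper_area TYPE('a) p p t / hyper_area TYPE('a) p p (squig_pi p / 2))
       \<longleftrightarrow> p \<in> {1, 2, \<infinity>})
     \<and>
     ((\<forall>t\<in>{0..squig_pi p / 2}.
         hyper_volume TYPE('a) p t / hyper_volume TYPE('a) p (squig_pi p / 2)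
           = hyper_area TYPE('a) p p t / hyper_area TYPE('a) p p (squig_pi p / 2)
         \<and> hyper_area TYPE('a) p p t / hyper_area TYPE('a) p p (squig_pi p / 2)
           = hyper_area TYPE('a) 2 p t / hyper_area TYPE('a) 2 p (squig_pi p / 2))
       \<longleftrightarrow> p \<in> {1, 2, \<infinity>})"
proof -
  let ?V = "\<lambda>t. hyper_volume TYPE('a) p t / hyper_volume TYPE('a) p (squig_pi p / 2)"
  let ?A = "\<lambda>q t. hyper_area TYPE('a) q p t / hyper_area TYPE('a) q p (squig_pi p / 2)"
  let ?I = "{0..squig_pi p / 2}"
  \<comment> \<open>Letting q range over p and 2 serves both parts of the theorem at once.\<close>
  have agree: "?V t = ?A q t" if "p \<in> {1, 2, \<infinity>}" "q \<in> {p, 2}" "t \<in> ?I" for q t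
  proof -
    have q: "0 < q" using that(2) \<open>0 < p\<close> by auto
    from that(1) consider "p = 1" | "p = 2" | "p = \<infinity>" by blast
    then show ?thesis
    proof cases
      case 1
      show ?thesis using ratios_agree_1[OF q, of t, where 'a = 'a] that(3) unfolding 1 .
    next
      case 2
      then have "q = 2" using that(2) by blast
      then show ?thesis using ratios_agree_2[of t, where 'a = 'a] that(3) unfolding 2 by blast
    next
      case 3
      show ?thesis using ratios_agree_inf[OF q, of t, where 'a = 'a] that(3) unfolding 3 .
    qed
  qed
  have differ: "p \<in> {1, 2, \<infinity>}" if "\<forall>t\<in>?I. ?V t = ?A p t"
  proof (rule ccontr)
    assume not_in: "p \<notin> {1, 2, \<infinity>}"
    obtain r where r: "p = ereal r" "0 < r" using \<open>0 < p\<close> not_in by (cases p rule: ereal_pos_cases) auto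
    then have "r \<noteq> 1" "r \<noteq> 2" using not_in by (auto simp: one_ereal_def)
    then show False using ratios_differ[OF r(2), where 'a = 'a] that unfolding r(1) by blast
  qed
  show ?thesis
  proof (intro conjI iffI)
    assume "p \<in> {1, 2, \<infinity>}"
    then show "\<forall>t\<in>?I. ?V t = ?A p t" using agree by blast
  next
    assume p: "p \<in> {1, 2, \<infinity>}"
    show "\<forall>t\<in>?I. ?V t = ?A p t \<and> ?A p t = ?A 2 t"
    proof (intro ballI conjI)
      fix t assume t: "t \<in> ?I"
      show "?V t = ?A p t" by (rule agree[OF p _ t]) simp
      have "?V t = ?A 2 t" by (rule agree[OF p _ t]) simp
      then show "?A p t = ?A 2 t" using \<open>?V t = ?A p t\<close> by simp
    qed
  next
    assume "\<forall>t\<in>?I. ?V t = ?A p t \<and> ?A p t = ?A 2 t"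
    then show "p \<in> {1, 2, \<infinity>}" by (intro differ) blast
  qed (rule differ)
qed

end
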